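(* Let $m$ and $\alpha$ be positive integers and let $F_m(z)=1+\sum_{\lambda\ge1}f_\lambda(m)z^\lambda$. If $p$ is a prime with $p\equiv1\pmod 6$, then there is a polynomial $\overline P_\alpha(z)\in\mathbb{Z}[z]$ such that $F_m(z)\equiv \overline P_\alpha(z)/Q_{(p-1)/6}(z)^\alpha$ coefficientwise modulo $p^\alpha$, where $Q_{(p-1)/6}(z)$ is a polynomial of degree $(p-1)/6$. If $p$ is a prime with $p\equiv5\pmod 6$, then there is a polynomial $\widehat P_\alpha(z)\in\mathbb{Z}[z]$ such that $F_m(z)\equiv \widehat P_\alpha(z)/Q_{(p-5)/6}(z)^\alpha$ coefficientwise modulo $p^\alpha$, where $Q_{(p-5)/6}(z)$ is a polynomial of degree $(p-5)/6$.
   Context: For a positive integer $m$, $\Gamma_m(3)=\langle x,y\mid x^{2m}=y^{3m}=1,\ x^2=y^3\rangle$ and $f_\lambda(m)$ is the number of free subgroups of index $6m\lambda$ in $\Gamma_m(3)$. For integers $n\ge0$, $Q_n(z)=\sum_{k=0}^n q_{n,k}z^k$, where for $0\le k\le n$ $$q_{n,n-k}=\frac{(-1)^n(6m)^{n-k}}{(\frac23-k)_{2k+1}}\Bigg(\Big(\tfrac56\Big)_{n+1}\sum_{j=0}^k\binom{k+j}{k}\binom{n-j}{k-j}\Big(\tfrac13+j\Big)_{k-j}\Big(\tfrac16\Big)_j-\Big(\tfrac16\Big)_{n+1}\sum_{j=0}^k\binom{k+j}{k}\binom{n-j}{k-j}\Big(\tfrac53+j\Big)_{k-j}\Big(\tfrac56\Big)_j\Bigg),$$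 with $(\alpha)_r=\alpha(\alpha+1)\cdots(\alpha+r-1)$, $(\alpha)_0=1$. (These $q_{n,k}$ are integers and $q_{n,0}=1$; $Q_n$ is the specialization $A=6m-2$, $B=6m$, $C=1$, $D=1-6m+5m^2$, $E=4m$ of the denominator of the Padé-type rational solution of the Riccati equation $(1-Az)F-Bz^2F'-CzF^2-1-Dz=0$.) Since $Q_n(0)=1$, $1/Q_n(z)^\alpha$ is a formal power series with integer coefficients; "$F\equiv P/Q^\alpha$ modulo $p^\alpha$" means that the coefficients of $F$ and $P\cdot Q^{-\alpha}$ agree modulo $p^\alpha$. *)

theory Defs
  imports
    "HOL-Algebra.Coset"
    "HOL-Number_Theory.Cong"
    "HOL-Computational_Algebra.Polynomial_FPS"
begin

text \<open>A letter \<open>(s, True)\<close> stands for the generator \<open>s\<close>, and \<open>(s, False)\<close> for its formal inverse.\<close>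

type_synonym 'g group_word = "('g \<times> bool) list"

definition words :: "'g set \<Rightarrow> 'g group_word set" where
  "words S = lists (S \<times> UNIV)"

text \<open>The least congruence on the words over \<open>S\<close> that cancels inverse letters and contains the
  relations \<open>u = v\<close> for \<open>(u, v) \<in> R\<close>.\<close>

inductive_set word_rel ::
    "'g set \<Rightarrow> ('g group_word \<times> 'g group_word) set \<Rightarrow> ('g group_word \<times> 'g group_word) set"
  for S :: "'g set" and R :: "('g group_word \<times> 'g group_word) set"
where
  refl: "w \<in> words S \<Longrightarrow> (w, w) \<in> word_rel S R"
| sym: "(u, v) \<in> word_rel S R \<Longrightarrow> (v, u) \<in> word_rel S R"
| trans: "(u, v) \<in> word_rel S R \<Longrightarrow> (v, w) \<in> word_rel S R \<Longrightarrow> (u, w) \<in> word_rel S R"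
| append: "(u, v) \<in> word_rel S R \<Longrightarrow> (u', v') \<in> word_rel S R \<Longrightarrow> (u @ u', v @ v') \<in> word_rel S R"
| cancel: "s \<in> S \<Longrightarrow> ([(s, b), (s, \<not> b)], []) \<in> word_rel S R"
| relation: "(u, v) \<in> R \<Longrightarrow> u \<in> words S \<Longrightarrow> v \<in> words S \<Longrightarrow> (u, v) \<in> word_rel S R"

definition presented_group ::
    "'g set \<Rightarrow> ('g group_word \<times> 'g group_word) set \<Rightarrow> 'g group_word set monoid" where
  "presented_group S R =
    \<lparr> carrier = words S // word_rel S R,
      monoid.mult = (\<lambda>A B. \<Union>u\<in>A. \<Union>v\<in>B. word_rel S R `` {u @ v}),
      one = word_rel S R `` {[]} \<rparr>"

text \<open>The basis can be taken inside the group itself, so it is no restriction that \<open>S\<close> has the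
  type of the elements of \<open>G\<close>. The trivial group is free on the empty set.\<close>

definition free_group :: "('a, 'b) monoid_scheme \<Rightarrow> bool" where
  "free_group G \<longleftrightarrow> group G \<and> (\<exists>S :: 'a set. G \<cong> presented_group S {})"

datatype gamma_gen = gen_x | gen_y

definition Gamma3 :: "nat \<Rightarrow> gamma_gen group_word set monoid" where
  "Gamma3 m = presented_group UNIV
    {(replicate (2 * m) (gen_x, True), []),
     (replicate (3 * m) (gen_y, True), []),
     (replicate 2 (gen_x, True), replicate 3 (gen_y, True))}"

definition free_subgroup_number :: "nat \<Rightarrow> nat \<Rightarrow> nat" where
  "free_subgroup_number m l =
    card {H. subgroup H (Gamma3 m) \<and> card (rcosets\<^bsub>Gamma3 m\<^esub> H) = 6 * m * l \<and>
             free_group (Gamma3 m \<lparr>carrier := H\<rparr>)}"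

definition F_series :: "nat \<Rightarrow> rat fps" where
  "F_series m = Abs_fps (\<lambda>l. if l = 0 then 1 else of_nat (free_subgroup_number m l))"

text \<open>\<open>q_rev m n k\<close> is the coefficient of \<open>z\<^sup>n\<^sup>-\<^sup>k\<close> in \<open>Q m n\<close>.\<close>

definition q_rev :: "nat \<Rightarrow> nat \<Rightarrow> nat \<Rightarrow> rat" where
  "q_rev m n k =
    (-1) ^ n * of_nat (6 * m) ^ (n - k) / pochhammer (2/3 - of_nat k) (2 * k + 1) *
    (pochhammer (5/6) (n + 1) *
       (\<Sum>j=0..k. of_nat ((k + j) choose k) * of_nat ((n - j) choose (k - j)) *
          pochhammer (1/3 + of_nat j) (k - j) * pochhammer (1/6) j)
     - pochhammer (1/6) (n + 1) *
       (\<Sum>j=0..k. of_nat ((k + j) choose k) * of_nat ((n - j) choose (k - j)) *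
          pochhammer (5/3 + of_nat j) (k - j) * pochhammer (5/6) j))"

definition q :: "nat \<Rightarrow> nat \<Rightarrow> nat \<Rightarrow> rat" where
  "q m n k = q_rev m n (n - k)"

definition Q :: "nat \<Rightarrow> nat \<Rightarrow> rat poly" where
  "Q m n = (\<Sum>k=0..n. monom (q m n k) k)"

text \<open>Divisibility is trivial in the field of rationals, so congruence of rational power series is
  reduced to congruence of integers; in particular all coefficients are required to be integral.\<close>

definition fps_cong :: "rat fps \<Rightarrow> rat fps \<Rightarrow> int \<Rightarrow> bool" where
  "fps_cong f g N \<longleftrightarrow>
    (\<forall>k. \<exists>a b :: int. fps_nth f k = of_int a \<and> fps_nth g k = of_int b \<and> [a = b] (mod N))"

lemma words_append: "u \<in> words S \<Longrightarrow> v \<in> words S \<Longrightarrow> u @ v \<in> words S"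
  by (simp add: words_def)

lemma Nil_in_words: "[] \<in> words S"
  by (simp add: words_def)

lemma word_rel_in_words: "(u, v) \<in> word_rel S R \<Longrightarrow> u \<in> words S \<and> v \<in> words S"
  by (induction rule: word_rel.induct) (auto simp: words_def)

lemma equiv_word_rel: "equiv (words S) (word_rel S R)"
  by (intro equivI refl_onI symI transI)
     (auto dest: word_rel_in_words intro: word_rel.intros)

lemma congruent2_word_rel:
  "congruent2 (word_rel S R) (word_rel S R) (\<lambda>u v. word_rel S R `` {u @ v})"
  by (rule congruent2I')
     (intro equiv_class_eq[OF equiv_word_rel] word_rel.append)

lemma mult_word_class:
  assumes "u \<in> words S" "v \<in> words S"
  shows "word_rel S R `` {u} \<otimes>\<^bsub>presented_group S R\<^esub> word_rel S R `` {v} = word_rel S R `` {u @ v}"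
  unfolding presented_group_def
  by (simp add: UN_equiv_class2[OF equiv_word_rel equiv_word_rel congruent2_word_rel] assms)

lemma word_rel_inverse:
  "w \<in> words S \<Longrightarrow> (map (\<lambda>(s, b). (s, \<not> b)) (rev w) @ w, []) \<in> word_rel S R"
proof (induction w)
  case Nil
  then show ?case by (simp add: word_rel.refl)
next
  case (Cons x w)
  obtain s b where x: "x = (s, b)" by force
  have s: "s \<in> S" and w: "w \<in> words S"
    using Cons.prems by (auto simp: words_def x)
  let ?w' = "map (\<lambda>(s, b). (s, \<not> b)) (rev w)"
  have w': "?w' \<in> words S" using w by (auto simp: words_def)
  have "([(s, \<not> b), (s, b)], []) \<in> word_rel S R"
    using word_rel.cancel[OF s, of "\<not> b"] by simp
  from word_rel.append[OF this word_rel.refl[OF w]]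
  have "([(s, \<not> b), (s, b)] @ w, w) \<in> word_rel S R" by simp
  from word_rel.append[OF word_rel.refl[OF w'] this]
  have "(?w' @ [(s, \<not> b), (s, b)] @ w, ?w' @ w) \<in> word_rel S R" .
  with Cons.IH[OF w] show ?case
    by (auto simp: x intro: word_rel.trans)
qed

lemma group_presented_group: "group (presented_group S R)"
proof (rule groupI)
  let ?G = "presented_group S R" and ?c = "\<lambda>w. word_rel S R `` {w}"
  have car: "?c w \<in> carrier ?G" if "w \<in> words S" for w
    using that by (simp add: presented_group_def quotientI)
  have ex: "\<exists>w \<in> words S. A = ?c w" if "A \<in> carrier ?G" for A
    using that by (auto simp: presented_group_def elim: quotientE)
  have one: "\<one>\<^bsub>?G\<^esub> = ?c []" by (simp add: presented_group_def)
  show "\<one>\<^bsub>?G\<^esub> \<in> carrier ?G" by (simp add: one car Nil_in_words)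
  show "A \<otimes>\<^bsub>?G\<^esub> B \<in> carrier ?G" if "A \<in> carrier ?G" "B \<in> carrier ?G" for A B
    using ex[OF that(1)] ex[OF that(2)] by (auto simp: mult_word_class words_append car)
  show "A \<otimes>\<^bsub>?G\<^esub> B \<otimes>\<^bsub>?G\<^esub> C = A \<otimes>\<^bsub>?G\<^esub> (B \<otimes>\<^bsub>?G\<^esub> C)"
    if "A \<in> carrier ?G" "B \<in> carrier ?G" "C \<in> carrier ?G" for A B C
    using ex[OF that(1)] ex[OF that(2)] ex[OF that(3)]
    by (auto simp: mult_word_class words_append)
  show "\<one>\<^bsub>?G\<^esub> \<otimes>\<^bsub>?G\<^esub> A = A" if "A \<in> carrier ?G" for A
    using ex[OF that] by (auto simp: one mult_word_class Nil_in_words)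
  show "\<exists>B \<in> carrier ?G. B \<otimes>\<^bsub>?G\<^esub> A = \<one>\<^bsub>?G\<^esub>" if "A \<in> carrier ?G" for A
  proof -
    obtain w where w: "w \<in> words S" "A = ?c w" using ex[OF \<open>A \<in> carrier ?G\<close>] by blast
    let ?w' = "map (\<lambda>(s, b). (s, \<not> b)) (rev w)"
    have w': "?w' \<in> words S" using w(1) by (auto simp: words_def)
    have "?c ?w' \<otimes>\<^bsub>?G\<^esub> A = \<one>\<^bsub>?G\<^esub>"
      unfolding w(2) mult_word_class[OF w' w(1)] one
      by (rule equiv_class_eq[OF equiv_word_rel word_rel_inverse[OF w(1)]])
    then show ?thesis using car[OF w'] by blast
  qed
qed

lemma group_Gamma3: "group (Gamma3 m)"
  unfolding Gamma3_def by (rule group_presented_group)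

end

theory Submission
  imports Defs "HOL-Combinatorics.Cycles"
begin

text \<open>A subgroup \<open>H\<close> of finite index is free iff \<open>x\<close> and \<open>y\<close> act on its cosets with all cycles of full
  length \<open>2 m\<close> and \<open>3 m\<close>. Free groups are torsion-free, which gives one direction; conversely, \<open>H\<close> is then
  the fundamental group of a finite graph, and a spanning tree yields a basis. The number of such actions
  on \<open>6 m k\<close> points is \<open>(6 m k)! h\<^sub>k\<close> with \<open>h\<^sub>k = m\<^sup>k (6 k)! / ((3 k)! (2 k)! 72\<^sup>k)\<close>, and splitting off the
  orbit of a point shows that \<open>h = \<Sum> h\<^sub>k z\<^sup>k\<close> satisfies \<open>F h = h + 6 m z h'\<close>.

  The coefficient \<open>h\<^sub>k\<close> is \<open>k!\<close> times a \<open>p\<close>-adic integer, so \<open>h\<close> is a polynomial modulo each power of \<open>p\<close>.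
  Moreover \<open>h\<close> is the hypergeometric series \<open>2F0(1/6, 5/6; 6 m z)\<close>. The convergents of the continued fraction
  for \<open>2F0(7/6, 5/6) / 2F0(1/6, 5/6)\<close>, whose partial numerators are \<open>5 m z, 7 m z, 11 m z, 13 m z, \<dots>\<close>, have the
  \<open>Q\<^sub>n\<close> among their denominators, and modulo \<open>p\<close> the fraction terminates at the numerator \<open>p m z\<close>; this gives
  \<open>h \<equiv> Q\<^sub>n\<close> modulo \<open>p\<close>. Hence \<open>Q\<^sub>n\<^sup>\<alpha>\<close> is a multiple of \<open>h\<close> modulo \<open>p\<^sup>\<alpha>\<close>, and \<open>F Q\<^sub>n\<^sup>\<alpha>\<close> is a polynomial.\<close>

section \<open>Coefficients of the denominators\<close>

text \<open>The partial numerators contain every prime p > 3 exactly once: p = 6 n + 1 is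
  \<open>cf (2 * n)\<close>, p = 6 n + 5 is \<open>cf (2 * n + 1)\<close>. A numerator that vanishes
  modulo p identifies two neighbouring denominators, so both residue classes lead to
  \<open>Q m n\<close> with n = p div 6. The explicit coefficients of \<open>Q m n\<close> do not
  show the fraction; the link is a three-term recurrence in n, which the fraction yields once every
  other convergent is eliminated. Each of the two weighted sums in \<open>q_rev\<close> satisfies
  it, because b = 1/6 and b = 5/6 both give (1 - 2 b)^2 = 4/9, but only their difference vanishes
  beyond the degree. The numbers h_k are rational with powers of 2 and 3 in the denominator, so
  congruences are expressed by p-adic divisibility and become integer congruences only for F. There
  are (d j)! / (d^j j!) permutations with j cycles of length d; using this for d = 2 m, 3 m and m
  gives the factors m^k and 72^k = 2^(3 k) 3^(2 k) in h_k. Finiteness of the set of free subgroups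
  of given index is a by-product of the count.\<close>

definition pade_sum :: "rat \<Rightarrow> rat \<Rightarrow> nat \<Rightarrow> rat" where
  "pade_sum b x k = (\<Sum>j\<le>k. of_nat ((k + j) choose k) * pochhammer (2 * b + of_nat j) (k - j) *
     pochhammer b j * ((x - of_nat j) gchoose (k - j)))"

lemma gbinomial_diff_one:
  "((x::rat) gchoose Suc n) - ((x - 1) gchoose Suc n) = ((x - 1) gchoose n)"
  using gbinomial_Suc_Suc[of "x - 1" n] by simp

lemma pade_sum_0 [simp]: "pade_sum b x 0 = 1"
  by (simp add: pade_sum_def)

lemma choose_mult_Suc: "(Suc k) * ((k + j) choose Suc k) = j * ((k + j) choose k)"
proof (cases j)
  case 0
  then show ?thesis by (simp add: binomial_eq_0)
next
  case (Suc i)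
  have "(Suc k) * ((k + j) choose Suc k) = (k + j - k) * ((k + j) choose k)"
    using binomial_absorb_comp[of "k + j" k] binomial_absorption[of k "k + j"] Suc
    by (simp only: add_Suc_right diff_Suc_1)
  then show ?thesis by simp
qed

text \<open>Coefficient comparison behind \<open>pade_sum_rec\<close>: both sides there are expanded
  in the binomials C(x - 1 - j, k - j), and this equates the coefficients of the j-th one. It rests
  on (k + 1) C(k + j, k + 1) = j C(k + j, k).\<close>

lemma pade_coeff_rec:
  fixes b :: rat
  assumes "j \<le> k"
  shows "of_nat ((Suc k + j) choose Suc k) * pochhammer (2 * b + of_nat j) (Suc k - j) * pochhammer b j *
      (2 * (1 - b) + of_nat (k - j)) +
     (if j = 0 then 0 else of_nat ((k + j) choose Suc k) *
        pochhammer (2 * b + of_nat (j - 1)) (Suc (Suc k) - j) * pochhammer b (j - 1) * (of_nat (j - 1) + b)) =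
     ((of_nat (Suc k))\<^sup>2 - (1 - 2 * b)\<^sup>2) * (of_nat ((k + j) choose k) *
        pochhammer (2 * b + of_nat j) (k - j) * pochhammer b j)"
proof -
  define C where "C = (of_nat ((k + j) choose k) :: rat)"
  define D where "D = (of_nat ((k + j) choose Suc k) :: rat)"
  have D: "of_nat (Suc k) * D = of_nat j * C"
    unfolding C_def D_def by (metis choose_mult_Suc of_nat_mult)
  have CD: "of_nat ((Suc k + j) choose Suc k) = C + D"
    by (simp add: C_def D_def)
  define p where "p = pochhammer (2 * b + of_nat j) (k - j)"
  have p1: "pochhammer (2 * b + of_nat j) (Suc k - j) = p * (2 * b + of_nat k)"
    using assms by (simp add: p_def Suc_diff_le pochhammer_Suc of_nat_diff)
  have p2: "pochhammer (2 * b + of_nat (j - 1)) (Suc (Suc k) - j) * pochhammer b (j - 1) * (of_nat (j - 1) + b) =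
     (2 * b + of_nat j - 1) * p * (2 * b + of_nat k) * pochhammer b j" if "j \<noteq> 0"
  proof -
    obtain i where i: "j = Suc i" using \<open>j \<noteq> 0\<close> by (cases j) auto
    have "pochhammer (2 * b + of_nat i) (Suc (Suc k - j)) =
        (2 * b + of_nat i) * pochhammer (2 * b + of_nat j) (Suc k - j)"
      by (simp add: pochhammer_rec i algebra_simps)
    moreover have "Suc (Suc k) - j = Suc (Suc k - j)" using assms by simp
    moreover have "pochhammer b j = pochhammer b i * (b + of_nat i)"
      by (simp add: i pochhammer_Suc)
    ultimately show ?thesis using p1 by (simp add: i algebra_simps)
  qed
  have second: "(if j = 0 then 0 else D *
        pochhammer (2 * b + of_nat (j - 1)) (Suc (Suc k) - j) * pochhammer b (j - 1) * (of_nat (j - 1) + b)) =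
     D * ((2 * b + of_nat j - 1) * p * (2 * b + of_nat k) * pochhammer b j)"
  proof (cases "j = 0")
    case True
    then have "D = 0" by (simp add: D_def binomial_eq_0)
    then show ?thesis using True by simp
  next
    case False
    then show ?thesis using p2[OF False] by (simp add: mult.assoc)
  qed
  have "(C + D) * (p * (2 * b + of_nat k)) * pochhammer b j * (2 * (1 - b) + (of_nat k - of_nat j)) +
      D * ((2 * b + of_nat j - 1) * p * (2 * b + of_nat k) * pochhammer b j) =
     p * pochhammer b j * (2 * b + of_nat k) *
       (C * (2 * (1 - b) + (of_nat k - of_nat j)) + of_nat (Suc k) * D)"
    by (simp add: algebra_simps)
  also have "\<dots> = ((of_nat (Suc k))\<^sup>2 - (1 - 2 * b)\<^sup>2) * (C * p * pochhammer b j)"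
    unfolding D by (simp add: power2_eq_square algebra_simps)
  finally show ?thesis
    using second unfolding CD p1 C_def[symmetric] D_def[symmetric] p_def[symmetric] of_nat_diff[OF assms]
    by (simp only: mult.assoc)
qed

text \<open>A second-order difference equation in x, which is why x is a rational variable with
  generalized binomials. Pascal's rule lowers the binomials with each difference, and absorption
  removes the factor depending on x.\<close>

lemma pade_sum_rec:
  "12 * (1 - b) * (pade_sum b x (Suc k) - pade_sum b (x - 1) (Suc k)) +
     (6 * x - 6 + 6 * b) * (pade_sum b x (Suc k) - 2 * pade_sum b (x - 1) (Suc k) + pade_sum b (x - 2) (Suc k)) =
   6 * ((of_nat (Suc k))\<^sup>2 - (1 - 2 * b)\<^sup>2) * pade_sum b (x - 1) k"
proof -
  define a where "a j = of_nat ((Suc k + j) choose Suc k) * pochhammer (2 * b + of_nat j) (Suc k - j) *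
     pochhammer b j" for j
  define g where "g j = ((x - 1 - of_nat j) gchoose (k - j))" for j
  have S: "pade_sum b y (Suc k) = (\<Sum>j\<le>k. a j * ((y - of_nat j) gchoose (Suc (k - j)))) + a (Suc k)" for y
    by (simp add: pade_sum_def a_def Suc_diff_le)
  have d: "pade_sum b y (Suc k) - pade_sum b (y - 1) (Suc k) =
      (\<Sum>j\<le>k. a j * ((y - 1 - of_nat j) gchoose (k - j)))" for y
  proof -
    have "a j * ((y - of_nat j) gchoose (Suc (k - j))) - a j * ((y - 1 - of_nat j) gchoose (Suc (k - j))) =
        a j * ((y - 1 - of_nat j) gchoose (k - j))" for j
      using gbinomial_diff_one[of "y - of_nat j" "k - j"] by (simp add: algebra_simps flip: right_diff_distrib)
    then show ?thesis by (simp add: S sum_subtractf[symmetric])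
  qed
  have d1: "pade_sum b x (Suc k) - pade_sum b (x - 1) (Suc k) = (\<Sum>j\<le>k. a j * g j)"
    by (simp add: d g_def)
  have "pade_sum b x (Suc k) - 2 * pade_sum b (x - 1) (Suc k) + pade_sum b (x - 2) (Suc k) =
      (pade_sum b x (Suc k) - pade_sum b (x - 1) (Suc k)) -
      (pade_sum b (x - 1) (Suc k) - pade_sum b (x - 1 - 1) (Suc k))"
    by (simp add: algebra_simps)
  also have "\<dots> = (\<Sum>j\<le>k. a j * (g j - ((x - 2 - of_nat j) gchoose (k - j))))"
    unfolding d by (simp add: g_def sum_subtractf right_diff_distrib)
  also have "\<dots> = (\<Sum>j<k. a j * g (Suc j))"
  proof -
    have "g j - ((x - 2 - of_nat j) gchoose (k - j)) = g (Suc j)" if "j < k" for j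
    proof -
      define n where "n = k - Suc j"
      have n: "k - j = Suc n" unfolding n_def using that by linarith
      have n': "k - Suc j = n" by (simp only: n_def)
      have e: "x - 2 - of_nat j = (x - 1 - of_nat j) - 1" "x - 1 - of_nat (Suc j) = (x - 1 - of_nat j) - 1"
        by simp_all
      show ?thesis
        unfolding g_def n n' e by (rule gbinomial_diff_one)
    qed
    moreover have "g k - ((x - 2 - of_nat k) gchoose (k - k)) = 0" by (simp add: g_def)
    ultimately show ?thesis by (simp add: lessThan_Suc_atMost[symmetric])
  qed
  finally have d2: "pade_sum b x (Suc k) - 2 * pade_sum b (x - 1) (Suc k) + pade_sum b (x - 2) (Suc k) =
      (\<Sum>j<k. a j * g (Suc j))" .
  \<comment> \<open>The split x - 1 + b = (x - 1 - j) + (j + b) lets absorption replace the part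
    containing x by k - j.\<close>
  have absorb: "(6 * x - 6 + 6 * b) * g (Suc j) = 6 * of_nat (k - j) * g j + 6 * (of_nat j + b) * g (Suc j)"
    if "j < k" for j
  proof -
    define n where "n = k - Suc j"
      have n: "k - j = Suc n" unfolding n_def using that by linarith
    have n': "k - Suc j = n" by (simp only: n_def)
    have e: "x - 1 - of_nat (Suc j) = (x - 1 - of_nat j) - 1" by simp
    have "(x - 1 - of_nat j) * g (Suc j) = of_nat (k - j) * g j"
      unfolding g_def n n' e by (rule gbinomial_absorption[symmetric])
    moreover have "(6 * x - 6 + 6 * b) * g (Suc j) =
        6 * ((x - 1 - of_nat j) * g (Suc j)) + 6 * (of_nat j + b) * g (Suc j)"
      by (simp only: left_diff_distrib distrib_right distrib_left right_diff_distrib mult.assoc)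
    ultimately show ?thesis by (simp only: mult.assoc)
  qed
  have "(6 * x - 6 + 6 * b) * (\<Sum>j<k. a j * g (Suc j)) =
      (\<Sum>j<k. a j * (6 * of_nat (k - j) * g j)) + (\<Sum>j<k. a j * (6 * (of_nat j + b) * g (Suc j)))"
    unfolding sum_distrib_left sum.distrib[symmetric]
  proof (rule sum.cong[OF HOL.refl])
    fix j assume "j \<in> {..<k}"
    then have "j < k" by simp
    show "(6 * x - 6 + 6 * b) * (a j * g (Suc j)) =
        a j * (6 * of_nat (k - j) * g j) + a j * (6 * (of_nat j + b) * g (Suc j))"
      using arg_cong[OF absorb[OF \<open>j < k\<close>], of "\<lambda>t. a j * t"] by (simp only: distrib_left mult.left_commute)
  qed
  also have "(\<Sum>j<k. a j * (6 * of_nat (k - j) * g j)) = (\<Sum>j\<le>k. a j * (6 * of_nat (k - j) * g j))"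
    by (simp add: lessThan_Suc_atMost[symmetric])
  \<comment> \<open>Shifting the index by one puts both sums on the same binomials
    \<open>g j\<close>; the term j = 0 has no predecessor.\<close>
  also have "(\<Sum>j<k. a j * (6 * (of_nat j + b) * g (Suc j))) =
      (\<Sum>j\<le>k. if j = 0 then 0 else a (j - 1) * (6 * (of_nat (j - 1) + b) * g j))"
    by (subst sum.atMost_shift) simp
  finally have "12 * (1 - b) * (\<Sum>j\<le>k. a j * g j) + (6 * x - 6 + 6 * b) * (\<Sum>j<k. a j * g (Suc j)) =
     (\<Sum>j\<le>k. 6 * g j * (a j * (2 * (1 - b) + of_nat (k - j)) +
        (if j = 0 then 0 else a (j - 1) * (of_nat (j - 1) + b))))"
    unfolding sum_distrib_left sum.distrib[symmetric]
    by (simp only: sum.distrib[symmetric] add.assoc[symmetric] sum_distrib_left)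
       (rule sum.cong, auto simp: distrib_left distrib_right left_diff_distrib right_diff_distrib mult_ac)
  also have "\<dots> = (\<Sum>j\<le>k. 6 * g j * (((of_nat (Suc k))\<^sup>2 - (1 - 2 * b)\<^sup>2) * (of_nat ((k + j) choose k) *
        pochhammer (2 * b + of_nat j) (k - j) * pochhammer b j)))"
  proof (rule sum.cong[OF HOL.refl])
    fix j assume "j \<in> {..k}"
    then have j: "j \<le> k" by simp
    have "(if j = 0 then 0 else a (j - 1) * (of_nat (j - 1) + b)) = 
      (if j = 0 then 0 else of_nat ((k + j) choose Suc k) *
        pochhammer (2 * b + of_nat (j - 1)) (Suc (Suc k) - j) * pochhammer b (j - 1) * (of_nat (j - 1) + b))"
    proof (cases j)
      case (Suc i)
      then show ?thesis unfolding a_def using Suc by simp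
    qed simp
    then show "6 * g j * (a j * (2 * (1 - b) + of_nat (k - j)) +
        (if j = 0 then 0 else a (j - 1) * (of_nat (j - 1) + b))) = 
      6 * g j * (((of_nat (Suc k))\<^sup>2 - (1 - 2 * b)\<^sup>2) * (of_nat ((k + j) choose k) *
        pochhammer (2 * b + of_nat j) (k - j) * pochhammer b j))"
      using pade_coeff_rec[OF j, of b] by (simp only: a_def)
  qed
  also have "\<dots> = 6 * ((of_nat (Suc k))\<^sup>2 - (1 - 2 * b)\<^sup>2) * pade_sum b (x - 1) k"
    unfolding pade_sum_def sum_distrib_left by (rule sum.cong[OF HOL.refl]) (simp only: g_def mult_ac)
  finally show ?thesis by (simp only: d1 d2)
qed

definition pade_diff :: "nat \<Rightarrow> nat \<Rightarrow> rat" where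
  "pade_diff n k = pochhammer (5/6) (n + 1) * pade_sum (1/6) (of_nat n) k
     - pochhammer (1/6) (n + 1) * pade_sum (5/6) (of_nat n) k"

text \<open>After multiplication by the Pochhammer prefactors, the difference equations for b = 1/6
  and b = 5/6 acquire identical coefficients, so the recurrence passes to the difference of the two
  sums.\<close>

lemma pade_diff_rec:
  "pade_diff (n + 2) k = (if k = 0 then 0 else ((of_nat k)\<^sup>2 - 4/9) * pade_diff (n + 1) (k - 1)) +
     2 * of_nat (n + 2) * pade_diff (n + 1) k - (of_nat n + 7/6) * (of_nat n + 11/6) * pade_diff n k"
proof -
  \<comment> \<open>At k = 0 the term with k - 1 is absent; the value 0 also masks the truncated
    subtraction.\<close>
  define \<kappa> where "\<kappa> = (if k = 0 then 0 else (of_nat k)\<^sup>2 - 4/9 :: rat)"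
  have rec: "12 * (1 - b) * (pade_sum b (of_nat (n + 2)) k - pade_sum b (of_nat (n + 1)) k) +
     (6 * of_nat n + 6 + 6 * b) * (pade_sum b (of_nat (n + 2)) k - 2 * pade_sum b (of_nat (n + 1)) k
       + pade_sum b (of_nat n) k) =
     6 * \<kappa> * pade_sum b (of_nat (n + 1)) (k - 1)" if "(1 - 2 * b)\<^sup>2 = 4/9" for b
  proof (cases k)
    case (Suc k')
    have e: "of_nat (n + 2) - 1 = (of_nat (n + 1) :: rat)" "of_nat (n + 2) - 2 = (of_nat n :: rat)"
      "6 * of_nat (n + 2) - 6 + 6 * b = 6 * of_nat n + 6 + 6 * b"
      by simp_all
    show ?thesis
      using pade_sum_rec[of b "of_nat (n + 2)" k'] unfolding e that \<kappa>_def Suc by simp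
  qed (simp add: \<kappa>_def)
  define P where "P = (pochhammer (5/6) (n + 1) :: rat)"
  define R where "R = (pochhammer (1/6) (n + 1) :: rat)"
  have P: "pochhammer (5/6) (n + 2 + 1) = P * (of_nat n + 11/6) * (of_nat n + 17/6)"
      "pochhammer (5/6) (n + 1 + 1) = P * (of_nat n + 11/6)"
    and R: "pochhammer (1/6) (n + 2 + 1) = R * (of_nat n + 7/6) * (of_nat n + 13/6)"
      "pochhammer (1/6) (n + 1 + 1) = R * (of_nat n + 7/6)"
    by (simp_all add: P_def R_def pochhammer_Suc eval_nat_numeral algebra_simps)
  have r1: "(of_nat n + 17/6) * pade_sum (1/6) (of_nat (n + 2)) k =
      \<kappa> * pade_sum (1/6) (of_nat (n + 1)) (k - 1) + 2 * of_nat (n + 2) * pade_sum (1/6) (of_nat (n + 1)) k -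
      (of_nat n + 7/6) * pade_sum (1/6) (of_nat n) k"
    using rec[of "1/6"] by (simp add: power2_eq_square field_simps)
  have r2: "(of_nat n + 13/6) * pade_sum (5/6) (of_nat (n + 2)) k =
      \<kappa> * pade_sum (5/6) (of_nat (n + 1)) (k - 1) + 2 * of_nat (n + 2) * pade_sum (5/6) (of_nat (n + 1)) k -
      (of_nat n + 11/6) * pade_sum (5/6) (of_nat n) k"
    using rec[of "5/6"] by (simp add: power2_eq_square field_simps)
  have "pade_diff (n + 2) k =
      P * (of_nat n + 11/6) * ((of_nat n + 17/6) * pade_sum (1/6) (of_nat (n + 2)) k) -
      R * (of_nat n + 7/6) * ((of_nat n + 13/6) * pade_sum (5/6) (of_nat (n + 2)) k)"
    unfolding pade_diff_def P R by (simp only: mult_ac)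
  also have "\<dots> = \<kappa> * pade_diff (n + 1) (k - 1) + 2 * of_nat (n + 2) * pade_diff (n + 1) k
      - (of_nat n + 7/6) * (of_nat n + 11/6) * pade_diff n k"
  proof -
    have ring: "P * u * (c * a + b * d - v * e) - R * v * (c * a' + b * d' - u * e') =
        c * (P * u * a - R * v * a') + b * (P * u * d - R * v * d') - v * u * (P * e - R * e')"
      for u v a b c d e a' d' e' :: rat
      by (simp add: algebra_simps)
    show ?thesis
      unfolding r1 r2 pade_diff_def P R P_def[symmetric] R_def[symmetric] by (rule ring)
  qed
  finally show ?thesis by (simp add: \<kappa>_def)
qed

lemma of_nat_gchoose_eq_0: "n < k \<Longrightarrow> ((of_nat n :: rat) gchoose k) = 0"
  by (simp add: binomial_gbinomial[symmetric] binomial_eq_0)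

text \<open>For k > n the terms with j \<le> n contain C(n - j, k - j) = 0. What remains is
  (b)_(n+1) times a factor free of b, so both products equal (1/6)_(n+1) (5/6)_(n+1) times the same
  number. The recurrence meets these values just beyond the degree.\<close>

lemma pade_diff_eq_0: "pade_diff n (n + 1) = 0" "pade_diff n (n + 2) = 0"
proof -
  have z: "(\<Sum>j\<le>n. f j * ((of_nat n - of_nat j) gchoose (k - j))) = (0 :: rat)" if "n < k" for f k
  proof (rule sum.neutral, intro ballI)
    fix j assume "j \<in> {..n}"
    then have "((of_nat n - of_nat j :: rat) gchoose (k - j)) = 0"
      using of_nat_gchoose_eq_0[of "n - j" "k - j"] that by (simp add: of_nat_diff)
    then show "f j * ((of_nat n - of_nat j) gchoose (k - j)) = 0" by simp
  qed
  have sum1: "pade_sum b (of_nat n) (Suc n) = of_nat ((Suc n + Suc n) choose Suc n) * pochhammer b (Suc n)" for b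
    unfolding pade_sum_def sum.atMost_Suc z[OF lessI] by simp
  show "pade_diff n (n + 1) = 0"
    unfolding pade_diff_def Suc_eq_plus1[symmetric] sum1 by simp
  define c where "c = (of_nat (Suc (Suc n) + Suc n choose Suc (Suc n)) :: rat)"
  \<comment> \<open>A central binomial coefficient is twice its neighbour in the row above.\<close>
  have c: "of_nat (Suc (Suc n) + Suc (Suc n) choose Suc (Suc n)) = 2 * c"
  proof -
    have "(Suc (Suc n) + Suc n) choose Suc n = (Suc (Suc n) + Suc n) choose Suc (Suc n)"
      using binomial_symmetric[of "Suc n" "Suc (Suc n) + Suc n"] by simp
    then have "(Suc (Suc n) + Suc (Suc n)) choose Suc (Suc n) = 2 * ((Suc (Suc n) + Suc n) choose Suc (Suc n))"
      unfolding add_Suc_right[of "Suc (Suc n)" "Suc n"] binomial_Suc_Suc[of "Suc (Suc n) + Suc n" "Suc n"] by simp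
    then show ?thesis unfolding c_def by (simp only: of_nat_mult of_nat_numeral)
  qed
  have n1: "(of_nat n - of_nat (Suc n) :: rat) = - 1" by simp
  have sum2: "pade_sum b (of_nat n) (Suc (Suc n)) = pochhammer b (Suc n) * (c * (of_nat n + 1))" for b
  proof -
    have "pade_sum b (of_nat n) (Suc (Suc n)) =
        c * (2 * b + of_nat (Suc n)) * pochhammer b (Suc n) * (- 1) + 2 * c * pochhammer b (Suc (Suc n))"
      unfolding pade_sum_def sum.atMost_Suc z[OF less_SucI[OF lessI]] c c_def[symmetric] n1 
      by (simp add: pochhammer_Suc0)
    also have "\<dots> = pochhammer b (Suc n) * (c * (of_nat n + 1))"
      unfolding pochhammer_Suc[of b "Suc n"] by (simp add: algebra_simps)
    finally show ?thesis .
  qed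
  have "n + 2 = Suc (Suc n)" by simp
  then show "pade_diff n (n + 2) = 0"
    unfolding pade_diff_def sum2 Suc_eq_plus1[symmetric] by (simp only: sum2 mult.left_commute diff_self)
qed

section \<open>Normalization, three-term recurrence and degree of the polynomials
  \<open>Q m n\<close>\<close>

definition pade_den :: "nat \<Rightarrow> rat" where
  "pade_den k = pochhammer (2/3 - of_nat k) (2 * k + 1)"

text \<open>The product runs over 2/3 + i with |i| \<le> k, and each step adds the factors for i = k
  + 1 and i = - (k + 1). The new factor is the negative of the coefficient of the shifted term in
  \<open>pade_diff_rec\<close>; dividing by \<open>pade_den\<close> turns that coefficient into
  -1.\<close>

lemma pade_den_Suc: "pade_den (Suc k) = (4/9 - (of_nat (Suc k))\<^sup>2) * pade_den k"
proof -
  have "pade_den (Suc k) = (2/3 - of_nat (Suc k)) * pochhammer (2/3 - of_nat k) (Suc (2 * k + 1))"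
    using pochhammer_rec[of "2/3 - of_nat (Suc k) :: rat" "Suc (2 * k + 1)"]
    by (simp add: pade_den_def)
  also have "pochhammer (2/3 - of_nat k) (Suc (2 * k + 1)) = pade_den k * (2/3 + of_nat (Suc k) :: rat)"
    unfolding pochhammer_Suc pade_den_def by simp
  finally show ?thesis by (simp add: power2_eq_square algebra_simps)
qed

lemma pade_den_nonzero: "pade_den k \<noteq> 0"
proof (induction k)
  case 0
  then show ?case by (simp add: pade_den_def)
next
  case (Suc k)
  have "(4/9 :: rat) < 1\<^sup>2" by simp
  also have "\<dots> \<le> (of_nat (Suc k))\<^sup>2" by (rule power_mono) simp_all
  finally show ?case using Suc by (simp add: pade_den_Suc del: of_nat_Suc)
qed

lemma q_rev_eq:
  assumes "k \<le> n"
  shows "q_rev m n k = (- 1) ^ n * of_nat (6 * m) ^ (n - k) / pade_den k * pade_diff n k"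
proof -
  have "of_nat ((n - j) choose (k - j)) = ((of_nat n - of_nat j :: rat) gchoose (k - j))" if "j \<le> k" for j
    using that assms by (simp add: binomial_gbinomial of_nat_diff)
  then have "(\<Sum>j=0..k. of_nat ((k + j) choose k) * of_nat ((n - j) choose (k - j)) *
        pochhammer (2 * b + of_nat j) (k - j) * pochhammer b j) = pade_sum b (of_nat n) k" for b :: rat
    unfolding pade_sum_def atLeast0AtMost by (intro sum.cong) (simp_all add: mult_ac)
  from this[of "1/6"] this[of "5/6"] show ?thesis
    unfolding q_rev_def pade_den_def pade_diff_def by simp
qed

lemma coeff_Q: "coeff (Q m n) i = (if i \<le> n then q m n i else 0)"
  by (simp add: Q_def coeff_sum)

lemma pade_den_0: "pade_den 0 = 2/3"
  by (simp add: pade_den_def)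

lemma pade_diff_small: "pade_diff 0 0 = 2/3" "pade_diff 1 0 = 4/3" "pade_diff 1 1 = 10/27"
proof -
  have "pade_sum b 1 1 = 4 * b" for b
    by (simp add: pade_sum_def numeral_2_eq_2)
  then show "pade_diff 0 0 = 2/3" "pade_diff 1 0 = 4/3" "pade_diff 1 1 = 10/27"
    by (simp_all add: pade_diff_def pochhammer_Suc)
qed

lemma Q_0: "Q m 0 = 1"
proof (rule poly_eqI)
  fix i
  show "coeff (Q m 0) i = coeff 1 i"
    using q_rev_eq[of 0 0 m] by (cases i) (simp_all add: coeff_Q q_def pade_den_0 pade_diff_small)
qed

lemma Q_1: "Q m 1 = [:1, - of_nat (12 * m):]"
proof (rule poly_eqI)
  fix i
  have q0: "q m 1 0 = 1"
    using q_rev_eq[of 1 1 m] pade_den_Suc[of 0]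
    by (simp add: q_def pade_den_0 pade_diff_small[unfolded One_nat_def])
  have q1: "q m 1 1 = - of_nat (12 * m)"
    using q_rev_eq[of 0 1 m] by (simp add: q_def pade_den_0 pade_diff_small[unfolded One_nat_def])
  consider "i = 0" | "i = 1" | j where "i = Suc (Suc j)"
    by (metis One_nat_def not0_implies_Suc)
  then show "coeff (Q m 1) i = coeff [:1, - of_nat (12 * m):] i"
    using q0 q1 by cases (simp_all add: coeff_Q)
qed

text \<open>The quotient r = \<open>pade_diff\<close> / \<open>pade_den\<close> obeys a recurrence
  whose coefficients are independent of k, and coefficient i of \<open>Q m n\<close> is (-1)^n (6
  m)^i r n (n - i). The constants are 6 m * 2 (n + 2) and (6 m)^2 (n + 7/6) (n + 11/6).\<close>

lemma Q_rec:
  "Q m (n + 2) = [:1, - of_nat (12 * (n + 2) * m):] * Q m (n + 1)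
     - [:0, 0, of_nat ((6 * n + 7) * (6 * n + 11) * m\<^sup>2):] * Q m n"
proof (rule poly_eqI)
  fix i
  define M where "M = (of_nat (6 * m) :: rat)"
  define r where "r n k = pade_diff n k / pade_den k" for n k
  define \<beta> where "\<beta> = (2 * of_nat (n + 2) :: rat)"
  define \<gamma> where "\<gamma> = ((of_nat n + 7/6) * (of_nat n + 11/6) :: rat)"
  have q: "coeff (Q m n) i = (- 1) ^ n * M ^ i * r n (n - i)" if "i \<le> n" for n i
    using that by (simp add: coeff_Q q_def q_rev_eq M_def r_def)
  have q0: "coeff (Q m n) i = 0" if "i > n" for n i
    using that by (simp add: coeff_Q)
  have r_Suc: "r (n + 2) (Suc k) = - r (n + 1) k + \<beta> * r (n + 1) (Suc k) - \<gamma> * r n (Suc k)" for k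
  proof -
    have "(of_nat (Suc k))\<^sup>2 - 4/9 = - (pade_den (Suc k) / pade_den k)"
      using pade_den_nonzero[of k] by (simp add: pade_den_Suc field_simps)
    then have "pade_diff (n + 2) (Suc k) = - (pade_den (Suc k) / pade_den k) * pade_diff (n + 1) k +
       \<beta> * pade_diff (n + 1) (Suc k) - \<gamma> * pade_diff n (Suc k)"
      using pade_diff_rec[of n "Suc k"] unfolding \<beta>_def \<gamma>_def by simp
    then show ?thesis
      unfolding r_def using pade_den_nonzero[of "Suc k"] by (simp add: add_divide_distrib diff_divide_distrib)
  qed
  have r_0: "r (n + 2) 0 = \<beta> * r (n + 1) 0 - \<gamma> * r n 0"
    using pade_diff_rec[of n 0] unfolding \<beta>_def \<gamma>_def r_def
    by (simp add: add_divide_distrib diff_divide_distrib)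
  have r_eq_0: "r n (n + 1) = 0" "r n (n + 2) = 0" for n
    by (simp_all only: r_def pade_diff_eq_0 div_0)
  have M1: "of_nat (12 * (n + 2) * m) = \<beta> * M"
    by (simp add: M_def \<beta>_def)
  have M2: "of_nat ((6 * n + 7) * (6 * n + 11) * m\<^sup>2) = \<gamma> * M\<^sup>2"
    by (simp add: M_def \<gamma>_def power2_eq_square field_simps)
  \<comment> \<open>Coefficients 0 and 1 involve values of \<open>pade_diff\<close> beyond the
    degree, which vanish; coefficient n + 2 is the leading one and uses the recurrence at k =
    0.\<close>
  consider "i = 0" | "i = 1" | j where "i = Suc (Suc j)" "j < n" | "i = Suc (Suc n)"
    | j where "i = Suc (Suc j)" "n < j"
    by (metis One_nat_def not0_implies_Suc linorder_neqE_nat)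
  then show "coeff (Q m (n + 2)) i = coeff ([:1, - of_nat (12 * (n + 2) * m):] * Q m (n + 1)
     - [:0, 0, of_nat ((6 * n + 7) * (6 * n + 11) * m\<^sup>2):] * Q m n) i"
  proof cases
    case 1
    have "r (n + 2) (n + 2) = - r (n + 1) (n + 1)"
      using r_Suc[of "n + 1"] r_eq_0[of n] r_eq_0[of "n + 1"] by simp
    then show ?thesis using 1 unfolding M1 M2 by (simp add: q)
  next
    case 2
    have "r (n + 2) (n + 1) = - r (n + 1) n + \<beta> * r (n + 1) (n + 1)"
      using r_Suc[of n] r_eq_0[of n] by simp
    then show ?thesis using 2 unfolding M1 M2 by (simp add: q right_diff_distrib distrib_left mult_ac)
  next
    case 3
    define k where "k = n - j - 1"
    have n: "n = Suc k + j" using 3 by (simp add: k_def)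
    have "coeff (Q m (n + 2)) i = (- 1) ^ n * M ^ i * r (n + 2) (Suc k)"
      using 3 q[of i "n + 2"] by (simp add: n)
    also have "\<dots> = coeff (Q m (n + 1)) i - \<beta> * M * coeff (Q m (n + 1)) (i - 1)
        - \<gamma> * M\<^sup>2 * coeff (Q m n) j"
      unfolding r_Suc
      using 3 q[of i "n + 1"] q[of "i - 1" "n + 1"] q[of j n]
      by (simp add: n power2_eq_square right_diff_distrib distrib_left mult_ac)
    finally show ?thesis using 3 unfolding M1 M2 by simp
  next
    case 4
    have "coeff (Q m (n + 2)) i = (- 1) ^ n * M ^ i * r (n + 2) 0"
      using 4 q[of i "n + 2"] by simp
    also have "\<dots> = - (\<beta> * M * coeff (Q m (n + 1)) (n + 1)) - \<gamma> * M\<^sup>2 * coeff (Q m n) n"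
      unfolding r_0 using 4 q[of "n + 1" "n + 1"] q[of n n]
      by (simp add: power2_eq_square right_diff_distrib mult_ac)
    finally show ?thesis using 4 q0[of "n + 1" i] unfolding M1 M2 by simp
  next
    case 5
    then show ?thesis using q0 unfolding M1 M2 by simp
  qed
qed

lemma degree_Q:
  assumes "m > 0"
  shows "degree (Q m n) = n"
proof (rule antisym)
  show "degree (Q m n) \<le> n" by (rule degree_le) (simp add: coeff_Q)
  \<comment> \<open>The leading coefficient is a nonzero multiple of (5/6)_(n+1) -
    (1/6)_(n+1).\<close>
  have "pochhammer (1/6) k < (pochhammer (5/6) k :: rat)" if "k > 0" for k
    using that
  proof (induction k rule: nat_induct_non_zero)
    case (Suc k)
    have "pochhammer (1/6) k > (0 :: rat)" by (rule pochhammer_pos) simp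
    with Suc show ?case unfolding pochhammer_Suc by (intro mult_strict_mono') auto
  qed simp
  then have "pade_diff n 0 > 0"
    unfolding pade_diff_def by (simp only: pade_sum_0 mult_1_right diff_gt_0_iff_gt add_gr_0 zero_less_one simp_thms)
  then have "q_rev m n 0 \<noteq> 0"
    unfolding q_rev_eq[OF le0] using assms pade_den_nonzero[of 0] by simp
  then have "coeff (Q m n) n \<noteq> 0" by (simp add: coeff_Q q_def)
  then show "n \<le> degree (Q m n)" by (rule le_degree)
qed

section \<open>Rational functions modulo prime powers\<close>

text \<open>The p-adic valuation of x is at least e, phrased through a fraction so that x = 0 needs
  no convention.\<close>

definition padic_ge :: "nat \<Rightarrow> nat \<Rightarrow> rat \<Rightarrow> bool" where
  "padic_ge p e x \<longleftrightarrow> (\<exists>a b :: int. \<not> int p dvd b \<and> x = of_int (int p ^ e * a) / of_int b)"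

context
  fixes p :: nat
  assumes p: "prime p"
begin

lemma padic_geI: "\<not> int p dvd b \<Longrightarrow> x = of_int (int p ^ e * a) / of_int b \<Longrightarrow> padic_ge p e x"
  unfolding padic_ge_def by blast

lemma padic_ge_of_int [simp]: "padic_ge p 0 (of_int a)"
  using p by (intro padic_geI[of 1 _ _ a]) (auto simp: prime_nat_iff)

lemma padic_ge_of_nat [simp]: "padic_ge p 0 (of_nat a)"
  using padic_ge_of_int[of "int a"] by simp

lemma padic_ge_Ints: "x \<in> \<int> \<Longrightarrow> padic_ge p 0 x"
  by (auto elim: Ints_cases)

lemma padic_ge_zero [simp]: "padic_ge p e 0"
  using p by (intro padic_geI[of 1 _ _ 0]) (auto simp: prime_nat_iff)

lemma padic_ge_power_self: "padic_ge p e (of_nat p ^ e)"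
  using p by (intro padic_geI[of 1 _ _ 1]) (auto simp: prime_nat_iff)

lemma padic_ge_add:
  assumes "padic_ge p e x" "padic_ge p e y"
  shows "padic_ge p e (x + y)"
proof -
  from assms obtain a b c d where b: "\<not> int p dvd b" "x = of_int (int p ^ e * a) / of_int b"
    and d: "\<not> int p dvd d" "y = of_int (int p ^ e * c) / of_int d"
    unfolding padic_ge_def by blast
  have "b \<noteq> 0" "d \<noteq> 0" using b d by auto
  then have "x + y = of_int (int p ^ e * (a * d + b * c)) / of_int (b * d)"
    unfolding b d by (simp add: field_simps)
  moreover have "\<not> int p dvd b * d"
    using p b(1) d(1) by (simp add: prime_dvd_mult_iff)
  ultimately show ?thesis by (intro padic_geI)
qed

lemma padic_ge_mult:
  assumes "padic_ge p e x" "padic_ge p f y"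
  shows "padic_ge p (e + f) (x * y)"
proof -
  from assms obtain a b c d where b: "\<not> int p dvd b" "x = of_int (int p ^ e * a) / of_int b"
    and d: "\<not> int p dvd d" "y = of_int (int p ^ f * c) / of_int d"
    unfolding padic_ge_def by blast
  have "x * y = of_int (int p ^ (e + f) * (a * c)) / of_int (b * d)"
    unfolding b d by (simp add: power_add mult_ac)
  moreover have "\<not> int p dvd b * d"
    using p b(1) d(1) by (simp add: prime_dvd_mult_iff)
  ultimately show ?thesis by (intro padic_geI)
qed

lemma padic_ge_uminus: "padic_ge p e x \<Longrightarrow> padic_ge p e (- x)"
  using padic_ge_mult[of 0 "-1" e x] padic_ge_of_int[of "-1"] by simp

lemma padic_ge_diff: "padic_ge p e x \<Longrightarrow> padic_ge p e y \<Longrightarrow> padic_ge p e (x - y)"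
  using padic_ge_add[of e x "- y"] padic_ge_uminus by simp

lemma padic_ge_sum: "(\<And>i. i \<in> A \<Longrightarrow> padic_ge p e (f i)) \<Longrightarrow> padic_ge p e (sum f A)"
  by (induction A rule: infinite_finite_induct) (auto intro: padic_ge_add)

lemma padic_ge_divide:
  assumes "padic_ge p e x" "\<not> p dvd n"
  shows "padic_ge p e (x / of_nat n)"
proof -
  from assms(2) have "padic_ge p 0 (1 / of_nat n)"
    by (intro padic_geI[of "int n" _ _ 1]) simp_all
  from padic_ge_mult[OF assms(1) this] show ?thesis by simp
qed

text \<open>On integers the p-adic condition is divisibility; this is how integer congruences are
  recovered.\<close>

lemma padic_ge_of_int_iff: "padic_ge p e (of_int n) \<longleftrightarrow> int p ^ e dvd n"
proof
  assume "padic_ge p e (of_int n)"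
  then obtain a b where b: "\<not> int p dvd b" "of_int n = (of_int (int p ^ e * a) / of_int b :: rat)"
    unfolding padic_ge_def by blast
  have "b \<noteq> 0" using b by auto
  then have "of_int (n * b) = (of_int (int p ^ e * a) :: rat)"
    using b(2) by (simp add: field_simps)
  then have "n * b = int p ^ e * a" by (simp only: of_int_eq_iff)
  moreover have "coprime (int p ^ e) b"
    using p b(1) by (simp add: prime_imp_coprime)
  ultimately show "int p ^ e dvd n"
    by (metis coprime_dvd_mult_left_iff dvd_triv_left)
next
  assume "int p ^ e dvd n"
  then obtain a where "n = int p ^ e * a" by blast
  then show "padic_ge p e (of_int n)"
    using padic_ge_mult[OF padic_ge_power_self padic_ge_of_int[of a], of e] by simp
qed

section \<open>Power series that are polynomials modulo a prime power\<close>

abbreviation fps_padic_ge :: "nat \<Rightarrow> rat fps \<Rightarrow> bool" where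
  "fps_padic_ge e f \<equiv> (\<forall>k. padic_ge p e (fps_nth f k))"

lemma fps_padic_ge_mult: "fps_padic_ge e f \<Longrightarrow> fps_padic_ge e' g \<Longrightarrow> fps_padic_ge (e + e') (f * g)"
  by (auto simp: fps_mult_nth intro!: padic_ge_sum padic_ge_mult)

lemma fps_padic_ge_power: "fps_padic_ge e f \<Longrightarrow> fps_padic_ge (n * e) (f ^ n)"
proof (induction n)
  case 0
  then show ?case using padic_ge_of_int[of 1] by (simp add: fps_one_nth)
next
  case (Suc n)
  then show ?case using fps_padic_ge_mult[of e f "n * e" "f ^ n"] by simp
qed

definition fps_poly_mod :: "nat \<Rightarrow> rat fps \<Rightarrow> bool" where
  "fps_poly_mod e f \<longleftrightarrow> fps_padic_ge 0 f \<and> (\<exists>N. \<forall>k>N. padic_ge p e (fps_nth f k))"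

lemma fps_poly_modI: "fps_padic_ge 0 f \<Longrightarrow> (\<And>k. k > N \<Longrightarrow> padic_ge p e (fps_nth f k)) \<Longrightarrow> fps_poly_mod e f"
  unfolding fps_poly_mod_def by blast

lemma fps_poly_mod_add:
  assumes "fps_poly_mod e f" "fps_poly_mod e g"
  shows "fps_poly_mod e (f + g)"
proof -
  from assms obtain M N where "\<forall>k>M. padic_ge p e (fps_nth f k)" "\<forall>k>N. padic_ge p e (fps_nth g k)"
    unfolding fps_poly_mod_def by blast
  then show ?thesis
    using assms by (intro fps_poly_modI[of _ "max M N"]) (auto simp: fps_poly_mod_def intro: padic_ge_add)
qed

lemma fps_poly_mod_mult:
  assumes "fps_poly_mod e f" "fps_poly_mod e g"
  shows "fps_poly_mod e (f * g)"
proof -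
  from assms obtain M N where MN: "\<forall>k>M. padic_ge p e (fps_nth f k)" "\<forall>k>N. padic_ge p e (fps_nth g k)"
    unfolding fps_poly_mod_def by blast
  show ?thesis
  proof (rule fps_poly_modI[of _ "M + N"])
    show "fps_padic_ge 0 (f * g)"
      using fps_padic_ge_mult[of 0 f 0 g] assms by (simp add: fps_poly_mod_def)
    fix k assume k: "k > M + N"
    show "padic_ge p e (fps_nth (f * g) k)"
      unfolding fps_mult_nth
    proof (rule padic_ge_sum)
      fix i assume "i \<in> {0..k}"
      then consider "i > M" | "k - i > N" using k by fastforce
      then show "padic_ge p e (fps_nth f i * fps_nth g (k - i))"
        using padic_ge_mult[of e "fps_nth f i" 0 "fps_nth g (k - i)"]
          padic_ge_mult[of 0 "fps_nth f i" e "fps_nth g (k - i)"] MN assms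
        by cases (auto simp: fps_poly_mod_def)
    qed
  qed
qed

lemma fps_poly_mod_sum: "(\<And>i. i \<in> A \<Longrightarrow> fps_poly_mod e (f i)) \<Longrightarrow> fps_poly_mod e (sum f A)"
  by (induction A rule: infinite_finite_induct)
     (auto intro: fps_poly_mod_add fps_poly_modI[of 0 0])

lemma fps_poly_mod_power: "fps_poly_mod e f \<Longrightarrow> fps_poly_mod e (f ^ n)"
proof (induction n)
  case 0
  then show ?case using padic_ge_of_int[of 1] by (intro fps_poly_modI[of _ 0]) (auto simp: fps_one_nth)
qed (simp add: fps_poly_mod_mult)

text \<open>The operator z d/dz multiplies coefficient k by k. It enters through the right-hand side
  h + 6 m z h' of the functional equation.\<close>

lemma fps_poly_mod_euler:
  assumes "fps_poly_mod e f"
  shows "fps_poly_mod e (fps_const (of_nat c) * fps_X * fps_deriv f)"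
proof -
  have nth: "fps_nth (fps_const (of_nat c) * fps_X * fps_deriv f) k = of_nat (c * k) * fps_nth f k" for k
    by (cases k) (simp_all add: mult.assoc distrib_left)
  from assms obtain N where "\<forall>k>N. padic_ge p e (fps_nth f k)"
    unfolding fps_poly_mod_def by blast
  then show ?thesis
    using assms padic_ge_mult[of 0 "of_nat (c * k)" _ "fps_nth f k" for k] 
    by (intro fps_poly_modI[of _ N]) (auto simp only: nth fps_poly_mod_def padic_ge_of_nat add_0)
qed

end

lemma fps_Ints_mult: "(\<And>k. fps_nth f k \<in> \<int>) \<Longrightarrow> (\<And>k. fps_nth g k \<in> \<int>) \<Longrightarrow> fps_nth (f * g :: rat fps) k \<in> \<int>"
  by (auto simp: fps_mult_nth)

lemma fps_Ints_power: "(\<And>k. fps_nth f k \<in> \<int>) \<Longrightarrow> fps_nth (f ^ n :: rat fps) k \<in> \<int>"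
  by (induction n arbitrary: k) (auto simp: fps_one_nth intro: fps_Ints_mult)

text \<open>The recursion for the coefficients of the inverse divides only by the constant
  coefficient 1.\<close>

lemma fps_Ints_inverse:
  assumes "\<And>k. fps_nth f k \<in> \<int>" "fps_nth f 0 = (1 :: rat)"
  shows "fps_nth (inverse f) k \<in> \<int>"
proof (induction k rule: less_induct)
  case (less k)
  show ?case
  proof (cases k)
    case 0
    then show ?thesis using assms by simp
  next
    case (Suc n)
    have "fps_nth (inverse f * f) k = 0"
      using assms(2) Suc by (simp add: inverse_mult_eq_1)
    then have "fps_nth (inverse f) k = - (\<Sum>i<k. fps_nth (inverse f) i * fps_nth f (k - i))"
      using assms(2) by (simp add: fps_mult_nth atLeast0AtMost lessThan_Suc_atMost[symmetric])
    then show ?thesis using less assms(1) by auto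
  qed
qed

text \<open>From \<open>F H = W\<close> with \<open>W\<close> and \<open>H\<close> polynomials modulo \<open>p\<^sup>\<alpha>\<close> and \<open>H \<equiv> q\<close> modulo \<open>p\<close>:
  \<open>q\<^sup>\<alpha> \<equiv> q\<^sup>\<alpha> - (q - H)\<^sup>\<alpha>\<close>, which is a multiple \<open>H V\<close> of \<open>H\<close>, so that \<open>F q\<^sup>\<alpha> \<equiv> W V\<close>.\<close>

lemma rational_mod_prime_power:
  fixes F H W :: "rat fps" and q :: "rat poly"
  assumes p: "prime p"
    and F: "\<And>k. fps_nth F k \<in> \<int>" and FH: "F * H = W"
    and H: "fps_poly_mod p \<alpha> H" and W: "fps_poly_mod p \<alpha> W"
    and q: "\<And>k. coeff q k \<in> \<int>" "coeff q 0 = 1"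
    and qH: "\<And>k. padic_ge p 1 (coeff q k - fps_nth H k)"
  shows "\<exists>P :: int poly. fps_cong F (fps_of_poly (map_poly of_int P) / fps_of_poly q ^ \<alpha>) (int p ^ \<alpha>)"
proof -
  define Q where "Q = fps_of_poly q"
  have Q: "\<And>k. fps_nth Q k \<in> \<int>" "fps_nth Q 0 = 1" using q by (simp_all add: Q_def)
  have Q_poly: "fps_poly_mod p \<alpha> Q"
    by (rule fps_poly_modI[OF p, of _ "degree q"])
       (auto simp: Q_def coeff_eq_0 padic_ge_zero[OF p] q intro: padic_ge_Ints[OF p])
  have QH_poly: "fps_poly_mod p \<alpha> (Q - H)"
  proof -
    have "fps_poly_mod p \<alpha> (- 1)"
      using padic_ge_of_int[OF p, of "-1"]
      by (intro fps_poly_modI[OF p, of _ 0]) (auto simp: fps_one_nth padic_ge_zero[OF p])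
    from fps_poly_mod_add[OF p Q_poly fps_poly_mod_mult[OF p this H]] show ?thesis by simp
  qed
  define V where "V = (\<Sum>i<\<alpha>. (Q - H) ^ (\<alpha> - Suc i) * Q ^ i)"
  have V: "fps_poly_mod p \<alpha> V"
    unfolding V_def
    by (intro fps_poly_mod_sum[OF p] fps_poly_mod_mult[OF p] fps_poly_mod_power[OF p] Q_poly QH_poly)
  \<comment> \<open>The factor H is Q - (Q - H) in the factorization of a difference of
    powers.\<close>
  have "Q ^ \<alpha> - (Q - H) ^ \<alpha> = H * V"
    unfolding V_def power_diff_sumr2 by simp
  then have eq: "F * Q ^ \<alpha> = F * (Q - H) ^ \<alpha> + W * V"
    unfolding FH[symmetric] by (simp add: algebra_simps)
  obtain N where N: "\<And>k. k > N \<Longrightarrow> padic_ge p \<alpha> (fps_nth (W * V) k)"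
    using fps_poly_mod_mult[OF p W V] unfolding fps_poly_mod_def[OF p] by blast
  \<comment> \<open>Every coefficient of Q - H has valuation at least 1, hence every coefficient of
    its \<alpha>-th power has valuation at least \<alpha>.\<close>
  have "\<forall>k. padic_ge p \<alpha> (fps_nth (F * (Q - H) ^ \<alpha>) k)"
    using fps_padic_ge_mult[OF p, of 0 F \<alpha> "(Q - H) ^ \<alpha>"] fps_padic_ge_power[OF p, of 1 "Q - H" \<alpha>] qH
      padic_ge_Ints[OF p F]
    by (simp add: Q_def)
  then have tail: "padic_ge p \<alpha> (fps_nth (F * Q ^ \<alpha>) k)" if "k > N" for k
    unfolding eq fps_add_nth using N[OF that] by (intro padic_ge_add[OF p]) auto
  have "fps_nth (F * Q ^ \<alpha>) k \<in> \<int>" for k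
    using F Q by (intro fps_Ints_mult fps_Ints_power)
  then have "\<forall>k. \<exists>z. fps_nth (F * Q ^ \<alpha>) k = of_int z" by (blast elim: Ints_cases)
  then obtain a where a: "\<And>k. fps_nth (F * Q ^ \<alpha>) k = of_int (a k)" by (auto dest: choice)
  define P where "P = (\<Sum>k\<le>N. monom (a k) k)"
  have P: "coeff P k = (if k \<le> N then a k else 0)" for k
    by (simp add: P_def coeff_sum)
  have "int p ^ \<alpha> dvd a k" if "k > N" for k
    using tail[OF that] by (simp add: a padic_ge_of_int_iff[OF p])
  then obtain d where d: "\<And>k. k > N \<Longrightarrow> a k = int p ^ \<alpha> * d k"
    using that[of "\<lambda>k. a k div int p ^ \<alpha>"] by simp
  \<comment> \<open>\<open>D\<close> is the part beyond \<open>N\<close> divided by p^\<alpha>;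
    dividing it further by Q^\<alpha> keeps it integral because Q has constant term 1.\<close>
  define D where "D = Abs_fps (\<lambda>k. if k \<le> N then 0 else of_int (d k) :: rat)"
  have "F * Q ^ \<alpha> = fps_of_poly (map_poly of_int P) + fps_const (of_int (int p ^ \<alpha>)) * D"
    by (rule fps_ext) (auto simp: a P D_def d coeff_map_poly)
  then have "F * Q ^ \<alpha> * inverse (Q ^ \<alpha>) =
      fps_of_poly (map_poly of_int P) / Q ^ \<alpha> + fps_const (of_int (int p ^ \<alpha>)) * (D * inverse (Q ^ \<alpha>))"
    using Q(2) by (simp add: fps_divide_unit algebra_simps fps_power_zeroth)
  moreover have "Q ^ \<alpha> * inverse (Q ^ \<alpha>) = 1"
    using Q(2) by (simp add: inverse_mult_eq_1' fps_power_zeroth)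
  ultimately have F_eq: "F = fps_of_poly (map_poly of_int P) / Q ^ \<alpha> +
      fps_const (of_int (int p ^ \<alpha>)) * (D * inverse (Q ^ \<alpha>))"
    by (simp add: mult.assoc)
  have int1: "fps_nth (D * inverse (Q ^ \<alpha>)) k \<in> \<int>" for k
    using Q by (intro fps_Ints_mult fps_Ints_inverse fps_Ints_power) (auto simp: D_def fps_power_zeroth)
  have "fps_cong F (fps_of_poly (map_poly of_int P) / Q ^ \<alpha>) (int p ^ \<alpha>)"
    unfolding fps_cong_def
  proof
    fix k
    obtain x y where x: "fps_nth F k = of_int x" and y: "fps_nth (D * inverse (Q ^ \<alpha>)) k = of_int y"
      using F[of k] int1[of k] by (elim Ints_cases) blast
    have "fps_nth (fps_of_poly (map_poly of_int P) / Q ^ \<alpha>) k = of_int (x - int p ^ \<alpha> * y)"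
      using arg_cong[OF F_eq, of "\<lambda>f. fps_nth f k"] x y by simp
    moreover have "[x = x - int p ^ \<alpha> * y] (mod int p ^ \<alpha>)"
      by (simp add: cong_iff_dvd_diff)
    ultimately show "\<exists>x y. fps_nth F k = of_int x \<and>
        fps_nth (fps_of_poly (map_poly of_int P) / Q ^ \<alpha>) k = of_int y \<and> [x = y] (mod int p ^ \<alpha>)"
      using x by blast
  qed
  then show ?thesis unfolding Q_def by blast
qed

section \<open>The continued fraction and its convergents\<close>

text \<open>The positive integers prime to 6 in increasing order: 1, 5, 7, 11, 13, and so
  on.\<close>

definition cf :: "nat \<Rightarrow> nat" where
  "cf i = (if even i then 3 * i + 1 else 3 * i + 2)"

lemma cf_add_2: "cf (i + 2) = cf i + 6"
  by (simp add: cf_def)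

text \<open>With \<open>c\<^sub>i = cf i\<close>, the denominators of \<open>1 / (1 - c\<^sub>1 m z / (1 - c\<^sub>2 m z / (1 - \<dots>)))\<close>; the index is shifted so
  that \<open>cf_den m (i + 1)\<close> is the one obtained by setting \<open>c\<^sub>j = 0\<close> for \<open>j > i\<close>.\<close>

fun cf_den :: "nat \<Rightarrow> nat \<Rightarrow> rat fps" where
  "cf_den m 0 = 1"
| "cf_den m (Suc 0) = 1"
| "cf_den m (Suc (Suc i)) = cf_den m (Suc i) - fps_const (of_nat (cf (Suc i) * m)) * fps_X * cf_den m i"

text \<open>Contraction of the continued fraction: eliminating the denominators with indices i + 1
  and i + 3 leaves a recurrence among every second one.\<close>

lemma cf_den_contraction:
  "cf_den m (i + 4) = (1 - fps_const (of_nat ((cf (i + 3) + cf (i + 2)) * m)) * fps_X) * cf_den m (i + 2)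
     - fps_const (of_nat (cf (i + 2) * cf (i + 1) * m\<^sup>2)) * fps_X\<^sup>2 * cf_den m i"
proof -
  define u :: "nat \<Rightarrow> rat fps" where "u j = fps_const (of_nat (cf j * m)) * fps_X" for j
  have r: "cf_den m (Suc (Suc j)) = cf_den m (Suc j) - u (Suc j) * cf_den m j" for j
    by (simp add: u_def)
  have 4: "cf_den m (i + 4) = cf_den m (i + 3) - u (i + 3) * cf_den m (i + 2)"
    and 3: "cf_den m (i + 3) = cf_den m (i + 2) - u (i + 2) * cf_den m (i + 1)"
    and 2: "cf_den m (i + 2) = cf_den m (i + 1) - u (i + 1) * cf_den m i"
    using r[of "i + 2"] r[of "i + 1"] r[of i] by (simp_all add: numeral_eq_Suc)
  have "cf_den m (i + 1) = cf_den m (i + 2) + u (i + 1) * cf_den m i"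
    by (simp only: 2 diff_add_cancel)
  then have "cf_den m (i + 4) = (1 - (u (i + 3) + u (i + 2))) * cf_den m (i + 2)
      - u (i + 2) * u (i + 1) * cf_den m i"
    unfolding 4 3 by (simp only: algebra_simps mult_1_left)
  moreover have "u (i + 3) + u (i + 2) = fps_const (of_nat ((cf (i + 3) + cf (i + 2)) * m)) * fps_X"
    unfolding u_def distrib_right[symmetric] fps_const_add of_nat_add[symmetric] ..
  moreover have "u (i + 2) * u (i + 1) = fps_const (of_nat (cf (i + 2) * cf (i + 1) * m\<^sup>2)) * fps_X\<^sup>2"
  proof -
    have "u (i + 2) * u (i + 1) =
        (fps_const (of_nat (cf (i + 2) * m)) * fps_const (of_nat (cf (i + 1) * m))) * (fps_X * fps_X)"
      unfolding u_def by (simp only: mult_ac)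
    then show ?thesis
      unfolding fps_const_mult of_nat_mult[symmetric] power2_eq_square by (simp only: mult_ac)
  qed
  ultimately show ?thesis by simp
qed

text \<open>Both sides satisfy the same recurrence, since
  \<open>cf (2 * k + 4) + cf (2 * k + 3)\<close> is 12 (k + 2) and the product of
  \<open>cf (2 * k + 3)\<close> and \<open>cf (2 * k + 2)\<close> is (6 k + 11) (6 k + 7); both
  start with 1 and 1 - 12 m z.\<close>

lemma fps_of_poly_Q: "fps_of_poly (Q m n) = cf_den m (2 * n + 1)"
proof (induction n rule: less_induct)
  case (less n)
  have lin: "fps_of_poly [:1, - c:] = 1 - fps_const c * fps_X" for c :: rat
    by (simp add: fps_of_poly_pCons algebra_simps flip: fps_const_neg)
  have quad: "fps_of_poly [:0, 0, c:] = fps_const c * fps_X\<^sup>2" for c :: rat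
    by (simp add: fps_of_poly_pCons power2_eq_square mult_ac)
  consider "n = 0" | "n = 1" | k where "n = k + 2"
    by (metis One_nat_def Suc_1 add_2_eq_Suc' not0_implies_Suc)
  then show ?case
  proof cases
    case 1
    then show ?thesis by (simp add: Q_0)
  next
    case 2
    have "cf_den m (2 * 1 + 1) = 1 - (fps_const (of_nat (cf 2 * m)) + fps_const (of_nat (cf 1 * m))) * fps_X"
      by (simp add: numeral_eq_Suc algebra_simps)
    also have "\<dots> = 1 - fps_const (of_nat (12 * m)) * fps_X"
      unfolding fps_const_add by (simp add: cf_def algebra_simps)
    finally show ?thesis using 2 by (simp only: Q_1 lin)
  next
    case 3
    have c: "cf (2 * k + 1 + 3) + cf (2 * k + 1 + 2) = 12 * (k + 2)"
      "cf (2 * k + 1 + 2) * cf (2 * k + 1 + 1) = (6 * k + 7) * (6 * k + 11)"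
      by (simp_all add: cf_def algebra_simps)
    have "cf_den m (2 * k + 1 + 4) = (1 - fps_const (of_nat (12 * (k + 2) * m)) * fps_X) * cf_den m (2 * k + 1 + 2)
       - fps_const (of_nat ((6 * k + 7) * (6 * k + 11) * m\<^sup>2)) * fps_X\<^sup>2 * cf_den m (2 * k + 1)"
      using cf_den_contraction[of m "2 * k + 1"] unfolding c .
    moreover have "2 * n + 1 = 2 * k + 1 + 4" "2 * k + 1 + 2 = 2 * (k + 1) + 1" using 3 by simp_all
    ultimately show ?thesis
      using less[of "k + 1"] less[of k] 3 by (simp only: Q_rec fps_of_poly_diff fps_of_poly_mult lin quad)
  qed
qed

section \<open>Hypergeometric series attached to the continued fraction\<close>

definition fps_2F0 :: "nat \<Rightarrow> rat \<Rightarrow> rat \<Rightarrow> rat fps" where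
  "fps_2F0 m a b = Abs_fps (\<lambda>k. of_nat (6 * m) ^ k * pochhammer a k * pochhammer b k / fact k)"

lemma fps_2F0_commute: "fps_2F0 m a b = fps_2F0 m b a"
  by (simp add: fps_2F0_def mult_ac)

text \<open>Contiguous relation, from (a + 1)_k - (a)_k = k (a + 1)_(k-1), where the factor k
  cancels against k!.\<close>

lemma fps_2F0_contiguous:
  "fps_2F0 m (a + 1) b = fps_2F0 m a b + fps_const (of_nat (6 * m) * b) * fps_X * fps_2F0 m (a + 1) (b + 1)"
proof (rule fps_ext)
  fix k
  show "fps_nth (fps_2F0 m (a + 1) b) k =
    fps_nth (fps_2F0 m a b + fps_const (of_nat (6 * m) * b) * fps_X * fps_2F0 m (a + 1) (b + 1)) k"
  proof (cases k)
    case (Suc n)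
    define M where "M = (of_nat (6 * m) :: rat)"
    have "pochhammer (a + 1) (Suc n) - pochhammer a (Suc n) = of_nat (Suc n) * pochhammer (a + 1) n"
      unfolding pochhammer_rec[of a n] pochhammer_Suc[of "a + 1" n] by (simp add: algebra_simps)
    then have "pochhammer (a + 1) (Suc n) = pochhammer a (Suc n) + of_nat (Suc n) * pochhammer (a + 1) n"
      by simp
    moreover have "pochhammer b (Suc n) = b * pochhammer (b + 1) n"
      by (rule pochhammer_rec)
    moreover have "M ^ Suc n * (x + s * y) * (b * w) / (s * f) =
        M ^ Suc n * x * (b * w) / (s * f) + M * b * (M ^ n * y * w / f)" if "s \<noteq> 0" for x y w s f
      using that by (simp add: add_divide_distrib distrib_left distrib_right mult_ac)
    from this[of "of_nat (Suc n)"]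
    have "M ^ Suc n * (x + of_nat (Suc n) * y) * (b * w) / fact (Suc n) =
        M ^ Suc n * x * (b * w) / fact (Suc n) + M * b * (M ^ n * y * w / fact n)" for x y w
      by (simp only: fact_Suc of_nat_neq_0 not_False_eq_True)
    ultimately have "M ^ Suc n * pochhammer (a + 1) (Suc n) * pochhammer b (Suc n) / fact (Suc n) =
        M ^ Suc n * pochhammer a (Suc n) * pochhammer b (Suc n) / fact (Suc n) +
        M * b * (M ^ n * pochhammer (a + 1) n * pochhammer (b + 1) n / fact n)"
      by (simp only:)
    then show ?thesis
      by (simp add: Suc fps_2F0_def mult.assoc M_def del: fact_Suc power_Suc)
  qed (simp add: fps_2F0_def)
qed

text \<open>The quotients of consecutive members are the tails of the continued fraction. Because
  \<open>cf (i + 2) = cf i + 6\<close>, passing from i to i + 1 raises the smaller parameter by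
  1.\<close>

definition cf_fun :: "nat \<Rightarrow> nat \<Rightarrow> rat fps" where
  "cf_fun m i = fps_2F0 m (of_nat (cf i) / 6) (of_nat (cf (i + 1)) / 6)"

lemma cf_fun_rec:
  "cf_fun m i = cf_fun m (i + 1) - fps_const (of_nat (cf (i + 1) * m)) * fps_X * cf_fun m (i + 2)"
proof -
  have 2: "of_nat (cf (j + 2)) / 6 = (of_nat (cf j) / 6 + 1 :: rat)" for j
    by (simp only: cf_add_2 of_nat_add add_divide_distrib)
  have "cf_fun m (i + 1) = fps_2F0 m (of_nat (cf i) / 6 + 1) (of_nat (cf (i + 1)) / 6)"
    unfolding cf_fun_def add.assoc one_add_one 2 by (rule fps_2F0_commute)
  moreover have "cf_fun m (i + 2) = fps_2F0 m (of_nat (cf i) / 6 + 1) (of_nat (cf (i + 1)) / 6 + 1)"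
    unfolding cf_fun_def add.commute[of "i + 2" 1] add.assoc[symmetric, of 1 i 2] 2 add.commute[of 1 i] ..
  moreover have "of_nat (6 * m) * (of_nat (cf (i + 1)) / 6) = (of_nat (cf (i + 1) * m) :: rat)"
    by simp
  ultimately show ?thesis
    using fps_2F0_contiguous[of m "of_nat (cf i) / 6" "of_nat (cf (i + 1)) / 6"]
    by (simp only: cf_fun_def[of m i]) simp
qed

text \<open>Iteration of \<open>cf_fun_rec\<close>. The last term carries the factor
  \<open>cf (i + 1)\<close>, so it drops out modulo p once this factor is p.\<close>

lemma cf_fun_0:
  "cf_fun m 0 = cf_den m (i + 1) * cf_fun m (i + 1)
     - fps_const (of_nat (cf (i + 1) * m)) * fps_X * cf_den m i * cf_fun m (i + 2)"
proof (induction i)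
  case 0
  then show ?case using cf_fun_rec[of m 0] by simp
next
  case (Suc i)
  define u :: "nat \<Rightarrow> rat fps" where "u j = fps_const (of_nat (cf j * m)) * fps_X" for j
  have 1: "cf_den m (i + 2) = cf_den m (i + 1) - u (i + 1) * cf_den m i"
    by (simp add: u_def)
  have 2: "cf_fun m (i + 1) = cf_fun m (i + 2) - u (i + 2) * cf_fun m (i + 3)"
    using cf_fun_rec[of m "i + 1"] by (simp add: u_def numeral_eq_Suc)
  have "cf_fun m 0 = cf_den m (i + 1) * (cf_fun m (i + 2) - u (i + 2) * cf_fun m (i + 3))
      - u (i + 1) * cf_den m i * cf_fun m (i + 2)"
    using Suc by (simp only: u_def[symmetric] 2)
  also have "\<dots> = cf_den m (i + 2) * cf_fun m (i + 2) - u (i + 2) * cf_den m (i + 1) * cf_fun m (i + 3)"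
    unfolding 1 by (simp only: algebra_simps)
  finally show ?case by (simp add: u_def numeral_eq_Suc)
qed

lemma cf_den_Ints: "fps_nth (cf_den m i) k \<in> \<int>"
proof (induction i arbitrary: k rule: cf_den.induct)
  case (3 m i)
  have "fps_nth (fps_const (of_nat (cf (Suc i) * m)) * fps_X * cf_den m i) k \<in> \<int>"
    using 3 by (cases k) (simp_all add: mult.assoc)
  then show ?case using 3 by (simp del: of_nat_mult)
qed (simp_all add: fps_one_nth)

lemma cf_den_0 [simp]: "fps_nth (cf_den m i) 0 = 1"
  by (induction m i rule: cf_den.induct) (simp_all add: mult.assoc)

section \<open>The coefficients of h and their divisibility by p\<close>

definition hom_coeff :: "nat \<Rightarrow> nat \<Rightarrow> rat" where
  "hom_coeff m k = of_nat (m ^ k * fact (6 * k)) / of_nat (fact (3 * k) * fact (2 * k) * 72 ^ k)"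

lemma hom_coeff_Suc:
  "hom_coeff m (Suc k) = hom_coeff m k * of_nat (m * (6 * k + 1) * (6 * k + 5)) / of_nat (6 * (k + 1))"
proof -
  define x where "x = (of_nat k :: rat)"
  have 6: "fact (6 * Suc k) = (6*x+1)*(6*x+2)*(6*x+3)*(6*x+4)*(6*x+5)*(6*x+6) * (fact (6 * k) :: rat)"
    and 3: "fact (3 * Suc k) = (3*x+1)*(3*x+2)*(3*x+3) * (fact (3 * k) :: rat)"
    and 2: "fact (2 * Suc k) = (2*x+1)*(2*x+2) * (fact (2 * k) :: rat)"
  proof -
    have e: "6 * Suc k = Suc (Suc (Suc (Suc (Suc (Suc (6 * k))))))" "3 * Suc k = Suc (Suc (Suc (3 * k)))"
      "2 * Suc k = Suc (Suc (2 * k))" by simp_all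
    show "fact (6 * Suc k) = (6*x+1)*(6*x+2)*(6*x+3)*(6*x+4)*(6*x+5)*(6*x+6) * (fact (6 * k) :: rat)"
      "fact (3 * Suc k) = (3*x+1)*(3*x+2)*(3*x+3) * (fact (3 * k) :: rat)"
      "fact (2 * Suc k) = (2*x+1)*(2*x+2) * (fact (2 * k) :: rat)"
      unfolding e fact_Suc x_def by (simp_all add: mult_ac add_ac)
  qed
  have nz: "(2 * of_nat k + 1 :: rat) \<noteq> 0" "(3 * of_nat k + 1 :: rat) \<noteq> 0" "(3 * of_nat k + 2 :: rat) \<noteq> 0"
      "(of_nat k + 1 :: rat) \<noteq> 0"
    using of_nat_neq_0[of "2 * k", where 'a = rat] of_nat_neq_0[of "3 * k", where 'a = rat] 
       of_nat_neq_0[of "3 * k + 1", where 'a = rat] of_nat_neq_0[of k, where 'a = rat]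
    by (simp_all add: add_ac)
  have f: "(6*x+1)*(6*x+2)*(6*x+3)*(6*x+4)*(6*x+5)*(6*x+6) / ((3*x+1)*(3*x+2)*(3*x+3)*((2*x+1)*(2*x+2))*72) =
     (6*x+1)*(6*x+5)/(6*(x+1))"
  proof -
    have e: "3*x+3 = 3*(x+1)" "2*x+2 = 2*(x+1)" by simp_all
    have "(3*x+1)*(3*x+2)*(3*x+3)*((2*x+1)*(2*x+2))*72 \<noteq> 0" "6*(x+1) \<noteq> 0"
      unfolding e using nz[folded x_def] by simp_all
    moreover have "(6*x+1)*(6*x+2)*(6*x+3)*(6*x+4)*(6*x+5)*(6*x+6) * (6*(x+1)) =
        (6*x+1)*(6*x+5) * ((3*x+1)*(3*x+2)*(3*x+3)*((2*x+1)*(2*x+2))*72)"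
      by algebra
    ultimately show ?thesis by (rule frac_eq_eq[THEN iffD2])
  qed
  have "hom_coeff m (Suc k) = of_nat (m ^ Suc k) * fact (6 * Suc k) / (fact (3 * Suc k) * fact (2 * Suc k) * 72 ^ Suc k)"
    by (simp add: hom_coeff_def del: mult_Suc_right power_Suc)
  also have "\<dots> = hom_coeff m k * of_nat m * ((6*x+1)*(6*x+2)*(6*x+3)*(6*x+4)*(6*x+5)*(6*x+6) / ((3*x+1)*(3*x+2)*(3*x+3)*((2*x+1)*(2*x+2))*72))"
    unfolding 6 3 2 by (simp add: hom_coeff_def x_def mult_ac)
  finally show ?thesis unfolding f by (simp add: x_def algebra_simps)
qed

lemma cf_fun_0_eq: "cf_fun m 0 = Abs_fps (hom_coeff m)"
proof -
  have "fps_nth (cf_fun m 0) k = hom_coeff m k" for k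
  proof (induction k)
    case 0
    then show ?case by (simp add: cf_fun_def fps_2F0_def hom_coeff_def)
  next
    case (Suc k)
    have "fps_nth (cf_fun m 0) (Suc k) = fps_nth (cf_fun m 0) k * 
       (of_nat (6 * m) * (1/6 + of_nat k) * (5/6 + of_nat k) / of_nat (k + 1))"
      by (simp add: cf_fun_def fps_2F0_def cf_def pochhammer_Suc mult_ac)
    also have "of_nat (6 * m) * (1/6 + of_nat k) * (5/6 + of_nat k) / of_nat (k + 1) =
       (of_nat (m * (6 * k + 1) * (6 * k + 5)) / of_nat (6 * (k + 1)) :: rat)"
      by (simp add: field_simps)
    finally show ?case unfolding Suc hom_coeff_Suc by simp
  qed
  then show ?thesis by (intro fps_ext) simp
qed

text \<open>Since (3 k)! (2 k)! k! divides (6 k)!, the coefficient is an integer multiple of k! /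
  72^k. The e multiples of p up to k contribute p^e to k!, and 72 is prime to p.\<close>

lemma padic_ge_hom_coeff:
  assumes "prime p" "p \<noteq> 2" "p \<noteq> 3" "e * p \<le> k"
  shows "padic_ge p e (hom_coeff m k)"
proof -
  have "fact (3 * k) * fact (2 * k) * fact k dvd (fact (6 * k) :: nat)"
  proof (rule dvd_trans[OF mult_dvd_mono[OF _ dvd_refl]])
    show "fact (3 * k) * fact (2 * k) dvd (fact (5 * k) :: nat)"
      using fact_fact_dvd_fact[of "3 * k" "2 * k", where 'a = nat] by simp
    show "fact (5 * k) * fact k dvd (fact (6 * k) :: nat)"
      using fact_fact_dvd_fact[of "5 * k" k, where 'a = nat] by simp
  qed
  then obtain c :: nat where c: "fact (6 * k) = fact (3 * k) * fact (2 * k) * fact k * c" by blast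
  have "p ^ e dvd (fact k :: nat)"
  proof -
    have "p ^ e dvd fact (e * p)"
    proof (induction e)
      case (Suc e)
      have "fact (e * p) * fact p dvd (fact (e * p + p) :: nat)" by (rule fact_fact_dvd_fact)
      moreover have "p dvd fact p" using assms(1) by (simp add: dvd_fact prime_gt_0_nat Suc_leI)
      ultimately have "p ^ e * p dvd fact (e * p + p)" using Suc by (meson dvd_trans mult_dvd_mono)
      then show ?case by (simp add: mult.commute add.commute)
    qed simp
    then show ?thesis using fact_dvd[OF assms(4)] dvd_trans by blast
  qed
  then obtain d where d: "fact k = p ^ e * d" by blast
  have "hom_coeff m k = of_nat (m ^ k * (fact k * c)) / of_nat (72 ^ k)"
    unfolding hom_coeff_def c by (simp add: mult_ac)
  also have "\<dots> = of_nat p ^ e * of_nat (m ^ k * d * c) / of_nat (72 ^ k)"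
    unfolding d by (simp add: mult_ac)
  finally have eq: "hom_coeff m k = of_nat p ^ e * of_nat (m ^ k * d * c) / of_nat (72 ^ k)" .
  have "\<not> p dvd 72"
  proof
    assume "p dvd 72"
    then have "p dvd 2 ^ 3 * 3 ^ 2" by simp
    then have "p dvd 2 \<or> p dvd 3"
      using assms(1) by (metis prime_dvd_mult_iff prime_dvd_power)
    then show False using assms(1-3) primes_dvd_imp_eq[of p 2] primes_dvd_imp_eq[of p 3] by auto
  qed
  then have "\<not> p dvd 72 ^ k" using assms(1) prime_dvd_power by blast
  from padic_ge_divide[OF assms(1) _ this, of e "of_nat p ^ e * of_nat (m ^ k * d * c)"]
  show ?thesis
    unfolding eq using padic_ge_mult[OF assms(1) padic_ge_power_self[OF assms(1), of e]
       padic_ge_of_nat[OF assms(1), of "m ^ k * d * c"]] by simp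
qed

lemma not_dvd_fact:
  assumes "prime p" "k < p"
  shows "\<not> p dvd fact k"
  using prime_dvd_fact_iff[OF assms(1), of k] assms(2) by simp

lemma cf_fun_nth:
  "fps_nth (cf_fun m i) k =
     of_nat (m ^ k * (\<Prod>l<k. cf i + 6 * l) * (\<Prod>l<k. cf (i + 1) + 6 * l)) / of_nat (6 ^ k * fact k)"
proof -
  have poch: "pochhammer (of_nat c / 6) k = of_nat (\<Prod>l<k. c + 6 * l) / (6 ^ k :: rat)" for c
    by (induction k) (simp_all add: pochhammer_Suc field_simps)
  show ?thesis
    by (simp add: cf_fun_def fps_2F0_def poch power_mult_distrib del: of_nat_prod)
qed

text \<open>For k < p the denominator 6^k k! is prime to p. If a parameter is p / 6, its Pochhammer
  symbol begins with that factor, so the series is 1 modulo p below order p.\<close>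

lemma padic_ge_cf_fun:
  assumes p: "prime p" "p \<noteq> 2" "p \<noteq> 3" and k: "k < p"
  shows "padic_ge p 0 (fps_nth (cf_fun m i) k)"
    and "cf i = p \<or> cf (i + 1) = p \<Longrightarrow> k > 0 \<Longrightarrow> padic_ge p 1 (fps_nth (cf_fun m i) k)"
proof -
  have "\<not> p dvd 6"
  proof
    assume "p dvd 6"
    then have "p dvd 2 * 3" by simp
    then have "p dvd 2 \<or> p dvd 3" using p(1) by (metis prime_dvd_mult_iff)
    then show False using p primes_dvd_imp_eq[of p 2] primes_dvd_imp_eq[of p 3] by auto
  qed
  then have nd: "\<not> p dvd 6 ^ k * fact k"
    using p(1) not_dvd_fact[OF p(1) k] prime_dvd_power by (auto simp: prime_dvd_mult_iff)
  show "padic_ge p 0 (fps_nth (cf_fun m i) k)"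
    unfolding cf_fun_nth by (intro padic_ge_divide p(1) padic_ge_of_nat nd)
  assume "cf i = p \<or> cf (i + 1) = p" "k > 0"
  moreover have "p dvd (\<Prod>l<k. p + 6 * l)"
  proof -
    have "p + 6 * 0 dvd (\<Prod>l<k. p + 6 * l)" using \<open>k > 0\<close> by (intro dvd_prodI) auto
    then show ?thesis by simp
  qed
  ultimately have "p dvd m ^ k * (\<Prod>l<k. cf i + 6 * l) * (\<Prod>l<k. cf (i + 1) + 6 * l)"
    by auto
  then obtain c where c: "m ^ k * (\<Prod>l<k. cf i + 6 * l) * (\<Prod>l<k. cf (i + 1) + 6 * l) = p * c" by blast
  have "padic_ge p 1 (of_nat (p * c))"
    using padic_ge_mult[OF p(1) padic_ge_power_self[OF p(1), of 1] padic_ge_of_nat[OF p(1), of c]] by simp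
  then show "padic_ge p 1 (fps_nth (cf_fun m i) k)"
    unfolding cf_fun_nth c by (intro padic_ge_divide p(1) nd)
qed

lemma padic_ge_p_mult:
  assumes "prime p" "padic_ge p 0 x"
  shows "padic_ge p 1 (of_nat (p * m) * x)"
proof -
  have "padic_ge p 1 (of_nat (p * m))"
    using padic_ge_mult[OF assms(1) padic_ge_power_self[OF assms(1), of 1] padic_ge_of_nat[OF assms(1), of m]]
    by simp
  from padic_ge_mult[OF assms(1) this assms(2)] show ?thesis by simp
qed

text \<open>In \<open>cf_fun_0\<close> the last term carries the factor p, and
  \<open>cf_fun m (i + 1)\<close> is 1 modulo p below order p because its first parameter is p / 6.
  The next denominator differs by a multiple of p, which gives the second congruence.\<close>

lemma cf_den_cong_hom_coeff:
  assumes p: "prime p" "p \<noteq> 2" "p \<noteq> 3" and i: "cf (i + 1) = p" and k: "k < p"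
  shows "padic_ge p 1 (fps_nth (cf_den m (i + 1)) k - hom_coeff m k)"
    and "padic_ge p 1 (fps_nth (cf_den m (i + 2)) k - hom_coeff m k)"
proof -
  let ?K = "cf_den m" and ?G = "cf_fun m"
  have X: "padic_ge p 1 (fps_nth (fps_const (of_nat (p * m)) * fps_X * f) k)"
    if "\<And>j. j < k \<Longrightarrow> padic_ge p 0 (fps_nth f j)" for f
    using that padic_ge_p_mult[OF p(1), of "fps_nth f (k - 1)" m] 
    by (cases k) (simp_all add: mult.assoc padic_ge_zero[OF p(1)])
  have K: "padic_ge p 0 (fps_nth (?K i) j)" for i j
    by (rule padic_ge_Ints[OF p(1) cf_den_Ints])
  have KG: "padic_ge p 0 (fps_nth (?K i * ?G l) j)" if "j < p" for j l
    unfolding fps_mult_nth using that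
    by (intro padic_ge_sum[OF p(1)] padic_ge_mult[OF p(1), of 0 _ 0, simplified] K
        padic_ge_cf_fun(1)[OF p]) auto
  have "Abs_fps (hom_coeff m) = ?K (i + 1) + ?K (i + 1) * (?G (i + 1) - 1)
      - fps_const (of_nat (p * m)) * fps_X * (?K i * ?G (i + 2))"
    using cf_fun_0[of m i] unfolding cf_fun_0_eq i by (simp add: algebra_simps)
  from arg_cong[OF this, of "\<lambda>f. fps_nth f k"]
  have eq: "fps_nth (?K (i + 1)) k - hom_coeff m k =
      fps_nth (fps_const (of_nat (p * m)) * fps_X * (?K i * ?G (i + 2))) k - 
      fps_nth (?K (i + 1) * (?G (i + 1) - 1)) k"
    by (simp only: fps_nth_Abs_fps fps_add_nth fps_sub_nth)
  have "padic_ge p 1 (fps_nth (?K (i + 1) * (?G (i + 1) - 1)) k)"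
    unfolding fps_mult_nth
  proof (rule padic_ge_sum[OF p(1)])
    fix j assume j: "j \<in> {0..k}"
    have "padic_ge p 1 (fps_nth (?G (i + 1) - 1) (k - j))"
    proof (cases "k - j = 0")
      case True
      then show ?thesis by (simp add: cf_fun_nth padic_ge_zero[OF p(1)])
    next
      case False
      then show ?thesis
        using padic_ge_cf_fun(2)[OF p, of "k - j" "i + 1" m] k i by (simp add: fps_one_nth)
    qed
    then show "padic_ge p 1 (fps_nth (?K (i + 1)) j * fps_nth (?G (i + 1) - 1) (k - j))"
      using padic_ge_mult[OF p(1) K, of 1] by simp
  qed
  moreover have "padic_ge p 1 (fps_nth (fps_const (of_nat (p * m)) * fps_X * (?K i * ?G (i + 2))) k)"
    using KG k by (intro X) auto
  ultimately show 1: "padic_ge p 1 (fps_nth (?K (i + 1)) k - hom_coeff m k)"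
    unfolding eq by (intro padic_ge_diff[OF p(1)])
  have "?K (i + 2) = ?K (i + 1) - fps_const (of_nat (p * m)) * fps_X * ?K i"
    using i by simp
  then have "fps_nth (?K (i + 2)) k - hom_coeff m k = (fps_nth (?K (i + 1)) k - hom_coeff m k)
      - fps_nth (fps_const (of_nat (p * m)) * fps_X * ?K i) k"
    by (simp only: fps_sub_nth diff_right_commute)
  then show "padic_ge p 1 (fps_nth (?K (i + 2)) k - hom_coeff m k)"
    using X[OF K] 1 by (simp only: padic_ge_diff[OF p(1)])
qed

text \<open>\<open>Q m n\<close> is the denominator with index 2 n + 1. For p = 6 n + 1 the
  numerator p enters when that denominator is formed, for p = 6 n + 5 when the next one is. From
  order p on, \<open>Q m n\<close> has no terms and h vanishes modulo p.\<close>

lemma Q_cong_hom_coeff: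
  assumes p: "prime p" "p \<noteq> 2" "p \<noteq> 3"
    and n: "p = 6 * n + 1 \<or> p = 6 * n + 5"
  shows "padic_ge p 1 (coeff (Q m n) k - hom_coeff m k)"
proof (cases "k < p")
  case True
  have Q: "coeff (Q m n) k = fps_nth (cf_den m (2 * n + 1)) k"
    using fps_of_poly_nth[of "Q m n" k] by (simp only: fps_of_poly_Q)
  show ?thesis
    using n
  proof
    assume "p = 6 * n + 1"
    \<comment> \<open>For n = 0 this would be p = 1; so the index 2 n - 1 makes sense.\<close>
    moreover from this have "n \<noteq> 0" using p(1) by (intro notI) simp
    then obtain l where "n = Suc l" by (cases n) auto
    ultimately have "cf ((2 * l + 1) + 1) = p" "2 * n + 1 = (2 * l + 1) + 2" by (simp_all add: cf_def)
    then show ?thesis using cf_den_cong_hom_coeff(2)[OF p _ True] unfolding Q by metis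
  next
    assume "p = 6 * n + 5"
    then have "cf (2 * n + 1) = p" by (simp add: cf_def)
    then show ?thesis using cf_den_cong_hom_coeff(1)[OF p _ True] unfolding Q by metis
  qed
next
  case False
  then have "coeff (Q m n) k = 0" using n by (auto simp: coeff_Q)
  moreover have "padic_ge p 1 (hom_coeff m k)"
    using padic_ge_hom_coeff[OF p, of 1 k m] False by simp
  ultimately show ?thesis using padic_ge_uminus[OF p(1)] by simp
qed

lemma coeff_Q_Ints: "coeff (Q m n) k \<in> \<int>"
  and coeff_Q_0: "coeff (Q m n) 0 = 1"
  using cf_den_Ints[of m "2 * n + 1" k] cf_den_0[of m "2 * n + 1"]
  by (simp_all only: fps_of_poly_nth flip: fps_of_poly_Q)

lemma F_series_mod_prime_power:
  assumes p: "prime p" "p \<noteq> 2" "p \<noteq> 3"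
    and n: "p = 6 * n + 1 \<or> p = 6 * n + 5"
    and rec: "F_series m * Abs_fps (hom_coeff m) =
       Abs_fps (hom_coeff m) + fps_const (of_nat (6 * m)) * fps_X * fps_deriv (Abs_fps (hom_coeff m))"
  shows "\<exists>P :: int poly. fps_cong (F_series m)
    (fps_of_poly (map_poly of_int P) / fps_of_poly (Q m n) ^ \<alpha>) (int p ^ \<alpha>)"
proof (rule rational_mod_prime_power[OF p(1) _ rec])
  show H: "fps_poly_mod p \<alpha> (Abs_fps (hom_coeff m))"
    using padic_ge_hom_coeff[OF p, of _ _ m]
    by (intro fps_poly_modI[OF p(1), of _ "\<alpha> * p"]) auto
  show "fps_poly_mod p \<alpha> (Abs_fps (hom_coeff m) +
      fps_const (of_nat (6 * m)) * fps_X * fps_deriv (Abs_fps (hom_coeff m)))"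
    by (intro fps_poly_mod_add fps_poly_mod_euler p(1) H)
  show "fps_nth (F_series m) k \<in> \<int>" for k
    by (simp add: F_series_def)
qed (simp_all only: coeff_Q_Ints coeff_Q_0 Q_cong_hom_coeff[OF p n] fps_nth_Abs_fps)

section \<open>Counting semiregular permutations\<close>

text \<open>Extensional functions, so that the set is finite and a function is determined by its
  values on S.\<close>

definition injections :: "'a set \<Rightarrow> 'b set \<Rightarrow> ('a \<Rightarrow> 'b) set" where
  "injections S T = {f \<in> S \<rightarrow>\<^sub>E T. inj_on f S}"

lemma finite_injections: "finite S \<Longrightarrow> finite T \<Longrightarrow> finite (injections S T)"
  unfolding injections_def by (rule finite_subset[OF _ finite_PiE]) auto

lemma bij_betw_injections_insert:
  assumes "x \<notin> S" "y \<in> T"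
  shows "bij_betw (\<lambda>g. g(x := y)) (injections S (T - {y})) {f \<in> injections (insert x S) T. f x = y}"
proof (rule bij_betwI[where g = "\<lambda>f. f(x := undefined)"])
  show "(\<lambda>g. g(x := y)) \<in> injections S (T - {y}) \<rightarrow> {f \<in> injections (insert x S) T. f x = y}"
  proof
    fix g assume "g \<in> injections S (T - {y})"
    then have g: "g \<in> S \<rightarrow>\<^sub>E (T - {y})" "inj_on g S" by (auto simp: injections_def)
    have "g \<in> S \<rightarrow>\<^sub>E T" using g(1) by (rule PiE_mono[THEN subsetD, rotated]) auto
    then have "g(x := y) \<in> insert x S \<rightarrow>\<^sub>E T" using assms(2) by (intro PiE_fun_upd)
    moreover have "inj_on (g(x := y)) S"
      using g(2) assms(1) by (subst inj_on_cong[of S _ g]) auto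
    moreover have "y \<notin> g ` S" using g(1) by auto
    ultimately show "g(x := y) \<in> {f \<in> injections (insert x S) T. f x = y}"
      using assms(1) by (auto simp: injections_def)
  qed
  show "(\<lambda>f. f(x := undefined)) \<in> {f \<in> injections (insert x S) T. f x = y} \<rightarrow> injections S (T - {y})"
  proof
    fix f assume "f \<in> {f \<in> injections (insert x S) T. f x = y}"
    then have f: "f \<in> insert x S \<rightarrow>\<^sub>E T" "inj_on f (insert x S)" "f x = y" by (auto simp: injections_def)
    have "inj_on (f(x := undefined)) S"
      using f(2) assms(1) by (subst inj_on_cong[of S _ f]) auto
    moreover have "f(x := undefined) \<in> S \<rightarrow>\<^sub>E (T - {y})"
    proof (rule PiE_I)
      fix z assume z: "z \<in> S"
      then have "f z \<noteq> f x" using inj_onD[OF f(2), of z x] assms(1) by auto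
      then show "(f(x := undefined)) z \<in> T - {y}" using z f assms(1) by auto
    next
      fix z assume "z \<notin> S"
      then show "(f(x := undefined)) z = undefined" using f(1) by (auto simp: PiE_def extensional_def)
    qed
    ultimately show "f(x := undefined) \<in> injections S (T - {y})" by (simp add: injections_def)
  qed
next
  fix g assume "g \<in> injections S (T - {y})"
  then show "(g(x := y))(x := undefined) = g"
    using assms(1) by (auto simp: injections_def PiE_def extensional_def)
next
  fix f assume "f \<in> {f \<in> injections (insert x S) T. f x = y}"
  then show "(f(x := undefined))(x := y) = f" by auto
qed

lemma card_injections:
  assumes "finite S" "finite T" "card S \<le> card T"
  shows "card (injections S T) * fact (card T - card S) = fact (card T)"
  using assms
proof (induction S arbitrary: T rule: finite_induct)
  case empty
  have "(injections {} T :: ('a \<Rightarrow> 'b) set) = {\<lambda>_. undefined}" by (auto simp: injections_def)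
  then show ?case by simp
next
  case (insert x S)
  have fib: "card {f \<in> injections (insert x S) T. f x = y} * fact (card T - card (insert x S)) = fact (card T - 1)"
    if "y \<in> T" for y
  proof -
    have "card {f \<in> injections (insert x S) T. f x = y} = card (injections S (T - {y}))"
      using bij_betw_same_card[OF bij_betw_injections_insert[OF insert.hyps(2) that]] by simp
    moreover have "card (injections S (T - {y})) * fact (card (T - {y}) - card S) = fact (card (T - {y}))"
      using insert.prems insert.hyps that by (intro insert.IH) auto
    ultimately show ?thesis using that insert.prems insert.hyps by simp
  qed
  have T: "card T > 0" using insert.prems insert.hyps by simp
  have "injections (insert x S) T = (\<Union>y\<in>T. {f \<in> injections (insert x S) T. f x = y})"
    by (auto simp: injections_def)
  then have "card (injections (insert x S) T) = (\<Sum>y\<in>T. card {f \<in> injections (insert x S) T. f x = y})"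
    using finite_injections[of "insert x S" T] insert.prems insert.hyps
    by (subst card_UN_disjoint[symmetric]) auto
  then have "card (injections (insert x S) T) * fact (card T - card (insert x S)) = (\<Sum>y\<in>T. fact (card T - 1))"
    using fib by (simp add: sum_distrib_right)
  also have "\<dots> = fact (card T)" using T by (simp add: fact_reduce[of "card T"])
  finally show ?case .
qed

lemma card_pointed_injections:
  assumes "finite X" "finite Y" "x0 \<in> X" "y0 \<in> Y" "card X \<le> card Y"
  shows "card {f \<in> injections X Y. f x0 = y0} * fact (card Y - card X) = fact (card Y - 1)"
proof -
  have X: "X = insert x0 (X - {x0})" using assms(3) by auto
  have "card {f \<in> injections X Y. f x0 = y0} = card (injections (X - {x0}) (Y - {y0}))"
    using bij_betw_same_card[OF bij_betw_injections_insert[of x0 "X - {x0}" y0 Y]] assms(4) X by simp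
  moreover have "card X > 0" using assms by (auto simp: card_gt_0_iff)
  then have "card (Y - {y0}) - card (X - {x0}) = card Y - card X" "card (X - {x0}) \<le> card (Y - {y0})"
    "card (Y - {y0}) = card Y - 1"
    using assms by auto
  ultimately show ?thesis
    using card_injections[of "X - {x0}" "Y - {y0}"] assms by simp
qed

section \<open>Splitting off the orbit of a point from an action\<close>

definition equivariant_on :: "'a set \<Rightarrow> ('i \<Rightarrow> 'a \<Rightarrow> 'a) \<Rightarrow> ('i \<Rightarrow> 'b \<Rightarrow> 'b) \<Rightarrow> ('a \<Rightarrow> 'b) \<Rightarrow> bool" where
  "equivariant_on X \<rho> \<sigma> h \<longleftrightarrow> (\<forall>i. \<forall>x\<in>X. h (\<rho> i x) = \<sigma> i (h x))"

text \<open>The identity outside B, because a permutation of B is a function on the whole type that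
  fixes all other points.\<close>

definition restrict_action :: "('i \<Rightarrow> 'b \<Rightarrow> 'b) \<Rightarrow> 'b set \<Rightarrow> 'i \<Rightarrow> 'b \<Rightarrow> 'b" where
  "restrict_action \<sigma> B i z = (if z \<in> B then \<sigma> i z else z)"

definition glue_action :: "'a set \<Rightarrow> ('a \<Rightarrow> 'b) \<Rightarrow> ('i \<Rightarrow> 'a \<Rightarrow> 'a) \<Rightarrow> ('i \<Rightarrow> 'b \<Rightarrow> 'b) \<Rightarrow> 'i \<Rightarrow> 'b \<Rightarrow> 'b" where
  "glue_action X h \<rho> \<tau> i z = (if z \<in> h ` X then h (\<rho> i (inv_into X h z)) else \<tau> i z)"

text \<open>For transitive X this says that the orbit of y0 is a copy of X with base point
  x0.\<close>

definition extends_action :: "'a set \<Rightarrow> 'a \<Rightarrow> ('i \<Rightarrow> 'a \<Rightarrow> 'a) \<Rightarrow> 'b set \<Rightarrow> 'b \<Rightarrow> ('i \<Rightarrow> 'b \<Rightarrow> 'b) \<Rightarrow> bool" where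
  "extends_action X x0 \<rho> Y y0 \<sigma> \<longleftrightarrow>
     (\<exists>h. inj_on h X \<and> h ` X \<subseteq> Y \<and> h x0 = y0 \<and> equivariant_on X \<rho> \<sigma> h)"

text \<open>Generation by forward steps only, which amounts to transitivity when the \<rho> i
  permute a finite X; the last clause serves as an induction rule.\<close>

definition transitive_action :: "'a set \<Rightarrow> 'a \<Rightarrow> ('i \<Rightarrow> 'a \<Rightarrow> 'a) \<Rightarrow> bool" where
  "transitive_action X x0 \<rho> \<longleftrightarrow> x0 \<in> X \<and> (\<forall>i. \<forall>x\<in>X. \<rho> i x \<in> X) \<and>
     (\<forall>Z. x0 \<in> Z \<longrightarrow> (\<forall>i. \<forall>x\<in>X \<inter> Z. \<rho> i x \<in> Z) \<longrightarrow> X \<subseteq> Z)"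

lemma equivariant_unique:
  assumes "transitive_action X x0 \<rho>" "equivariant_on X \<rho> \<sigma> h" "equivariant_on X \<rho> \<sigma> h'" "h x0 = h' x0" "x \<in> X"
  shows "h x = h' x"
proof -
  have "X \<subseteq> {x. h x = h' x}"
    using assms by (auto simp: transitive_action_def equivariant_on_def)
  then show ?thesis using assms(5) by blast
qed

text \<open>Such an action is the same as a pointed injection h of X into Y together with an action
  on the complement of its image; gluing and restricting are mutually inverse. The action determines
  h because an equivariant map on a transitive X is fixed by its value at x0. The class C is
  abstract so that the count serves single permutations and pairs of generators alike.\<close>

lemma card_extends_action:
  fixes C :: "'b set \<Rightarrow> ('i \<Rightarrow> 'b \<Rightarrow> 'b) set"
  assumes fin: "finite X" "finite Y" and y0: "y0 \<in> Y" and card: "card X \<le> card Y"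
    and tr: "transitive_action X x0 \<rho>"
    and perm: "\<And>B \<sigma> i. \<sigma> \<in> C B \<Longrightarrow> \<sigma> i permutes B"
    and restr: "\<And>\<sigma> h. \<sigma> \<in> C Y \<Longrightarrow> inj_on h X \<Longrightarrow> h ` X \<subseteq> Y \<Longrightarrow> equivariant_on X \<rho> \<sigma> h \<Longrightarrow>
        restrict_action \<sigma> (Y - h ` X) \<in> C (Y - h ` X)"
    and glue: "\<And>\<tau> h. \<tau> \<in> C (Y - h ` X) \<Longrightarrow> inj_on h X \<Longrightarrow> h ` X \<subseteq> Y \<Longrightarrow> glue_action X h \<rho> \<tau> \<in> C Y"
    and rest: "\<And>D. D \<subseteq> Y \<Longrightarrow> card D = card Y - card X \<Longrightarrow> finite (C D) \<and> card (C D) = a"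
  shows "card {\<sigma> \<in> C Y. extends_action X x0 \<rho> Y y0 \<sigma>} * fact (card Y - card X) = fact (card Y - 1) * a"
proof -
  define J where "J = {h \<in> injections X Y. h x0 = y0}"
  have x0: "x0 \<in> X" and \<rho>X: "\<And>i x. x \<in> X \<Longrightarrow> \<rho> i x \<in> X" using tr by (auto simp: transitive_action_def)
  have J: "inj_on h X" "h ` X \<subseteq> Y" "h x0 = y0" "card (Y - h ` X) = card Y - card X" if "h \<in> J" for h
  proof -
    show h: "inj_on h X" "h ` X \<subseteq> Y" "h x0 = y0"
      using that by (auto simp: J_def injections_def)
    show "card (Y - h ` X) = card Y - card X"
      using h fin by (simp add: card_Diff_subset card_image)
  qed
  have CJ: "finite (C (Y - h ` X)) \<and> card (C (Y - h ` X)) = a" if "h \<in> J" for h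
    by (rule rest[OF _ J(4)[OF that]]) auto
  have glue_in: "glue_action X h \<rho> \<tau> i (h x) = h (\<rho> i x)" if "inj_on h X" "x \<in> X" for h \<tau> i x
    using that by (simp add: glue_action_def)
  have glue_eq: "equivariant_on X \<rho> (glue_action X h \<rho> \<tau>) h" if "inj_on h X" for h \<tau>
    using glue_in[OF that] by (simp add: equivariant_on_def)
  have "bij_betw (\<lambda>(h, \<tau>). glue_action X h \<rho> \<tau>) (SIGMA h:J. C (Y - h ` X))
      {\<sigma> \<in> C Y. extends_action X x0 \<rho> Y y0 \<sigma>}"
    unfolding bij_betw_def
  proof
    show "inj_on (\<lambda>(h, \<tau>). glue_action X h \<rho> \<tau>) (SIGMA h:J. C (Y - h ` X))"
    proof (rule inj_onI, clarify)
      fix h \<tau> h' \<tau>'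
      assume h: "h \<in> J" "h' \<in> J" and \<tau>: "\<tau> \<in> C (Y - h ` X)" "\<tau>' \<in> C (Y - h' ` X)"
        and eq: "glue_action X h \<rho> \<tau> = glue_action X h' \<rho> \<tau>'"
      have "h x = h' x" if "x \<in> X" for x
        using equivariant_unique[OF tr glue_eq[OF J(1)[OF h(1)], of \<tau>] _ _ that, of h']
          glue_eq[OF J(1)[OF h(2)], of \<tau>'] J(3)[OF h(1)] J(3)[OF h(2)] eq by simp
      then have hh: "h = h'"
        using h unfolding J_def injections_def by (intro PiE_ext[of h X _ h']) auto
      have "\<tau> i z = \<tau>' i z" for i z
      proof (cases "z \<in> h ` X")
        case True
        then show ?thesis
          using perm[OF \<tau>(1), of i] perm[OF \<tau>(2), of i] hh by (simp add: permutes_not_in)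
      next
        case False
        then show ?thesis using fun_cong[OF fun_cong[OF eq], of i z] hh by (simp add: glue_action_def)
      qed
      then show "h = h' \<and> \<tau> = \<tau>'" using hh by auto
    qed
    show "(\<lambda>(h, \<tau>). glue_action X h \<rho> \<tau>) ` (SIGMA h:J. C (Y - h ` X)) =
        {\<sigma> \<in> C Y. extends_action X x0 \<rho> Y y0 \<sigma>}"
    proof (intro equalityI subsetI)
      fix \<sigma> assume "\<sigma> \<in> (\<lambda>(h, \<tau>). glue_action X h \<rho> \<tau>) ` (SIGMA h:J. C (Y - h ` X))"
      then obtain h \<tau> where h: "h \<in> J" "\<tau> \<in> C (Y - h ` X)" "\<sigma> = glue_action X h \<rho> \<tau>" by auto
      then show "\<sigma> \<in> {\<sigma> \<in> C Y. extends_action X x0 \<rho> Y y0 \<sigma>}"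
        using glue[OF h(2) J(1,2)[OF h(1)]] glue_eq[OF J(1)[OF h(1)]] J[OF h(1)]
        by (auto simp: extends_action_def)
    next
      fix \<sigma> assume "\<sigma> \<in> {\<sigma> \<in> C Y. extends_action X x0 \<rho> Y y0 \<sigma>}"
      then obtain h' where \<sigma>: "\<sigma> \<in> C Y" and h': "inj_on h' X" "h' ` X \<subseteq> Y" "h' x0 = y0"
        "equivariant_on X \<rho> \<sigma> h'" unfolding extends_action_def by blast
      \<comment> \<open>Members of \<open>J\<close> are extensional, so the given embedding is cut
        down to X.\<close>
      define h where "h = restrict h' X"
      have h: "inj_on h X" "h ` X \<subseteq> Y" "h x0 = y0" "equivariant_on X \<rho> \<sigma> h"
        using h' x0 \<rho>X by (auto simp: h_def equivariant_on_def inj_on_def)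
      have "h \<in> J" using h h'(2) by (auto simp: J_def injections_def h_def)
      define \<tau> where "\<tau> = restrict_action \<sigma> (Y - h ` X)"
      have \<tau>: "\<tau> \<in> C (Y - h ` X)" unfolding \<tau>_def by (rule restr[OF \<sigma> h(1,2,4)])
      have "glue_action X h \<rho> \<tau> i z = \<sigma> i z" for i z
      proof (cases "z \<in> h ` X")
        case True
        then obtain x where "x \<in> X" "z = h x" by blast
        then show ?thesis using glue_in[OF h(1)] h(4) by (simp add: equivariant_on_def)
      next
        case False
        then show ?thesis
          using perm[OF \<sigma>, of i] by (auto simp: glue_action_def \<tau>_def restrict_action_def permutes_not_in)
      qed
      then have "\<sigma> = glue_action X h \<rho> \<tau>" by (intro HOL.ext) simp
      then show "\<sigma> \<in> (\<lambda>(h, \<tau>). glue_action X h \<rho> \<tau>) ` (SIGMA h:J. C (Y - h ` X))"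
        using \<open>h \<in> J\<close> \<tau> by force
    qed
  qed
  then have "card {\<sigma> \<in> C Y. extends_action X x0 \<rho> Y y0 \<sigma>} = card (SIGMA h:J. C (Y - h ` X))"
    by (rule bij_betw_same_card[symmetric])
  also have "\<dots> = (\<Sum>h\<in>J. card (C (Y - h ` X)))"
  proof (rule card_SigmaI)
    show "finite J" unfolding J_def using finite_injections[OF fin] by simp
    show "\<forall>h\<in>J. finite (C (Y - h ` X))" using CJ by simp
  qed
  also have "\<dots> = (\<Sum>h\<in>J. a)"
    by (rule sum.cong[OF HOL.refl]) (simp add: CJ)
  also have "\<dots> = card J * a" by simp
  finally show ?thesis
    using card_pointed_injections[OF fin x0 y0 card] by (simp add: J_def mult_ac)
qed

section \<open>Permutations all of whose cycles have the same length\<close>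

definition semiregular :: "nat \<Rightarrow> ('a \<Rightarrow> 'a) \<Rightarrow> 'a set \<Rightarrow> bool" where
  "semiregular d f Y \<longleftrightarrow> f permutes Y \<and> (\<forall>y\<in>Y. (f ^^ d) y = y \<and> (\<forall>i. 0 < i \<and> i < d \<longrightarrow> (f ^^ i) y \<noteq> y))"

lemma semiregularD:
  assumes "semiregular d f Y"
  shows "f permutes Y" "y \<in> Y \<Longrightarrow> (f ^^ d) y = y" "y \<in> Y \<Longrightarrow> 0 < i \<Longrightarrow> i < d \<Longrightarrow> (f ^^ i) y \<noteq> y"
  using assms by (auto simp: semiregular_def)

lemma funpow_equivariant:
  assumes "\<And>x. x \<in> X \<Longrightarrow> f x \<in> X" "\<And>x. x \<in> X \<Longrightarrow> h (f x) = g (h x)" "x \<in> X"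
  shows "(f ^^ n) x \<in> X \<and> h ((f ^^ n) x) = (g ^^ n) (h x)"
  by (induction n) (use assms in auto)

lemma funpow_cong_on:
  assumes "\<And>x. x \<in> D \<Longrightarrow> f x \<in> D" "\<And>x. x \<in> D \<Longrightarrow> f x = g x" "x \<in> D"
  shows "(f ^^ n) x = (g ^^ n) x"
  using funpow_equivariant[of D f id g x n] assms by simp

lemma image_permutes_equivariant:
  assumes "finite X" "f permutes X" "\<And>x. x \<in> X \<Longrightarrow> h (f x) = g (h x)"
  shows "g ` (h ` X) = h ` X"
proof -
  have "g ` (h ` X) = h ` (f ` X)" using assms(3) by force
  then show ?thesis using permutes_image[OF assms(2)] by simp
qed

lemma permutes_restrict_diff:
  assumes "g permutes Y" "g ` D = D" "D \<subseteq> Y"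
  shows "(\<lambda>z. if z \<in> Y - D then g z else z) permutes (Y - D)"
proof (rule bij_imp_permutes)
  have "g ` (Y - D) = Y - D"
    using assms permutes_inj[OF assms(1)] permutes_image[OF assms(1)] by (metis image_set_diff)
  then have "bij_betw g (Y - D) (Y - D)"
    using permutes_inj_on[OF assms(1)] by (simp add: bij_betw_def)
  then show "bij_betw (\<lambda>z. if z \<in> Y - D then g z else z) (Y - D) (Y - D)"
    by (rule bij_betw_cong[THEN iffD1, rotated]) simp
qed auto

lemma permutes_glue:
  assumes "f permutes X" "inj_on h X" "h ` X \<subseteq> Y" "t permutes (Y - h ` X)"
  shows "(\<lambda>z. if z \<in> h ` X then h (f (inv_into X h z)) else t z) permutes Y" (is "?g permutes Y")
proof (rule bij_imp_permutes)
  have b1: "bij_betw ?g (h ` X) (h ` X)"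
  proof -
    have "bij_betw (h \<circ> f \<circ> inv_into X h) (h ` X) (h ` X)"
      using assms(1,2) by (intro bij_betw_trans[of _ _ X]) 
        (auto simp: bij_betw_inv_into inj_on_imp_bij_betw permutes_imp_bij)
    then show ?thesis by (rule bij_betw_cong[THEN iffD1, rotated]) simp
  qed
  have b2: "bij_betw ?g (Y - h ` X) (Y - h ` X)"
    using permutes_imp_bij[OF assms(4)] by (rule bij_betw_cong[THEN iffD1, rotated]) simp
  have "bij_betw ?g (h ` X \<union> (Y - h ` X)) (h ` X \<union> (Y - h ` X))"
    using b1 b2 by (rule bij_betw_combine) auto
  moreover have "h ` X \<union> (Y - h ` X) = Y" using assms(3) by auto
  ultimately show "bij_betw ?g Y Y" by simp
  fix z assume "z \<notin> Y"
  then show "?g z = z" using assms(3,4) by (auto simp: permutes_not_in)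
qed

lemma semiregular_restrict:
  assumes "semiregular d g Y" "g ` D = D" "D \<subseteq> Y"
  shows "semiregular d (\<lambda>z. if z \<in> Y - D then g z else z) (Y - D)"
proof -
  define r where "r = (\<lambda>z. if z \<in> Y - D then g z else z)"
  have p: "r permutes (Y - D)"
    unfolding r_def by (rule permutes_restrict_diff[OF semiregularD(1)[OF assms(1)] assms(2,3)])
  have r: "r z = g z" if "z \<in> Y - D" for z using that by (simp add: r_def)
  have eq: "(r ^^ i) y = (g ^^ i) y" if "y \<in> Y - D" for i y
    by (rule funpow_cong_on[of "Y - D" r g, OF _ r that]) (use permutes_in_image[OF p] in blast)
  have "semiregular d r (Y - D)"
    unfolding semiregular_def
  proof (intro conjI ballI p)
    fix y assume y: "y \<in> Y - D"
    then show "(r ^^ d) y = y" "\<forall>i. 0 < i \<and> i < d \<longrightarrow> (r ^^ i) y \<noteq> y"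
      using semiregularD[OF assms(1)] by (simp_all add: eq)
  qed
  then show ?thesis by (simp only: r_def)
qed

lemma semiregular_glue:
  assumes "semiregular d f X" "inj_on h X" "h ` X \<subseteq> Y" "semiregular d t (Y - h ` X)"
  shows "semiregular d (\<lambda>z. if z \<in> h ` X then h (f (inv_into X h z)) else t z) Y"
proof -
  define g where "g = (\<lambda>z. if z \<in> h ` X then h (f (inv_into X h z)) else t z)"
  have g1: "h (f x) = g (h x)" if "x \<in> X" for x using that assms(2) by (simp add: g_def)
  have g2: "t z = g z" if "z \<in> Y - h ` X" for z using that by (simp add: g_def)
  have fX: "f x \<in> X" if "x \<in> X" for x
    using permutes_in_image[OF semiregularD(1)[OF assms(1)]] that by simp
  have X: "(f ^^ i) x \<in> X \<and> h ((f ^^ i) x) = (g ^^ i) (h x)" if "x \<in> X" for x i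
    by (rule funpow_equivariant[of X f h g x i, OF fX g1 that])
  have tY: "t y \<in> Y - h ` X" if "y \<in> Y - h ` X" for y
    using permutes_in_image[OF semiregularD(1)[OF assms(4)], of y] that by blast
  have R: "(g ^^ i) y = (t ^^ i) y" if "y \<in> Y - h ` X" for y i
    by (rule funpow_cong_on[of "Y - h ` X" t g, OF tY g2 that, symmetric])
  have "(g ^^ d) y = y \<and> (\<forall>i. 0 < i \<and> i < d \<longrightarrow> (g ^^ i) y \<noteq> y)" if "y \<in> Y" for y
  proof (cases "y \<in> h ` X")
    case True
    then obtain x where x: "x \<in> X" "y = h x" by blast
    have "(g ^^ i) y = y \<longleftrightarrow> (f ^^ i) x = x" for i
      using X[OF x(1), of i] x assms(2) by (metis inj_onD)
    then show ?thesis using semiregularD[OF assms(1)] x(1) by simp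
  next
    case False
    then have y: "y \<in> Y - h ` X" using that by blast
    show ?thesis using semiregularD(2,3)[OF assms(4) y] R[OF y] by simp
  qed
  moreover have "g permutes Y"
    unfolding g_def using assms by (intro permutes_glue) (auto simp: semiregular_def)
  ultimately show ?thesis by (simp add: semiregular_def g_def[symmetric])
qed

text \<open>The model of a cycle of length d, continued by the identity so that it permutes exactly
  the numbers below d.\<close>

definition cyclic_shift :: "nat \<Rightarrow> nat \<Rightarrow> nat" where
  "cyclic_shift d i = (if i < d then Suc i mod d else i)"

lemma cyclic_shift_funpow:
  assumes "i < d"
  shows "(cyclic_shift d ^^ n) i = (i + n) mod d"
proof (induction n)
  case (Suc n)
  then show ?case using assms by (simp add: cyclic_shift_def mod_Suc_eq)
qed (use assms in simp)

lemma semiregular_cyclic_shift: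
  assumes "d > 0"
  shows "semiregular d (cyclic_shift d) {..<d}"
proof -
  have "bij_betw (cyclic_shift d) {..<d} {..<d}"
  proof (rule bij_betwI[where g = "\<lambda>i. (i + (d - 1)) mod d"])
    show "(cyclic_shift d i + (d - 1)) mod d = i" if "i \<in> {..<d}" for i
    proof -
      have "(Suc i mod d + (d - 1)) mod d = (Suc i + (d - 1)) mod d" by (rule mod_add_left_eq)
      then show ?thesis using that assms by (simp add: cyclic_shift_def)
    qed
    show "cyclic_shift d ((i + (d - 1)) mod d) = i" if "i \<in> {..<d}" for i
    proof -
      have "Suc ((i + (d - 1)) mod d) mod d = Suc (i + (d - 1)) mod d" by (rule mod_Suc_eq)
      then show ?thesis using that assms by (simp add: cyclic_shift_def)
    qed
  qed (use assms in \<open>auto simp: cyclic_shift_def\<close>)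
  then have "cyclic_shift d permutes {..<d}"
    by (rule bij_imp_permutes) (simp add: cyclic_shift_def)
  moreover have "(y + i) mod d \<noteq> y" if "y < d" "0 < i" "i < d" for y i
    using that by (cases "y + i < d") (auto simp: mod_if)
  ultimately show ?thesis by (auto simp: semiregular_def cyclic_shift_funpow)
qed

lemma funpow_mod_semiregular:
  assumes "semiregular d f Y" "y \<in> Y"
  shows "(f ^^ (n mod d)) y = (f ^^ n) y"
proof -
  have m: "((f ^^ d) ^^ q) y = y" for q
    by (induction q) (use semiregularD(2)[OF assms] in \<open>auto simp: funpow_Suc_right simp del: funpow.simps(2)\<close>)
  have "(f ^^ n) y = (f ^^ (n mod d + n div d * d)) y" by simp
  also have "\<dots> = (f ^^ (n mod d)) (((f ^^ d) ^^ (n div d)) y)"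
    unfolding funpow_add funpow_mult by (simp add: mult.commute)
  finally show ?thesis using m by simp
qed

lemma semiregular_funpow_inj:
  assumes "semiregular d f Y" "y \<in> Y" "i < d" "j < d" "(f ^^ i) y = (f ^^ j) y"
  shows "i = j"
proof -
  have *: "i = j" if "i \<le> j" "i < d" "j < d" "(f ^^ i) y = (f ^^ j) y" for i j
  proof (rule ccontr)
    assume "i \<noteq> j"
    then have ij: "0 < j - i" "j - i < d" using that by auto
    have "(f ^^ j) y = (f ^^ i) ((f ^^ (j - i)) y)"
      using that(1) funpow_add[of i "j - i" f] by simp
    then have "(f ^^ i) ((f ^^ (j - i)) y) = (f ^^ i) y" using that(4) by simp
    moreover have "inj (f ^^ i)"
      using permutes_inj[OF semiregularD(1)[OF assms(1)]] by (induction i) (auto simp: inj_compose)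
    ultimately have "(f ^^ (j - i)) y = y" by (simp add: inj_eq)
    then show False using semiregularD(3)[OF assms(1,2) ij] by simp
  qed
  show ?thesis
    using *[of i j] *[of j i] assms(3-5) by (metis nat_le_linear)
qed

lemma semiregular_orbit:
  assumes "semiregular d f Y" "y \<in> Y" "d > 0"
  defines "h \<equiv> \<lambda>i. (f ^^ i) y"
  shows "inj_on h {..<d}" "h ` {..<d} \<subseteq> Y" "h 0 = y"
    "i < d \<Longrightarrow> h (cyclic_shift d i) = f (h i)" "f ` (h ` {..<d}) = h ` {..<d}" "card (h ` {..<d}) = d"
proof -
  show "inj_on h {..<d}"
    unfolding h_def using semiregular_funpow_inj[OF assms(1,2)] by (intro inj_onI) auto
  then show "card (h ` {..<d}) = d" by (simp add: card_image)
  have "f x \<in> Y" if "x \<in> Y" for x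
    using permutes_in_image[OF semiregularD(1)[OF assms(1)]] that by simp
  then have "(f ^^ i) y \<in> Y" for i using assms(2) by (induction i) auto
  then show "h ` {..<d} \<subseteq> Y" by (auto simp: h_def)
  show "h 0 = y" by (simp add: h_def)
  show eq: "h (cyclic_shift d i) = f (h i)" if "i < d" for i
    using funpow_mod_semiregular[OF assms(1,2), of "Suc i"] that by (simp add: h_def cyclic_shift_def)
  show "f ` (h ` {..<d}) = h ` {..<d}"
    by (rule image_permutes_equivariant[OF _ semiregularD(1)[OF semiregular_cyclic_shift[OF assms(3)]]])
       (use eq in auto)
qed

lemma finite_semiregular: "finite Y \<Longrightarrow> finite {f. semiregular d f Y}"
  by (rule finite_subset[OF _ finite_permutations[of Y]]) (auto simp: semiregular_def)

text \<open>The cycle through a chosen point y0 is split off: the (d (k + 1) - 1)! / (d k)! pointed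
  injections of the model cycle are combined with the permutations of the remaining d k
  points.\<close>

lemma card_semiregular:
  assumes "d > 0" "finite Y" "card Y = d * k"
  shows "card {f. semiregular d f Y} * (d ^ k * fact k) = fact (d * k)"
  using assms(2,3)
proof (induction k arbitrary: Y)
  case 0
  then have "{f. semiregular d f Y} = {id}" by (auto simp: semiregular_def)
  then show ?case by simp
next
  case (Suc k)
  \<comment> \<open>A single permutation is an action with one generator, hence the index type
    \<open>unit\<close>.\<close>
  define C :: "'a set \<Rightarrow> (unit \<Rightarrow> 'a \<Rightarrow> 'a) set" where "C B = {\<sigma>. semiregular d (\<sigma> ()) B}" for B
  have bij: "bij_betw (\<lambda>\<sigma>. \<sigma> ()) (C B) {f. semiregular d f B}" for B
    by (rule bij_betwI[where g = "\<lambda>f _. f"]) (auto simp: C_def)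
  have C: "card (C B) = card {f. semiregular d f B}" for B
    by (rule bij_betw_same_card[OF bij])
  have fin: "finite (C B)" if "finite B" for B
    using bij_betw_finite[OF bij] finite_semiregular[OF that] by blast
  have "card Y > 0" using Suc.prems assms(1) by simp
  then obtain y0 where y0: "y0 \<in> Y" by fastforce
  define \<rho> where "\<rho> = (\<lambda>_ :: unit. cyclic_shift d)"
  have tr: "transitive_action {..<d} 0 \<rho>"
    unfolding transitive_action_def
  proof (intro conjI allI ballI impI subsetI)
    show "0 \<in> {..<d}" using assms(1) by simp
    show "\<rho> i x \<in> {..<d}" if "x \<in> {..<d}" for i x using that by (simp add: \<rho>_def cyclic_shift_def)
    fix Z x assume Z: "0 \<in> Z" "\<forall>i. \<forall>x\<in>{..<d} \<inter> Z. \<rho> i x \<in> Z" and x: "x \<in> {..<d}"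
    have "x < d \<Longrightarrow> x \<in> Z" for x
    proof (induction x)
      case (Suc x)
      then have "\<rho> () x \<in> Z" using Z by simp
      then show ?case using Suc.prems by (simp add: \<rho>_def cyclic_shift_def)
    qed (use Z in simp)
    then show "x \<in> Z" using x by simp
  qed
  have IH: "card (C D) * (d ^ k * fact k) = fact (d * k)" if "finite D" "card D = d * k" for D
    using Suc.IH[OF that] C by simp
  define a where "a = (fact (d * k) :: nat) div (d ^ k * fact k)"
  have a: "card (C D) = a" if "finite D" "card D = d * k" for D
    unfolding a_def IH[OF that, symmetric] using assms(1) by simp
  have "card {\<sigma> \<in> C Y. extends_action {..<d} 0 \<rho> Y y0 \<sigma>} * fact (card Y - card {..<d}) = fact (card Y - 1) * a"
  proof (rule card_extends_action)
    show "\<sigma> i permutes B" if "\<sigma> \<in> C B" for \<sigma> B i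
      using that by (cases i) (auto simp: C_def semiregular_def)
  next
    fix \<sigma> h assume *: "\<sigma> \<in> C Y" "inj_on h {..<d}" "h ` {..<d} \<subseteq> Y" "equivariant_on {..<d} \<rho> \<sigma> h"
    have "\<sigma> () ` (h ` {..<d}) = h ` {..<d}"
      by (rule image_permutes_equivariant[OF _ semiregularD(1)[OF semiregular_cyclic_shift[OF assms(1)]]])
         (use * in \<open>auto simp: equivariant_on_def \<rho>_def\<close>)
    then show "restrict_action \<sigma> (Y - h ` {..<d}) \<in> C (Y - h ` {..<d})"
      using semiregular_restrict[of d "\<sigma> ()" Y "h ` {..<d}"] * by (simp add: C_def restrict_action_def[abs_def])
  next
    fix \<tau> h assume "\<tau> \<in> C (Y - h ` {..<d})" "inj_on h {..<d}" "h ` {..<d} \<subseteq> Y"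
    then show "glue_action {..<d} h \<rho> \<tau> \<in> C Y"
      using semiregular_glue[OF semiregular_cyclic_shift[OF assms(1)], of h Y "\<tau> ()"]
      by (simp add: C_def glue_action_def[abs_def] \<rho>_def)
  next
    fix D assume "D \<subseteq> Y" "card D = card Y - card {..<d}"
    then show "finite (C D) \<and> card (C D) = a"
      using a[of D] fin[of D] Suc.prems by (auto intro: finite_subset)
  qed (use Suc.prems y0 tr in auto)
  \<comment> \<open>Every permutation counted has a full cycle through y0, so the fibre over the
    model cycle is everything.\<close>
  moreover have "{\<sigma> \<in> C Y. extends_action {..<d} 0 \<rho> Y y0 \<sigma>} = C Y"
  proof -
    have "extends_action {..<d} 0 \<rho> Y y0 \<sigma>" if "\<sigma> \<in> C Y" for \<sigma>
    proof -
      have s: "semiregular d (\<sigma> ()) Y" using that by (simp add: C_def)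
      show ?thesis
        unfolding extends_action_def equivariant_on_def \<rho>_def
        using semiregular_orbit(1-4)[OF s y0 assms(1)] 
        by (intro exI[of _ "\<lambda>i. (\<sigma> () ^^ i) y0"]) auto
    qed
    then show ?thesis by blast
  qed
  ultimately have 1: "card (C Y) * fact (d * k) = fact (d * Suc k - 1) * a"
    using Suc.prems by simp
  obtain D where D: "D \<subseteq> Y" "card D = d * k"
    using obtain_subset_with_card_n[of "d * k" Y] Suc.prems by auto
  have 2: "a * (d ^ k * fact k) = fact (d * k)"
    using IH[of D] a[of D] D Suc.prems finite_subset by metis
  have "card (C Y) * (d ^ k * fact k) * fact (d * k) = fact (d * Suc k - 1) * fact (d * k)"
    using 1 2 by (metis mult.assoc mult.commute)
  then have "card (C Y) * (d ^ k * fact k) = fact (d * Suc k - 1)" by simp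
  then have "card (C Y) * (d ^ Suc k * fact (Suc k)) = (d * Suc k) * fact (d * Suc k - 1)"
    by (simp add: algebra_simps)
  also have "\<dots> = fact (d * Suc k)"
    using assms(1) by (subst (2) fact_reduce) (simp_all del: mult_Suc_right)
  finally show ?case using C by simp
qed

lemma semiregular_induct [consumes 3, case_names empty orbit]:
  assumes "finite Y" "semiregular d f Y" "d > 0"
    and "\<And>f. P {} f"
    and "\<And>Y f y. finite Y \<Longrightarrow> semiregular d f Y \<Longrightarrow> y \<in> Y \<Longrightarrow>
       P (Y - (\<lambda>i. (f ^^ i) y) ` {..<d}) (\<lambda>z. if z \<in> Y - (\<lambda>i. (f ^^ i) y) ` {..<d} then f z else z) \<Longrightarrow> P Y f"
  shows "P Y f"
  using assms(1,2)
proof (induction "card Y" arbitrary: Y f rule: less_induct)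
  case less
  show ?case
  proof (cases "Y = {}")
    case True
    then show ?thesis using assms(4) by simp
  next
    case False
    then obtain y where y: "y \<in> Y" by blast
    let ?D = "(\<lambda>i. (f ^^ i) y) ` {..<d}"
    note orb = semiregular_orbit[OF less.prems(2) y assms(3)]
    have "y \<in> ?D" using assms(3) by (force intro: image_eqI[of _ _ 0])
    then have "Y - ?D \<subset> Y" using y by blast
    then have "card (Y - ?D) < card Y" using less.prems(1) psubset_card_mono by blast
    then have "P (Y - ?D) (\<lambda>z. if z \<in> Y - ?D then f z else z)"
      using less.prems(1) semiregular_restrict[OF less.prems(2) orb(5) orb(2)] by (intro less.hyps) auto
    then show ?thesis using assms(5)[OF less.prems y] by blast
  qed
qed

lemma semiregular_dvd_card:
  assumes "finite Y" "semiregular d f Y" "d > 0"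
  shows "d dvd card Y"
  using assms
proof (induction rule: semiregular_induct)
  case (orbit Y f y)
  note orb = semiregular_orbit[OF orbit(2,3) assms(3)]
  have "card Y = card (Y - (\<lambda>i. (f ^^ i) y) ` {..<d}) + d"
    using card_Diff_subset[OF finite_subset[OF orb(2) orbit(1)] orb(2)] orb(6) card_mono[OF orbit(1) orb(2)] by simp
  then show ?case using orbit(4) by simp
qed simp

text \<open>Cycles are matched one by one: the i-th iterate of y is sent to the i-th iterate of a
  chosen y', and induction treats the complements.\<close>

lemma semiregular_conjugate:
  assumes "finite Y" "semiregular d f Y" "d > 0" "finite Y'" "semiregular d g Y'" "card Y = card Y'"
  shows "\<exists>\<pi>. bij_betw \<pi> Y Y' \<and> (\<forall>y\<in>Y. \<pi> (f y) = g (\<pi> y))"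
  using assms
proof (induction arbitrary: Y' g rule: semiregular_induct)
  case empty
  then show ?case by (auto simp: bij_betw_def)
next
  case (orbit Y f y)
  let ?h = "\<lambda>i. (f ^^ i) y"
  let ?D = "?h ` {..<d}"
  note o1 = semiregular_orbit[OF orbit(2,3) assms(3)]
  have "card Y' > 0" using orbit by (metis card_gt_0_iff empty_iff)
  then obtain y' where y': "y' \<in> Y'" by fastforce
  let ?h' = "\<lambda>i. (g ^^ i) y'"
  let ?D' = "?h' ` {..<d}"
  note o2 = semiregular_orbit[OF orbit(6) y' assms(3)]
  have c: "card (Y - ?D) = card (Y' - ?D')"
    using card_Diff_subset[OF finite_subset[OF o1(2) orbit(1)] o1(2)]
      card_Diff_subset[OF finite_subset[OF o2(2) orbit(5)] o2(2)] o1(6) o2(6) orbit(7) by simp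
  have "\<exists>\<pi>. bij_betw \<pi> (Y - ?D) (Y' - ?D') \<and>
      (\<forall>z\<in>Y - ?D. \<pi> (if z \<in> Y - ?D then f z else z) = (if \<pi> z \<in> Y' - ?D' then g (\<pi> z) else \<pi> z))"
    by (rule orbit.IH[OF _ semiregular_restrict[OF orbit(6) o2(5) o2(2)] c]) (use orbit in auto)
  then obtain \<pi> where \<pi>: "bij_betw \<pi> (Y - ?D) (Y' - ?D')"
    and eq: "\<forall>z\<in>Y - ?D. \<pi> (if z \<in> Y - ?D then f z else z) = (if \<pi> z \<in> Y' - ?D' then g (\<pi> z) else \<pi> z)"
    by blast
  define \<theta> where "\<theta> = (\<lambda>z. if z \<in> ?D then ?h' (inv_into {..<d} ?h z) else \<pi> z)"
  have \<theta>h: "\<theta> (?h i) = ?h' i" if "i < d" for i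
  proof -
    have "inv_into {..<d} ?h (?h i) = i" by (rule inv_into_f_f[OF o1(1)]) (use that in simp)
    then show ?thesis using that by (simp add: \<theta>_def)
  qed
  have b1: "bij_betw \<theta> ?D ?D'"
  proof -
    have "bij_betw (?h' \<circ> inv_into {..<d} ?h) ?D ?D'"
      using o1(1) o2(1) by (intro bij_betw_trans[of _ _ "{..<d}"])
        (auto simp: bij_betw_inv_into inj_on_imp_bij_betw)
    then show ?thesis by (rule bij_betw_cong[THEN iffD1, rotated]) (simp add: \<theta>_def)
  qed
  have b2: "bij_betw \<theta> (Y - ?D) (Y' - ?D')"
    using \<pi> by (rule bij_betw_cong[THEN iffD1, rotated]) (simp add: \<theta>_def)
  have "bij_betw \<theta> (?D \<union> (Y - ?D)) (?D' \<union> (Y' - ?D'))"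
    using b1 b2 by (rule bij_betw_combine) auto
  moreover have "?D \<union> (Y - ?D) = Y" "?D' \<union> (Y' - ?D') = Y'" using o1(2) o2(2) by blast+
  ultimately have "bij_betw \<theta> Y Y'" by simp
  moreover have "\<theta> (f z) = g (\<theta> z)" if z: "z \<in> Y" for z
  proof (cases "z \<in> ?D")
    case True
    then obtain i where i: "i < d" "z = ?h i" by blast
    have i': "cyclic_shift d i < d" using i(1) by (simp add: cyclic_shift_def)
    show ?thesis
      using \<theta>h[OF i'] \<theta>h[OF i(1)] o1(4)[OF i(1)] o2(4)[OF i(1)] i(2) by metis
  next
    case False
    then have z': "z \<in> Y - ?D" using z by blast
    have "f z \<in> Y" using permutes_in_image[OF semiregularD(1)[OF orbit(2)]] z by blast
    moreover have "f z \<notin> ?D"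
    proof
      assume "f z \<in> ?D"
      then have "f z \<in> f ` ?D" using o1(5) by simp
      then show False using False permutes_inj[OF semiregularD(1)[OF orbit(2)]] by (simp add: inj_image_mem_iff)
    qed
    ultimately have fz: "\<theta> (f z) = \<pi> (f z)" by (simp add: \<theta>_def)
    have "\<pi> z \<in> Y' - ?D'" using bij_betw_apply[OF \<pi> z'] .
    then have "\<pi> (f z) = g (\<pi> z)" using bspec[OF eq z'] z' by simp
    then show ?thesis using fz False by (simp add: \<theta>_def)
  qed
  ultimately show ?case by blast
qed

lemma permutes_conjugate_funpow:
  assumes "\<pi> permutes Y"
  shows "(\<pi> \<circ> f \<circ> inv_into UNIV \<pi>) ^^ n = \<pi> \<circ> f ^^ n \<circ> inv_into UNIV \<pi>"
proof (induction n)
  case 0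
  then show ?case using permutes_inv_o[OF assms] by simp
next
  case (Suc n)
  have "(\<pi> \<circ> f \<circ> inv_into UNIV \<pi>) \<circ> (\<pi> \<circ> f ^^ n \<circ> inv_into UNIV \<pi>) = \<pi> \<circ> f \<circ> (inv_into UNIV \<pi> \<circ> \<pi>) \<circ> f ^^ n \<circ> inv_into UNIV \<pi>"
    by (simp only: comp_assoc)
  also have "\<dots> = \<pi> \<circ> (f \<circ> f ^^ n) \<circ> inv_into UNIV \<pi>"
    unfolding permutes_inv_o(2)[OF assms] by (simp only: comp_assoc comp_id)
  finally show ?case by (simp only: funpow.simps(2) Suc)
qed

lemma semiregular_conj:
  assumes "\<pi> permutes Y" "semiregular d f Y"
  shows "semiregular d (\<pi> \<circ> f \<circ> inv_into UNIV \<pi>) Y"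
  unfolding semiregular_def
proof (intro conjI ballI)
  show "\<pi> \<circ> f \<circ> inv_into UNIV \<pi> permutes Y"
    using assms semiregularD(1) by (intro permutes_compose permutes_inv) auto
  fix y assume "y \<in> Y"
  then have "inv_into UNIV \<pi> y \<in> Y" using permutes_in_image[OF permutes_inv[OF assms(1)]] by simp
  moreover have "\<pi> x = y \<longleftrightarrow> x = inv_into UNIV \<pi> y" for x using permutes_inv_eq[OF assms(1)] by metis
  ultimately show "((\<pi> \<circ> f \<circ> inv_into UNIV \<pi>) ^^ d) y = y" "\<forall>i. 0 < i \<and> i < d \<longrightarrow> ((\<pi> \<circ> f \<circ> inv_into UNIV \<pi>) ^^ i) y \<noteq> y"
    using semiregularD[OF assms(2)] by (simp_all add: permutes_conjugate_funpow[OF assms(1)])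
qed

section \<open>Counting actions of the group with all cycles of full length\<close>

definition semiregular_roots :: "nat \<Rightarrow> nat \<Rightarrow> 'a set \<Rightarrow> ('a \<Rightarrow> 'a) \<Rightarrow> ('a \<Rightarrow> 'a) set" where
  "semiregular_roots e m Y c = {f. semiregular (e * m) f Y \<and> f ^^ e = c}"

text \<open>The permutations c and c' are conjugate, and conjugation carries roots of c injectively
  to roots of c'. Exchanging c and c' turns the inequality into an equality.\<close>

lemma card_semiregular_roots_le:
  assumes "finite Y" "m > 0" "semiregular m c Y" "semiregular m c' Y"
  shows "card (semiregular_roots e m Y c) \<le> card (semiregular_roots e m Y c')"
proof -
  obtain \<pi>0 where \<pi>0: "bij_betw \<pi>0 Y Y" "\<And>y. y \<in> Y \<Longrightarrow> \<pi>0 (c y) = c' (\<pi>0 y)"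
    using semiregular_conjugate[OF assms(1,3,2,1,4)] by blast
  define \<pi> where "\<pi> y = (if y \<in> Y then \<pi>0 y else y)" for y
  have \<pi>: "\<pi> permutes Y"
  proof (rule bij_imp_permutes)
    show "bij_betw \<pi> Y Y" using \<pi>0(1) by (rule bij_betw_cong[THEN iffD1, rotated]) (simp add: \<pi>_def)
  qed (simp add: \<pi>_def)
  have c: "c permutes Y" "c' permutes Y" using assms by (auto simp: semiregular_def)
  have "\<pi> (c y) = c' (\<pi> y)" for y
    using \<pi>0(2) permutes_in_image[OF c(1)] permutes_not_in[OF c(1)] permutes_not_in[OF c(2)]
    by (simp add: \<pi>_def)
  then have conj: "\<pi> \<circ> c \<circ> inv_into UNIV \<pi> = c'"
    using permutes_inv_o(1)[OF \<pi>] by (auto simp: fun_eq_iff)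
  have "(\<lambda>f. \<pi> \<circ> f \<circ> inv_into UNIV \<pi>) ` semiregular_roots e m Y c \<subseteq> semiregular_roots e m Y c'"
    using semiregular_conj[OF \<pi>] conj
    by (auto simp: semiregular_roots_def permutes_conjugate_funpow[OF \<pi>])
  moreover have "inj_on (\<lambda>f. \<pi> \<circ> f \<circ> inv_into UNIV \<pi>) (semiregular_roots e m Y c)"
  proof (rule inj_onI)
    fix f g assume "\<pi> \<circ> f \<circ> inv_into UNIV \<pi> = \<pi> \<circ> g \<circ> inv_into UNIV \<pi>"
    then have "inv_into UNIV \<pi> \<circ> (\<pi> \<circ> f \<circ> inv_into UNIV \<pi>) \<circ> \<pi> = inv_into UNIV \<pi> \<circ> (\<pi> \<circ> g \<circ> inv_into UNIV \<pi>) \<circ> \<pi>" by simp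
    then have "(inv_into UNIV \<pi> \<circ> \<pi>) \<circ> f \<circ> (inv_into UNIV \<pi> \<circ> \<pi>) = (inv_into UNIV \<pi> \<circ> \<pi>) \<circ> g \<circ> (inv_into UNIV \<pi> \<circ> \<pi>)"
      by (simp only: comp_assoc)
    then show "f = g" using permutes_inv_o(2)[OF \<pi>] by simp
  qed
  moreover have "finite (semiregular_roots e m Y c')"
    unfolding semiregular_roots_def by (rule finite_subset[OF _ finite_semiregular[OF assms(1)]]) auto
  ultimately show ?thesis by (intro card_inj_on_le)
qed

lemma semiregular_funpow:
  assumes "semiregular (e * m) f Y" "e > 0"
  shows "semiregular m (f ^^ e) Y"
  unfolding semiregular_def
proof (intro conjI ballI allI impI)
  show "f ^^ e permutes Y" using semiregularD(1)[OF assms(1)] permutes_funpow by blast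
  fix y i assume y: "y \<in> Y"
  show "((f ^^ e) ^^ m) y = y" using semiregularD(2)[OF assms(1) y] by (simp add: funpow_mult)
  assume "0 < i \<and> i < m"
  then have "0 < e * i" "e * i < e * m" using assms(2) by auto
  then show "((f ^^ e) ^^ i) y \<noteq> y" using semiregularD(3)[OF assms(1) y] by (simp add: funpow_mult)
qed

definition gamma_action :: "nat \<Rightarrow> 'a set \<Rightarrow> (gamma_gen \<Rightarrow> 'a \<Rightarrow> 'a) \<Rightarrow> bool" where
  "gamma_action m Y \<sigma> \<longleftrightarrow> semiregular (2 * m) (\<sigma> gen_x) Y \<and> semiregular (3 * m) (\<sigma> gen_y) Y \<and>
     \<sigma> gen_x ^^ 2 = \<sigma> gen_y ^^ 3"

lemma UNIV_gamma_gen: "UNIV = {gen_x, gen_y}"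
  using gamma_gen.exhaust by auto

lemma finite_semiregular_roots: "finite Y \<Longrightarrow> finite (semiregular_roots e m Y c)"
  unfolding semiregular_roots_def by (rule finite_subset[OF _ finite_semiregular]) auto

text \<open>An action is a common value c of x^2 and y^3 with independent choices of a square root
  and a cube root of c.\<close>

lemma bij_betw_gamma_action:
  "bij_betw (\<lambda>\<sigma>. (\<sigma> gen_x ^^ 2, \<sigma> gen_x, \<sigma> gen_y)) {\<sigma>. gamma_action m Y \<sigma>}
     (SIGMA c : {c. semiregular m c Y}. semiregular_roots 2 m Y c \<times> semiregular_roots 3 m Y c)"
  by (rule bij_betwI[where g = "\<lambda>(c, f, g). case_gamma_gen f g"])
     (auto simp: gamma_action_def semiregular_roots_def fun_eq_iff dest: semiregular_funpow[of 2] split: gamma_gen.split)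

text \<open>Let S(d) count the permutations with all cycles of length d. The number r(e) of
  admissible e-th roots is the same for all permutations counted by S(m), so S(e m) = S(m) r(e), and
  the number of actions is S(m) r(2) r(3).\<close>

lemma card_gamma_action_mult:
  assumes "finite Y" "m > 0"
  shows "finite {\<sigma>. gamma_action m Y \<sigma>}"
    and "card {\<sigma>. gamma_action m Y \<sigma>} * card {f. semiregular m f Y} =
      card {f. semiregular (2 * m) f Y} * card {f. semiregular (3 * m) f Y}"
proof -
  let ?S = "\<lambda>d. {f. semiregular d f Y}"
  have fin: "finite (?S d)" for d by (rule finite_semiregular[OF assms(1)])
  show "finite {\<sigma>. gamma_action m Y \<sigma>}"
    unfolding bij_betw_finite[OF bij_betw_gamma_action]
    using fin finite_semiregular_roots[OF assms(1)] by (intro finite_SigmaI finite_cartesian_product) auto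
  show "card {\<sigma>. gamma_action m Y \<sigma>} * card (?S m) = card (?S (2 * m)) * card (?S (3 * m))"
  proof -
    define r where "r e = (if ?S m = {} then 0 else card (semiregular_roots e m Y (SOME c. semiregular m c Y)))" for e
    have r: "card (semiregular_roots e m Y c) = r e" if "semiregular m c Y" for e c
      using card_semiregular_roots_le[OF assms, of c "SOME c. semiregular m c Y" e] 
        card_semiregular_roots_le[OF assms, of "SOME c. semiregular m c Y" c e] that
        someI[of "\<lambda>c. semiregular m c Y", OF that]
      by (auto simp: r_def)
    have S: "card (?S (e * m)) = card (?S m) * r e" if "e > 0" for e
    proof -
      have "?S (e * m) = (\<Union>c\<in>?S m. semiregular_roots e m Y c)"
        using semiregular_funpow[OF _ that] by (auto simp: semiregular_roots_def)
      moreover have "card (\<Union>c\<in>?S m. semiregular_roots e m Y c) = (\<Sum>c\<in>?S m. card (semiregular_roots e m Y c))"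
        using fin finite_semiregular_roots[OF assms(1)]
        by (intro card_UN_disjoint) (auto simp: semiregular_roots_def)
      ultimately show ?thesis by (simp add: r)
    qed
    have "card {\<sigma>. gamma_action m Y \<sigma>} =
        card (SIGMA c : ?S m. semiregular_roots 2 m Y c \<times> semiregular_roots 3 m Y c)"
      by (rule bij_betw_same_card[OF bij_betw_gamma_action])
    also have "\<dots> = (\<Sum>c\<in>?S m. card (semiregular_roots 2 m Y c \<times> semiregular_roots 3 m Y c))"
      using fin finite_semiregular_roots[OF assms(1)] by (intro card_SigmaI) auto
    also have "\<dots> = card (?S m) * (r 2 * r 3)"
      by (simp add: r card_cartesian_product)
    finally show ?thesis using S[of 2] S[of 3] by simp
  qed
qed

lemma card_gamma_action:
  assumes "finite Y" "m > 0" "card Y = 6 * m * k"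
  shows "of_nat (card {\<sigma>. gamma_action m Y \<sigma>}) = fact (6 * m * k) * hom_coeff m k"
proof -
  have s: "of_nat (card {f. semiregular d f Y}) = (fact (6 * m * k) :: rat) / (of_nat d ^ j * fact j)"
    if "d > 0" "6 * m * k = d * j" for d j
  proof -
    have "of_nat (card {f. semiregular d f Y} * (d ^ j * fact j)) = (of_nat (fact (d * j)) :: rat)"
      using card_semiregular[of d Y j] that assms by (simp only:)
    then show ?thesis using that by (simp add: field_simps)
  qed
  have s1: "of_nat (card {f. semiregular m f Y}) = (fact (6 * m * k) :: rat) / (of_nat m ^ (6 * k) * fact (6 * k))"
    using assms by (intro s) auto
  have s2: "of_nat (card {f. semiregular (2 * m) f Y}) = (fact (6 * m * k) :: rat) / (of_nat (2 * m) ^ (3 * k) * fact (3 * k))"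
    using assms by (intro s) auto
  have s3: "of_nat (card {f. semiregular (3 * m) f Y}) = (fact (6 * m * k) :: rat) / (of_nat (3 * m) ^ (2 * k) * fact (2 * k))"
    using assms by (intro s) auto
  define F where "F = (fact (6 * m * k) :: rat)"
  define M where "M = (of_nat m :: rat)"
  have nz: "F \<noteq> 0" "M \<noteq> 0" using assms by (simp_all add: F_def M_def)
  \<comment> \<open>The exponents 3 k and 2 k are the numbers of cycles of x and of y.\<close>
  have p: "(72 :: rat) ^ k = 2 ^ (3 * k) * 3 ^ (2 * k)"
    by (simp add: power_mult flip: power_mult_distrib)
  have M: "M ^ (6 * k) = M ^ k * (M ^ (3 * k) * M ^ (2 * k))"
    by (simp flip: power_add)
  have "of_nat (card {\<sigma>. gamma_action m Y \<sigma>} * card {f. semiregular m f Y}) =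
      (of_nat (card {f. semiregular (2 * m) f Y} * card {f. semiregular (3 * m) f Y}) :: rat)"
    using card_gamma_action_mult(2)[OF assms(1,2)] by (simp only:)
  then have "of_nat (card {\<sigma>. gamma_action m Y \<sigma>}) * (F / (M ^ (6 * k) * fact (6 * k))) =
     F / ((2 * M) ^ (3 * k) * fact (3 * k)) * (F / ((3 * M) ^ (2 * k) * fact (2 * k)))"
    unfolding of_nat_mult s1 s2 s3 F_def[symmetric] M_def by simp
  then have "of_nat (card {\<sigma>. gamma_action m Y \<sigma>}) =
      F * (M ^ (6 * k) * fact (6 * k)) / (((2 * M) ^ (3 * k) * fact (3 * k)) * ((3 * M) ^ (2 * k) * fact (2 * k)))"
    using nz by (simp add: field_simps)
  also have "\<dots> = F * hom_coeff m k"
    unfolding hom_coeff_def power_mult_distrib M using nz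
    by (simp add: p M_def)
  finally show ?thesis by (simp add: F_def)
qed

lemma gamma_action_card:
  assumes "finite Y" "m > 0" "gamma_action m Y \<sigma>"
  shows "6 * m dvd card Y"
proof -
  have "2 * m dvd card Y" "3 * m dvd card Y"
    using assms semiregular_dvd_card[of Y] by (auto simp: gamma_action_def)
  then obtain a b where ab: "card Y = 2 * m * a" "card Y = 3 * m * b" unfolding dvd_def by blast
  then have "2 * a = 3 * b" using assms(2) by simp
  then have "3 dvd a" by presburger
  then show ?thesis using ab(1) by auto
qed

text \<open>Its purpose is to show that the generators have orders exactly 2 m and 3 m.\<close>

lemma ex_gamma_action:
  assumes "m > 0"
  shows "\<exists>\<sigma>. gamma_action m {..<6 * m} \<sigma>"
proof -
  have "hom_coeff m 1 > 0" using assms by (simp add: hom_coeff_def)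
  then have "of_nat (card {\<sigma>. gamma_action m {..<6 * m} \<sigma>}) > (0 :: rat)"
    using card_gamma_action[of "{..<6 * m}" m 1] assms by simp
  then have "{\<sigma>. gamma_action m {..<6 * m} \<sigma>} \<noteq> {}" by (metis card.empty less_irrefl of_nat_0)
  then show ?thesis by blast
qed

lemma gamma_action_restrict:
  assumes "gamma_action m Y \<sigma>" "\<And>i. \<sigma> i ` D = D" "D \<subseteq> Y"
  shows "gamma_action m (Y - D) (restrict_action \<sigma> (Y - D))"
proof -
  let ?B = "Y - D"
  have s: "semiregular (2 * m) (restrict_action \<sigma> ?B gen_x) ?B" "semiregular (3 * m) (restrict_action \<sigma> ?B gen_y) ?B"
    unfolding restrict_action_def[abs_def]
    using assms by (auto intro!: semiregular_restrict simp: gamma_action_def simp del: Diff_iff)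
  have perm: "restrict_action \<sigma> ?B i permutes ?B" for i
    using s by (cases i) (auto simp: semiregular_def)
  have pw: "(restrict_action \<sigma> ?B i ^^ n) y = (\<sigma> i ^^ n) y" if "y \<in> ?B" for i n y
  proof (rule funpow_cong_on[of ?B "restrict_action \<sigma> ?B i" "\<sigma> i", OF _ _ that])
    show "restrict_action \<sigma> ?B i z \<in> ?B" if "z \<in> ?B" for z using permutes_in_image[OF perm] that by blast
    show "restrict_action \<sigma> ?B i z = \<sigma> i z" if "z \<in> ?B" for z using that by (simp add: restrict_action_def)
  qed
  have "(restrict_action \<sigma> ?B gen_x ^^ 2) y = (restrict_action \<sigma> ?B gen_y ^^ 3) y" for y
  proof (cases "y \<in> ?B")
    case True
    then show ?thesis using assms(1) by (simp add: pw gamma_action_def)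
  next
    case False
    then show ?thesis
      using permutes_not_in[OF permutes_funpow[OF perm], of y] by simp
  qed
  then show ?thesis using s unfolding gamma_action_def by blast
qed

lemma gamma_action_glue:
  assumes "gamma_action m X \<rho>" "inj_on h X" "h ` X \<subseteq> Y" "gamma_action m (Y - h ` X) \<tau>"
  shows "gamma_action m Y (glue_action X h \<rho> \<tau>)"
proof -
  let ?g = "glue_action X h \<rho> \<tau>"
  have s: "semiregular (2 * m) (?g gen_x) Y" "semiregular (3 * m) (?g gen_y) Y"
    unfolding glue_action_def[abs_def]
    using assms by (auto intro!: semiregular_glue simp: gamma_action_def)
  have perm: "?g i permutes Y" "\<rho> i permutes X" "\<tau> i permutes (Y - h ` X)" for i
    using s assms(1,4) by (cases i; auto simp: semiregular_def gamma_action_def)+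
  have X: "h ((\<rho> i ^^ n) x) = (?g i ^^ n) (h x)" if "x \<in> X" for x i n
    using funpow_equivariant[of X "\<rho> i" h "?g i" x n] that permutes_in_image[OF perm(2)] assms(2)
    by (simp add: glue_action_def)
  have R: "(\<tau> i ^^ n) y = (?g i ^^ n) y" if y: "y \<in> Y - h ` X" for y i n
  proof (rule funpow_cong_on[of "Y - h ` X", OF _ _ y])
    show "\<tau> i z \<in> Y - h ` X" if "z \<in> Y - h ` X" for z using permutes_in_image[OF perm(3)] that by blast
    show "\<tau> i z = ?g i z" if "z \<in> Y - h ` X" for z using that by (simp add: glue_action_def)
  qed
  have "(?g gen_x ^^ 2) y = (?g gen_y ^^ 3) y" for y
  proof -
    consider x where "x \<in> X" "y = h x" | "y \<in> Y - h ` X" | "y \<notin> Y" by blast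
    then show ?thesis
    proof cases
      case 1
      then show ?thesis using assms(1) X[OF 1(1), symmetric] by (simp add: gamma_action_def)
    next
      case 2
      then show ?thesis using assms(4) R[OF 2, symmetric] by (simp add: gamma_action_def)
    next
      case 3
      then show ?thesis using permutes_not_in[OF permutes_funpow[OF perm(1)], of y] by simp
    qed
  qed
  then show ?thesis using s unfolding gamma_action_def by blast
qed

section \<open>Words and free groups\<close>

definition letter_act :: "('g \<Rightarrow> 'z \<Rightarrow> 'z) \<Rightarrow> 'g \<times> bool \<Rightarrow> 'z \<Rightarrow> 'z" where
  "letter_act \<sigma> l = (if snd l then \<sigma> (fst l) else inv_into UNIV (\<sigma> (fst l)))"

text \<open>Letters act in reading order, so a product acts first by its left factor; this fits
  right multiplication on right cosets.\<close>

definition word_act :: "('g \<Rightarrow> 'z \<Rightarrow> 'z) \<Rightarrow> 'g group_word \<Rightarrow> 'z \<Rightarrow> 'z" where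
  "word_act \<sigma> w = fold (letter_act \<sigma>) w"

lemma word_act_simps [simp]:
  "word_act \<sigma> [] z = z"
  "word_act \<sigma> (l # w) z = word_act \<sigma> w (letter_act \<sigma> l z)"
  by (simp_all add: word_act_def)

lemma word_act_append [simp]: "word_act \<sigma> (u @ v) z = word_act \<sigma> v (word_act \<sigma> u z)"
  by (simp add: word_act_def)

lemma word_act_replicate: "word_act \<sigma> (replicate n (s, True)) z = (\<sigma> s ^^ n) z"
  by (induction n arbitrary: z) (simp_all add: letter_act_def funpow_swap1)

lemma word_act_word_rel:
  assumes "\<And>s. bij (\<sigma> s)" "\<And>u v. (u, v) \<in> R \<Longrightarrow> word_act \<sigma> u = word_act \<sigma> v" "(u, v) \<in> word_rel S R"
  shows "word_act \<sigma> u z = word_act \<sigma> v z"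
  using assms(3)
proof (induction arbitrary: z rule: word_rel.induct)
  case (cancel s b)
  have "\<sigma> s (inv_into UNIV (\<sigma> s) z) = z" "inv_into UNIV (\<sigma> s) (\<sigma> s z) = z"
    using assms(1)[of s] by (simp_all add: bij_is_surj surj_f_inv_f bij_is_inj)
  then show ?case by (cases b) (simp_all add: letter_act_def)
qed (use assms(2) in auto)

abbreviation word_class :: "'g set \<Rightarrow> ('g group_word \<times> 'g group_word) set \<Rightarrow> 'g group_word \<Rightarrow> 'g group_word set" where
  "word_class S R w \<equiv> word_rel S R `` {w}"

lemma carrier_presented_group: "carrier (presented_group S R) = word_class S R ` words S"
  by (auto simp: presented_group_def quotient_def)

lemma word_class_in_carrier: "w \<in> words S \<Longrightarrow> word_class S R w \<in> carrier (presented_group S R)"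
  by (simp add: carrier_presented_group)

lemma one_presented_group: "\<one>\<^bsub>presented_group S R\<^esub> = word_class S R []"
  by (simp add: presented_group_def)

lemma word_class_eq_iff:
  "u \<in> words S \<Longrightarrow> v \<in> words S \<Longrightarrow> word_class S R u = word_class S R v \<longleftrightarrow> (u, v) \<in> word_rel S R"
  by (rule eq_equiv_class_iff[OF equiv_word_rel])

lemma word_class_self: "w \<in> words S \<Longrightarrow> w \<in> word_class S R w"
  by (simp add: word_rel.refl)

lemma in_word_class: "v \<in> word_class S R w \<Longrightarrow> (w, v) \<in> word_rel S R"
  by simp

lemma word_class_replicate:
  assumes "l \<in> S \<times> UNIV"
  shows "word_class S R (replicate n l) = word_class S R [l] [^]\<^bsub>presented_group S R\<^esub> n"
proof (induction n)
  case 0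
  then show ?case by (simp add: one_presented_group)
next
  case (Suc n)
  interpret group "presented_group S R" by (rule group_presented_group)
  have w: "replicate n l \<in> words S" "[l] \<in> words S" using assms by (auto simp: words_def)
  have "word_class S R (replicate (Suc n) l) = word_class S R (replicate n l @ [l])"
    by (simp add: replicate_append_same)
  also have "\<dots> = word_class S R (replicate n l) \<otimes>\<^bsub>presented_group S R\<^esub> word_class S R [l]"
    by (rule mult_word_class[OF w, symmetric])
  finally show ?case by (simp add: Suc)
qed

lemma word_class_inverse_letter:
  assumes "s \<in> S"
  shows "word_class S R [(s, \<not> b)] = inv\<^bsub>presented_group S R\<^esub> (word_class S R [(s, b)])"
proof -
  interpret group "presented_group S R" by (rule group_presented_group)
  have w: "[(s, c)] \<in> words S" for c using assms by (simp add: words_def)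
  have "word_class S R [(s, \<not> b)] \<otimes>\<^bsub>presented_group S R\<^esub> word_class S R [(s, b)] = \<one>\<^bsub>presented_group S R\<^esub>"
    unfolding mult_word_class[OF w w] one_presented_group
    using word_rel.cancel[OF assms, of "\<not> b"] w[of b] w[of "\<not> b"]
    by (subst word_class_eq_iff) (auto simp: words_def)
  then show ?thesis using inv_equality[OF _ word_class_in_carrier[OF w] word_class_in_carrier[OF w]] by simp
qed

section \<open>Evaluation of words in a group\<close>

definition word_eval :: "('b, 'c) monoid_scheme \<Rightarrow> ('g \<Rightarrow> 'b) \<Rightarrow> 'g group_word \<Rightarrow> 'b" where
  "word_eval G f w = foldr (\<lambda>(s, b) a. (if b then f s else inv\<^bsub>G\<^esub> (f s)) \<otimes>\<^bsub>G\<^esub> a) w \<one>\<^bsub>G\<^esub>"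

context group
begin

lemma inv_mult_cancel: "g \<in> carrier G \<Longrightarrow> y \<in> carrier G \<Longrightarrow> inv g \<otimes> (g \<otimes> y) = y"
  by (simp flip: m_assoc)

lemma conjugate_nat_pow:
  fixes k :: nat
  assumes "g \<in> carrier G" "x \<in> carrier G"
  shows "(g \<otimes> x \<otimes> inv g) [^] k = g \<otimes> x [^] k \<otimes> inv g"
  using assms by (induction k) (simp_all add: m_assoc inv_mult_cancel)

lemma conjugate_eq_one:
  assumes "g \<in> carrier G" "x \<in> carrier G" "g \<otimes> x \<otimes> inv g = \<one>"
  shows "x = \<one>"
proof -
  have "x = inv g \<otimes> (g \<otimes> x \<otimes> inv g) \<otimes> g"
    using assms(1,2) by (simp add: m_assoc inv_mult_cancel)
  then show ?thesis using assms by simp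
qed

lemma word_eval_simps [simp]:
  "word_eval G f [] = \<one>"
  "word_eval G f ((s, b) # w) = (if b then f s else inv (f s)) \<otimes> word_eval G f w"
  by (simp_all add: word_eval_def)

lemma word_eval_closed: "f \<in> S \<rightarrow> carrier G \<Longrightarrow> w \<in> words S \<Longrightarrow> word_eval G f w \<in> carrier G"
  by (induction w) (auto simp: words_def Pi_iff)

lemma word_eval_append:
  assumes "f \<in> S \<rightarrow> carrier G" "u \<in> words S" "v \<in> words S"
  shows "word_eval G f (u @ v) = word_eval G f u \<otimes> word_eval G f v"
  using assms(2)
proof (induction u)
  case Nil
  then show ?case using word_eval_closed[OF assms(1,3)] by simp
next
  case (Cons l u)
  obtain s b where l: "l = (s, b)" by force
  have "f s \<in> carrier G" "u \<in> words S" using Cons.prems assms(1) by (auto simp: l words_def)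
  then show ?case
    using Cons.IH word_eval_closed[OF assms(1)] assms(3) by (simp add: l m_assoc)
qed

lemma word_eval_word_rel:
  assumes "f \<in> S \<rightarrow> carrier G" "(u, v) \<in> word_rel S {}"
  shows "word_eval G f u = word_eval G f v"
  using assms(2)
proof (induction rule: word_rel.induct)
  case (append u v u' v')
  then show ?case
    using word_rel_in_words[OF append(1)] word_rel_in_words[OF append(2)] word_eval_append[OF assms(1)] by simp
next
  case (cancel s b)
  have "f s \<in> carrier G" using cancel assms(1) by auto
  then show ?case by simp
qed auto

definition class_eval :: "('g \<Rightarrow> 'a) \<Rightarrow> 'g group_word set \<Rightarrow> 'a" where
  "class_eval f A = word_eval G f (SOME w. w \<in> A)"

lemma class_eval_word_class:
  assumes "f \<in> S \<rightarrow> carrier G" "w \<in> words S"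
  shows "class_eval f (word_class S {} w) = word_eval G f w"
proof -
  have "(SOME v. v \<in> word_class S {} w) \<in> word_class S {} w"
    using word_class_self[OF assms(2)] by (rule someI)
  then show ?thesis
    unfolding class_eval_def using word_eval_word_rel[OF assms(1) in_word_class] by metis
qed

text \<open>The universal property of the free group on S: a map from S into a group extends to a
  homomorphism.\<close>

lemma class_eval_hom:
  assumes "f \<in> S \<rightarrow> carrier G"
  shows "class_eval f \<in> hom (presented_group S {}) G"
proof (rule homI)
  fix A B assume "A \<in> carrier (presented_group S {})" "B \<in> carrier (presented_group S {})"
  then obtain u v where "u \<in> words S" "A = word_class S {} u" "v \<in> words S" "B = word_class S {} v"
    by (auto simp: carrier_presented_group)
  then show "class_eval f (A \<otimes>\<^bsub>presented_group S {}\<^esub> B) = class_eval f A \<otimes> class_eval f B"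
    by (simp add: mult_word_class class_eval_word_class[OF assms] words_append word_eval_append[OF assms])
qed (auto simp: carrier_presented_group class_eval_word_class[OF assms] word_eval_closed[OF assms])

end

section \<open>Reduced words and torsion in free groups\<close>

definition inv_letter :: "'g \<times> bool \<Rightarrow> 'g \<times> bool" where
  "inv_letter l = (fst l, \<not> snd l)"

lemma inv_letter_simps [simp]: "inv_letter (inv_letter l) = l" "inv_letter l \<noteq> l"
  "inv_letter (s, b) = (s, \<not> b)" "fst (inv_letter l) = fst l"
  by (auto simp: inv_letter_def prod_eq_iff)

abbreviation reduced :: "'g group_word \<Rightarrow> bool" where
  "reduced \<equiv> successively (\<lambda>a b. b \<noteq> inv_letter a)"

definition push_letter :: "'g \<times> bool \<Rightarrow> 'g group_word \<Rightarrow> 'g group_word" where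
  "push_letter l r = (if r \<noteq> [] \<and> hd r = inv_letter l then tl r else l # r)"

text \<open>Van der Waerden's action of the free group on reduced words. Lists that are not reduced
  stay fixed, so that each generator acts as a bijection of the whole type.\<close>

definition reduced_act :: "'g \<Rightarrow> 'g group_word \<Rightarrow> 'g group_word" where
  "reduced_act s r = (if reduced r then push_letter (s, True) r else r)"

lemma reduced_push_letter: "reduced r \<Longrightarrow> reduced (push_letter l r)"
  by (cases r) (auto simp: push_letter_def successively_Cons)

lemma push_letter_inverse: "reduced r \<Longrightarrow> push_letter l (push_letter (inv_letter l) r) = r"
  by (cases r) (auto simp: push_letter_def successively_Cons)

lemma
  fixes s :: 'g and l :: "'g \<times> bool"
  shows bij_reduced_act: "bij (reduced_act s)"
    and letter_act_reduced: "reduced r \<Longrightarrow> letter_act reduced_act l r = push_letter l r"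
proof -
  define g where "g s r = (if reduced r then push_letter (s, False) r else r)" for s :: 'g and r
  have 1: "reduced_act s \<circ> g s = id" for s
    using push_letter_inverse[of _ "(s, True)"] by (auto simp: reduced_act_def g_def reduced_push_letter fun_eq_iff)
  have 2: "g s \<circ> reduced_act s = id" for s
    using push_letter_inverse[of _ "(s, False)"] by (auto simp: reduced_act_def g_def reduced_push_letter fun_eq_iff)
  show "bij (reduced_act s)" by (rule o_bij[OF 2 1])
  have inv: "inv_into UNIV (reduced_act s) = g s" for s by (rule inv_unique_comp[OF 1 2])
  show "reduced r \<Longrightarrow> letter_act reduced_act l r = push_letter l r"
    by (cases l; cases "snd l") (auto simp: letter_act_def inv g_def reduced_act_def)
qed

lemma reduced_rev: "reduced w \<Longrightarrow> reduced (rev w)"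
proof -
  have "b \<noteq> inv_letter a \<longleftrightarrow> a \<noteq> inv_letter b" for a b :: "'a \<times> bool" by auto
  then show "reduced w \<Longrightarrow> reduced (rev w)" by (simp add: successively_rev)
qed

text \<open>Letters are pushed at the front, so the word comes out reversed. In particular a
  nonempty reduced word moves the empty list and is not trivial in the free group.\<close>

lemma word_act_reduced: "reduced w \<Longrightarrow> word_act reduced_act w [] = rev w"
proof (induction w rule: rev_induct)
  case (snoc l w)
  then have w: "reduced w" and last: "w \<noteq> [] \<longrightarrow> l \<noteq> inv_letter (last w)"
    by (auto simp: successively_append_iff)
  have "w \<noteq> [] \<longrightarrow> hd (rev w) \<noteq> inv_letter l"
    using last by (auto simp: hd_rev)
  then show ?case
    using snoc.IH[OF w] letter_act_reduced[OF reduced_rev[OF w]] by (auto simp: push_letter_def)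
qed simp

lemma not_reducedE:
  assumes "\<not> reduced w"
  obtains u l v where "w = u @ [l, inv_letter l] @ v"
proof -
  have "\<exists>u l v. w = u @ [l, inv_letter l] @ v"
    using assms
  proof (induction w)
    case (Cons a w)
    show ?case
    proof (cases "reduced w")
      case True
      then obtain w' where "w = inv_letter a # w'" using Cons.prems by (cases w) (auto simp: successively_Cons)
      then have "a # w = [] @ [a, inv_letter a] @ w'" by simp
      then show ?thesis by blast
    next
      case False
      then obtain u l v where "w = u @ [l, inv_letter l] @ v" using Cons.IH by blast
      then have "a # w = (a # u) @ [l, inv_letter l] @ v" by simp
      then show ?thesis by blast
    qed
  qed simp
  then show thesis using that by blast
qed

text \<open>The condition on the first and last letter keeps the junctions between the copies free
  of cancellation.\<close>

lemma reduced_concat_replicate: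
  assumes "reduced w" "w \<noteq> []" "last w \<noteq> inv_letter (hd w)"
  shows "reduced (concat (replicate n w))"
proof (induction n)
  case (Suc n)
  have "hd w \<noteq> inv_letter (last w)" using assms(3) by auto
  moreover have "concat (replicate n w) \<noteq> [] \<Longrightarrow> hd (concat (replicate n w)) = hd w"
    using assms(2) by (cases n) auto
  ultimately show ?case using Suc assms(1,2) by (auto simp: successively_append_iff)
qed simp

text \<open>A shortest word in the conjugacy class of a torsion element is cyclically reduced; if it were
  nonempty, all its powers would be reduced and nonempty.\<close>

lemma free_group_torsion_free:
  fixes S :: "'g set" and n :: nat
  assumes x: "x \<in> carrier (presented_group S {})" and n: "n > 0"
    and pow: "x [^]\<^bsub>presented_group S {}\<^esub> n = \<one>\<^bsub>presented_group S {}\<^esub>"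
  shows "x = \<one>\<^bsub>presented_group S {}\<^esub>"
proof -
  let ?F = "presented_group S {}" and ?c = "word_class S {}"
  interpret F: group ?F by (rule group_presented_group)
  define P where "P w \<longleftrightarrow> w \<in> words S \<and> (\<exists>g \<in> carrier ?F. ?c w = g \<otimes>\<^bsub>?F\<^esub> x \<otimes>\<^bsub>?F\<^esub> inv\<^bsub>?F\<^esub> g)" for w
  obtain u where u: "u \<in> words S" "x = ?c u" using x by (auto simp: carrier_presented_group)
  have "P u" unfolding P_def using u x by (intro conjI bexI[of _ "\<one>\<^bsub>?F\<^esub>"]) auto
  then obtain w where w: "P w" and min: "\<And>v. P v \<Longrightarrow> length w \<le> length v"
    using ex_has_least_nat[of P u length] by blast
  from w obtain g where wS: "w \<in> words S" and g: "g \<in> carrier ?F"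
    and cw: "?c w = g \<otimes>\<^bsub>?F\<^esub> x \<otimes>\<^bsub>?F\<^esub> inv\<^bsub>?F\<^esub> g"
    unfolding P_def by blast
  have red: "reduced w"
  proof (rule ccontr)
    assume "\<not> reduced w"
    then obtain a l v where w_eq: "w = a @ [l, inv_letter l] @ v" by (rule not_reducedE)
    obtain s b where l: "l = (s, b)" by force
    have aS: "a \<in> words S" "v \<in> words S" "s \<in> S" using wS by (auto simp: w_eq words_def l)
    have "([l, inv_letter l], []) \<in> word_rel S {}"
      using word_rel.cancel[OF aS(3)] by (simp add: l)
    from word_rel.append[OF word_rel.refl[OF aS(1)] word_rel.append[OF this word_rel.refl[OF aS(2)]]]
    have "(w, a @ v) \<in> word_rel S {}" by (simp add: w_eq)
    then have "?c w = ?c (a @ v)" using equiv_class_eq[OF equiv_word_rel] by blast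
    then have "P (a @ v)" using cw g aS by (auto simp: P_def words_append)
    from min[OF this] show False by (simp add: w_eq)
  qed
  have "w = []"
  proof (rule ccontr)
    assume ne: "w \<noteq> []"
    \<comment> \<open>Otherwise conjugation by the first letter removes both ends of w, contrary to
      minimality.\<close>
    have cyc: "last w \<noteq> inv_letter (hd w)"
    proof
      assume last: "last w = inv_letter (hd w)"
      obtain l v where lv: "w = l # v" using ne by (cases w) auto
      have "v \<noteq> []" using last lv inv_letter_simps(2)[of l] by (metis last.simps list.sel(1))
      then have w_eq: "w = [l] @ butlast v @ [inv_letter l]" 
      proof -
        have "last v = inv_letter l" using last lv \<open>v \<noteq> []\<close> by simp
        then have "v = butlast v @ [inv_letter l]" using append_butlast_last_id[OF \<open>v \<noteq> []\<close>] by simp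
        then show ?thesis using lv by simp
      qed
      obtain s b where l: "l = (s, b)" by force
      have vS: "butlast v \<in> words S" "[l] \<in> words S" "[inv_letter l] \<in> words S" "s \<in> S"
        using wS by (auto simp: lv words_def l dest: in_set_butlastD)
      define y where "y = ?c [l]"
      have y: "y \<in> carrier ?F" unfolding y_def using vS by (intro word_class_in_carrier)
      have iy: "?c [inv_letter l] = inv\<^bsub>?F\<^esub> y"
        unfolding y_def l inv_letter_simps by (rule word_class_inverse_letter[OF vS(4)])
      have bv: "?c (butlast v) \<in> carrier ?F" using vS by (intro word_class_in_carrier)
      have "?c w = ?c [l] \<otimes>\<^bsub>?F\<^esub> ?c (butlast v @ [inv_letter l])"
        using mult_word_class[OF vS(2) words_append[OF vS(1,3)], of "{}"] by (simp only: w_eq[symmetric])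
      also have "?c (butlast v @ [inv_letter l]) = ?c (butlast v) \<otimes>\<^bsub>?F\<^esub> inv\<^bsub>?F\<^esub> y"
        using mult_word_class[OF vS(1,3), of "{}"] by (simp only: iy)
      finally have "?c w = y \<otimes>\<^bsub>?F\<^esub> (?c (butlast v) \<otimes>\<^bsub>?F\<^esub> inv\<^bsub>?F\<^esub> y)"
        by (simp only: y_def)
      then have "?c (butlast v) = inv\<^bsub>?F\<^esub> y \<otimes>\<^bsub>?F\<^esub> ?c w \<otimes>\<^bsub>?F\<^esub> y"
        using y bv by (simp add: F.m_assoc) (simp flip: F.m_assoc)
      also have "\<dots> = (inv\<^bsub>?F\<^esub> y \<otimes>\<^bsub>?F\<^esub> g) \<otimes>\<^bsub>?F\<^esub> x \<otimes>\<^bsub>?F\<^esub> inv\<^bsub>?F\<^esub> (inv\<^bsub>?F\<^esub> y \<otimes>\<^bsub>?F\<^esub> g)"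
        unfolding cw using y g x by (simp add: F.inv_mult_group F.m_assoc)
      finally have "P (butlast v)" unfolding P_def using vS(1) y g by auto
      from min[OF this] show False using lv by simp
    qed
    define W where "W = concat (replicate n w)"
    have W: "W \<in> words S" "?c W = ?c w [^]\<^bsub>?F\<^esub> n"
    proof -
      have "concat (replicate k w) \<in> words S \<and> ?c (concat (replicate k w)) = ?c w [^]\<^bsub>?F\<^esub> k" for k
      proof (induction k)
        case 0
        then show ?case by (simp add: one_presented_group Nil_in_words)
      next
        case (Suc k)
        have "?c w \<in> carrier ?F" using wS by (rule word_class_in_carrier)
        then have "?c w [^]\<^bsub>?F\<^esub> Suc k = ?c w \<otimes>\<^bsub>?F\<^esub> ?c w [^]\<^bsub>?F\<^esub> k" by (rule F.nat_pow_Suc2)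
        then have "?c (w @ concat (replicate k w)) = ?c w [^]\<^bsub>?F\<^esub> Suc k"
          using Suc mult_word_class[OF wS, of "concat (replicate k w)" "{}"] by simp
        then show ?case using Suc wS by (simp add: words_append)
      qed
      then show "W \<in> words S" "?c W = ?c w [^]\<^bsub>?F\<^esub> n" by (auto simp: W_def)
    qed
    have "?c W = \<one>\<^bsub>?F\<^esub>" 
      using W(2) F.conjugate_nat_pow[OF g x, of n] g pow by (simp add: cw)
    then have "(W, []) \<in> word_rel S {}"
      unfolding one_presented_group using W(1) word_class_eq_iff[OF W(1) Nil_in_words] by blast
    then have "word_act reduced_act W [] = word_act reduced_act [] []"
      by (intro word_act_word_rel[OF bij_reduced_act]) auto
    moreover have "reduced W" unfolding W_def by (rule reduced_concat_replicate[OF red ne cyc])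
    ultimately have "W = []" by (simp add: word_act_reduced)
    then show False using n ne by (simp add: W_def)
  qed
  then have "g \<otimes>\<^bsub>?F\<^esub> x \<otimes>\<^bsub>?F\<^esub> inv\<^bsub>?F\<^esub> g = \<one>\<^bsub>?F\<^esub>" using cw by (simp add: one_presented_group)
  then show ?thesis by (rule F.conjugate_eq_one[OF g x])
qed

lemma free_group_torsion:
  fixes G :: "('a, 'b) monoid_scheme" and n :: nat
  assumes "free_group G" "x \<in> carrier G" "n > 0" "x [^]\<^bsub>G\<^esub> n = \<one>\<^bsub>G\<^esub>"
  shows "x = \<one>\<^bsub>G\<^esub>"
proof -
  obtain S :: "'a set" where G: "group G" and "G \<cong> presented_group S {}" using assms(1) unfolding free_group_def by blast
  then obtain h where h: "h \<in> iso G (presented_group S {})" unfolding is_iso_def by blast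
  interpret group_hom G "presented_group S {}" h
    using h G group_presented_group by (auto simp: group_hom_def group_hom_axioms_def iso_def)
  have "h x [^]\<^bsub>presented_group S {}\<^esub> n = \<one>\<^bsub>presented_group S {}\<^esub>"
    using assms(2,4) hom_nat_pow[of x n] by simp
  then have "h x = h \<one>\<^bsub>G\<^esub>"
    using free_group_torsion_free[OF hom_closed[OF assms(2)] assms(3)] by simp
  moreover have "inj_on h (carrier G)" using h by (simp add: iso_def bij_betw_def)
  ultimately show ?thesis by (rule inj_onD[rotated, OF _ assms(2) G.one_closed])
qed

section \<open>Coset actions and stabilizers\<close>

text \<open>Evaluated on a chosen representative; under \<open>relations_hold R \<sigma>\<close> all
  representatives act alike.\<close>

definition class_act :: "('g \<Rightarrow> 'z \<Rightarrow> 'z) \<Rightarrow> 'g group_word set \<Rightarrow> 'z \<Rightarrow> 'z" where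
  "class_act \<sigma> A = word_act \<sigma> (SOME w. w \<in> A)"

definition relations_hold :: "('g group_word \<times> 'g group_word) set \<Rightarrow> ('g \<Rightarrow> 'z \<Rightarrow> 'z) \<Rightarrow> bool" where
  "relations_hold R \<sigma> \<longleftrightarrow> (\<forall>s. bij (\<sigma> s)) \<and> (\<forall>(u, v) \<in> R. word_act \<sigma> u = word_act \<sigma> v)"

lemma class_act_word_class:
  assumes "relations_hold R \<sigma>"
  shows "class_act \<sigma> (word_class UNIV R w) = word_act \<sigma> w"
proof -
  have "(SOME v. v \<in> word_class UNIV R w) \<in> word_class UNIV R w"
    using word_class_self[of w UNIV R] by (rule someI) (simp add: words_def)
  then have rel: "(w, SOME v. v \<in> word_class UNIV R w) \<in> word_rel UNIV R" by (rule in_word_class)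
  have "word_act \<sigma> w z = word_act \<sigma> (SOME v. v \<in> word_class UNIV R w) z" for z
    by (rule word_act_word_rel[OF _ _ rel]) (use assms in \<open>auto simp: relations_hold_def\<close>)
  then show ?thesis unfolding class_act_def by (intro HOL.ext) (simp only:)
qed

lemma words_UNIV: "w \<in> words UNIV"
  by (simp add: words_def)

lemma class_act_mult:
  assumes "relations_hold R \<sigma>" "A \<in> carrier (presented_group UNIV R)" "B \<in> carrier (presented_group UNIV R)"
  shows "class_act \<sigma> (A \<otimes>\<^bsub>presented_group UNIV R\<^esub> B) z = class_act \<sigma> B (class_act \<sigma> A z)"
proof -
  obtain u v where "A = word_class UNIV R u" "B = word_class UNIV R v"
    using assms(2,3) unfolding carrier_presented_group by blast
  then show ?thesis
    by (simp only: mult_word_class words_UNIV class_act_word_class[OF assms(1)] word_act_append)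
qed

lemma class_act_one:
  assumes "relations_hold R \<sigma>"
  shows "class_act \<sigma> \<one>\<^bsub>presented_group UNIV R\<^esub> z = z"
  unfolding one_presented_group class_act_word_class[OF assms] by simp

definition stabilizer_group :: "('g group_word \<times> 'g group_word) set \<Rightarrow> ('g \<Rightarrow> 'z \<Rightarrow> 'z) \<Rightarrow> 'z \<Rightarrow> 'g group_word set set" where
  "stabilizer_group R \<sigma> z = {A \<in> carrier (presented_group UNIV R). class_act \<sigma> A z = z}"

lemma class_act_inv:
  assumes "relations_hold R \<sigma>" "A \<in> carrier (presented_group UNIV R)"
  shows "class_act \<sigma> (inv\<^bsub>presented_group UNIV R\<^esub> A) (class_act \<sigma> A z) = z"
proof -
  interpret group "presented_group UNIV R" by (rule group_presented_group)
  show ?thesis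
    using class_act_mult[OF assms(1) assms(2) inv_closed[OF assms(2)], of z] class_act_one[OF assms(1)] assms(2)
    by simp
qed

lemma subgroup_stabilizer_group:
  assumes "relations_hold R \<sigma>"
  shows "subgroup (stabilizer_group R \<sigma> z) (presented_group UNIV R)"
proof -
  interpret group "presented_group UNIV R" by (rule group_presented_group)
  show ?thesis
  proof (rule subgroupI)
    show "stabilizer_group R \<sigma> z \<noteq> {}"
      using class_act_one[OF assms] by (auto simp: stabilizer_group_def)
    fix A assume A: "A \<in> stabilizer_group R \<sigma> z"
    then have "class_act \<sigma> (inv\<^bsub>presented_group UNIV R\<^esub> A) (class_act \<sigma> A z) = z"
      by (intro class_act_inv[OF assms]) (simp add: stabilizer_group_def)
    then show "inv\<^bsub>presented_group UNIV R\<^esub> A \<in> stabilizer_group R \<sigma> z"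
      using A by (simp add: stabilizer_group_def)
    fix B assume "B \<in> stabilizer_group R \<sigma> z"
    then show "A \<otimes>\<^bsub>presented_group UNIV R\<^esub> B \<in> stabilizer_group R \<sigma> z"
      using A by (simp add: stabilizer_group_def class_act_mult[OF assms])
  qed (auto simp: stabilizer_group_def)
qed

section \<open>The action on right cosets\<close>

abbreviation coset_space :: "('g group_word \<times> 'g group_word) set \<Rightarrow> 'g group_word set set \<Rightarrow> 'g group_word set set set" where
  "coset_space R H \<equiv> rcosets\<^bsub>presented_group UNIV R\<^esub> H"

definition coset_act :: "('g group_word \<times> 'g group_word) set \<Rightarrow> 'g group_word set set \<Rightarrow> 'g \<Rightarrow>
    'g group_word set set \<Rightarrow> 'g group_word set set" where
  "coset_act R H s v = (if v \<in> rcosets\<^bsub>presented_group UNIV R\<^esub> H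
     then v #>\<^bsub>presented_group UNIV R\<^esub> word_class UNIV R [(s, True)] else v)"

context
  fixes R :: "('g group_word \<times> 'g group_word) set" and H
  assumes H: "subgroup H (presented_group UNIV R)"
begin

interpretation group "presented_group UNIV R" by (rule group_presented_group)

lemma rcos_carrier: "v \<in> coset_space R H \<Longrightarrow> v \<subseteq> carrier (presented_group UNIV R)"
  by (rule subgroup.rcosets_carrier[OF H is_group])

lemma word_class_carrier [simp]: "word_class UNIV R w \<in> carrier (presented_group UNIV R)"
  by (rule word_class_in_carrier[OF words_UNIV])

lemma rcos_mult:
  assumes "v \<in> coset_space R H" "g \<in> carrier (presented_group UNIV R)"
  shows "v #>\<^bsub>presented_group UNIV R\<^esub> g \<in> coset_space R H"
proof -
  obtain a where a: "a \<in> carrier (presented_group UNIV R)" "v = H #>\<^bsub>presented_group UNIV R\<^esub> a" using assms(1) by (auto simp: RCOSETS_def)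
  then have "v #>\<^bsub>presented_group UNIV R\<^esub> g = H #>\<^bsub>presented_group UNIV R\<^esub> (a \<otimes>\<^bsub>presented_group UNIV R\<^esub> g)"
    using coset_mult_assoc[OF subgroup.subset[OF H] a(1) assms(2)] by simp
  then show ?thesis using a assms(2) by (auto simp: RCOSETS_def)
qed

lemma rcos_mult_assoc: "v \<in> coset_space R H \<Longrightarrow> g \<in> carrier (presented_group UNIV R) \<Longrightarrow> h \<in> carrier (presented_group UNIV R) \<Longrightarrow>
    (v #>\<^bsub>presented_group UNIV R\<^esub> g) #>\<^bsub>presented_group UNIV R\<^esub> h = v #>\<^bsub>presented_group UNIV R\<^esub> (g \<otimes>\<^bsub>presented_group UNIV R\<^esub> h)"
  using coset_mult_assoc[OF rcos_carrier] by blast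

lemma rcos_mult_one: "v \<in> coset_space R H \<Longrightarrow> v #>\<^bsub>presented_group UNIV R\<^esub> \<one>\<^bsub>presented_group UNIV R\<^esub> = v"
  using coset_mult_one[OF rcos_carrier] by blast

lemma H_in_rcosets: "H \<in> coset_space R H"
  using subgroup.subgroup_in_rcosets[OF H is_group] .

lemma coset_act_permutes: "coset_act R H s permutes (coset_space R H)"
proof (rule bij_imp_permutes)
  let ?g = "word_class UNIV R [(s, True)]"
  show "bij_betw (coset_act R H s) (coset_space R H) (coset_space R H)"
    by (rule bij_betwI[where g = "\<lambda>v. v #>\<^bsub>presented_group UNIV R\<^esub> inv\<^bsub>presented_group UNIV R\<^esub> ?g"])
       (auto simp: coset_act_def rcos_mult rcos_mult_assoc rcos_mult_one)
qed (simp add: coset_act_def)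

lemma letter_act_coset_act:
  assumes "v \<in> coset_space R H"
  shows "letter_act (coset_act R H) l v = v #>\<^bsub>presented_group UNIV R\<^esub> word_class UNIV R [l]"
proof -
  obtain s b where l: "l = (s, b)" by force
  let ?g = "word_class UNIV R [(s, True)]"
  show ?thesis
  proof (cases b)
    case False
    have "coset_act R H s (v #>\<^bsub>presented_group UNIV R\<^esub> inv\<^bsub>presented_group UNIV R\<^esub> ?g) = v"
      using assms by (simp add: coset_act_def rcos_mult rcos_mult_assoc rcos_mult_one)
    then have "inv_into UNIV (coset_act R H s) v = v #>\<^bsub>presented_group UNIV R\<^esub> inv\<^bsub>presented_group UNIV R\<^esub> ?g"
      using permutes_inj[OF coset_act_permutes] by (metis inv_f_f)
    then show ?thesis
      using word_class_inverse_letter[of s UNIV R True] False by (simp add: letter_act_def l)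
  qed (use assms in \<open>simp add: letter_act_def l coset_act_def\<close>)
qed

lemma word_act_coset_act:
  assumes "v \<in> coset_space R H"
  shows "word_act (coset_act R H) w v = v #>\<^bsub>presented_group UNIV R\<^esub> word_class UNIV R w"
  using assms
proof (induction w arbitrary: v)
  case Nil
  then show ?case using rcos_mult_one by (simp add: one_presented_group)
next
  case (Cons l w)
  have "word_class UNIV R [l] \<otimes>\<^bsub>presented_group UNIV R\<^esub> word_class UNIV R w = word_class UNIV R (l # w)"
    by (simp add: mult_word_class words_UNIV)
  then show ?case
    using Cons by (simp add: letter_act_coset_act rcos_mult rcos_mult_assoc)
qed

lemma word_act_outside:
  assumes "v \<notin> coset_space R H"
  shows "word_act (coset_act R H) w v = v"
proof -
  have "letter_act (coset_act R H) l v = v" for l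
    using assms permutes_not_in[OF coset_act_permutes] permutes_not_in[OF permutes_inv[OF coset_act_permutes]]
    by (simp add: letter_act_def)
  then show ?thesis by (induction w) simp_all
qed

lemma relations_hold_coset_act: "relations_hold R (coset_act R H)"
  unfolding relations_hold_def
proof (intro conjI allI ballI, goal_cases)
  case 1
  show ?case by (rule permutes_bij[OF coset_act_permutes])
next
  case (2 r)
  obtain u v where r: "r = (u, v)" by force
  then have "word_class UNIV R u = word_class UNIV R v"
    using 2 by (simp add: word_class_eq_iff word_rel.relation words_UNIV)
  then have "word_act (coset_act R H) u z = word_act (coset_act R H) v z" for z
    using word_act_coset_act[of z] word_act_outside[of z] by (cases "z \<in> coset_space R H") simp_all
  then show ?case by (auto simp: r)
qed

lemma rcosetE:
  assumes "v \<in> coset_space R H"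
  obtains w where "v = H #>\<^bsub>presented_group UNIV R\<^esub> word_class UNIV R w"
  using assms by (auto simp: RCOSETS_def carrier_presented_group)

lemma coset_eq_iff:
  assumes "g \<in> carrier (presented_group UNIV R)"
  shows "H #>\<^bsub>presented_group UNIV R\<^esub> g = H \<longleftrightarrow> g \<in> H"
  using coset_join1[OF _ assms H] coset_join2[OF assms H] subgroup.subset[OF H] by blast

text \<open>H g = H holds exactly for g in H, so a subgroup can be recovered from its coset
  action.\<close>

lemma stabilizer_coset_act: "stabilizer_group R (coset_act R H) H = H"
proof -
  have "class_act (coset_act R H) A H = H \<longleftrightarrow> A \<in> H" if "A \<in> carrier (presented_group UNIV R)" for A
  proof -
    obtain w where "A = word_class UNIV R w" using \<open>A \<in> carrier (presented_group UNIV R)\<close> by (auto simp: carrier_presented_group)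
    then show ?thesis
      by (simp add: class_act_word_class[OF relations_hold_coset_act] word_act_coset_act[OF H_in_rcosets]
          coset_eq_iff)
  qed
  then show ?thesis using subgroup.subset[OF H] by (auto simp: stabilizer_group_def)
qed

text \<open>An injective self-map of a finite set is onto; hence closure under generators implies
  closure under inverse letters.\<close>

lemma permutes_finite_closed:
  assumes "finite Z" "f permutes Y" "Z \<subseteq> Y" "\<And>z. z \<in> Z \<Longrightarrow> f z \<in> Z" "z \<in> Z"
  shows "inv_into UNIV f z \<in> Z"
proof -
  have "f ` Z = Z"
    using assms(1,4) permutes_inj_on[OF assms(2)] by (intro endo_inj_surj) auto
  then obtain y where "y \<in> Z" "z = f y" using assms(5) by blast
  then show ?thesis using permutes_inj[OF assms(2)] by simp
qed

lemma transitive_coset_act: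
  assumes "finite (coset_space R H)"
  shows "transitive_action (coset_space R H) H (coset_act R H)"
  unfolding transitive_action_def
proof (intro conjI allI ballI impI subsetI)
  show "H \<in> coset_space R H" by (rule H_in_rcosets)
  show "coset_act R H s v \<in> coset_space R H" if "v \<in> coset_space R H" for s v
    using permutes_in_image[OF coset_act_permutes] that by blast
  fix Z v assume Z: "H \<in> Z" "\<forall>s. \<forall>v\<in>(coset_space R H) \<inter> Z. coset_act R H s v \<in> Z" and v: "v \<in> coset_space R H"
  have closed: "letter_act (coset_act R H) l z \<in> (coset_space R H) \<inter> Z" if "z \<in> (coset_space R H) \<inter> Z" for l z
  proof -
    have 1: "coset_act R H s z \<in> (coset_space R H) \<inter> Z" if "z \<in> (coset_space R H) \<inter> Z" for s z
      using Z(2) that permutes_in_image[OF coset_act_permutes] by blast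
    have "inv_into UNIV (coset_act R H s) z \<in> (coset_space R H) \<inter> Z" for s
      by (rule permutes_finite_closed[OF _ coset_act_permutes _ 1 that]) (use assms in auto)
    then show ?thesis using 1[OF that] by (simp add: letter_act_def)
  qed
  have "word_act (coset_act R H) w z \<in> (coset_space R H) \<inter> Z" if "z \<in> (coset_space R H) \<inter> Z" for w z
    using that
  proof (induction w arbitrary: z)
    case (Cons l w)
    then show ?case using Cons.IH[OF closed[OF Cons.prems, of l]] by simp
  qed simp
  moreover obtain w where "v = word_act (coset_act R H) w H"
    using v rcosetE word_act_coset_act[OF H_in_rcosets] by metis
  ultimately show "v \<in> Z" using Z(1) H_in_rcosets by blast
qed

end

lemma equivariant_word_act:
  assumes "\<And>s. \<rho> s permutes X" "\<And>s. \<sigma> s permutes Y" "h ` X \<subseteq> Y" "equivariant_on X \<rho> \<sigma> h" "x \<in> X"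
  shows "word_act \<rho> w x \<in> X \<and> h (word_act \<rho> w x) = word_act \<sigma> w (h x)"
proof -
  have l: "letter_act \<rho> l x \<in> X \<and> h (letter_act \<rho> l x) = letter_act \<sigma> l (h x)" if x: "x \<in> X" for l x
  proof -
    obtain s b where l: "l = (s, b)" by force
    show ?thesis
    proof (cases b)
      case True
      then show ?thesis
        using x assms(4) permutes_in_image[OF assms(1)] by (simp add: letter_act_def l equivariant_on_def)
    next
      case False
      define y where "y = inv_into UNIV (\<rho> s) x"
      have y: "y \<in> X" "\<rho> s y = x"
        using x permutes_in_image[OF permutes_inv[OF assms(1)]] permutes_inverses(1)[OF assms(1)]
        by (auto simp: y_def)
      have "\<sigma> s (h y) = h x" using assms(4) y by (auto simp: equivariant_on_def)
      then have "inv_into UNIV (\<sigma> s) (h x) = h y"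
        using permutes_inj[OF assms(2)] by (metis inv_f_f)
      then show ?thesis using False y by (simp add: letter_act_def l y_def)
    qed
  qed
  show ?thesis
    using assms(5) by (induction w arbitrary: x) (use l in auto)
qed

text \<open>The coset H g has to go to the image of y0 under g, and this is well defined and
  injective exactly when H is the stabilizer of y0. So each action extends the coset action of only
  one subgroup.\<close>

lemma extends_action_stabilizer:
  fixes R :: "('g group_word \<times> 'g group_word) set"
  assumes "relations_hold R \<sigma>" "\<And>s. \<sigma> s permutes Y" "y0 \<in> Y"
    and H: "subgroup H (presented_group UNIV R)"
  shows "extends_action (rcosets\<^bsub>presented_group UNIV R\<^esub> H) H (coset_act R H) Y y0 \<sigma> \<longleftrightarrow>
    H = stabilizer_group R \<sigma> y0"
proof
  let ?G = "presented_group UNIV R"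
  let ?X = "rcosets\<^bsub>?G\<^esub> H"
  assume "extends_action ?X H (coset_act R H) Y y0 \<sigma>"
  then obtain h where h: "inj_on h ?X" "h ` ?X \<subseteq> Y" "h H = y0" "equivariant_on ?X (coset_act R H) \<sigma> h"
    unfolding extends_action_def by blast
  have "class_act \<sigma> A y0 = y0 \<longleftrightarrow> class_act (coset_act R H) A H = H" if "A \<in> carrier ?G" for A
  proof -
    obtain w where A: "A = word_class UNIV R w" using \<open>A \<in> carrier ?G\<close> by (auto simp: carrier_presented_group)
    have w: "word_act (coset_act R H) w H \<in> ?X" "h (word_act (coset_act R H) w H) = word_act \<sigma> w y0"
      using equivariant_word_act[OF coset_act_permutes[OF H] assms(2) h(2,4) H_in_rcosets[OF H], of w] h(3) by auto
    show ?thesis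
      unfolding A class_act_word_class[OF assms(1)] class_act_word_class[OF relations_hold_coset_act[OF H]]
        w(2)[symmetric]
      using inj_onD[OF h(1) _ w(1) H_in_rcosets[OF H]] h(3) by auto
  qed
  then have "stabilizer_group R \<sigma> y0 = stabilizer_group R (coset_act R H) H"
    by (auto simp: stabilizer_group_def)
  then show "H = stabilizer_group R \<sigma> y0" by (simp add: stabilizer_coset_act[OF H])
next
  let ?G = "presented_group UNIV R"
  let ?X = "rcosets\<^bsub>?G\<^esub> H"
  interpret G: group ?G by (rule group_presented_group)
  assume H_eq: "H = stabilizer_group R \<sigma> y0"
  \<comment> \<open>One direction makes the map on cosets well defined, the other makes it
    injective.\<close>
  have same: "H #>\<^bsub>?G\<^esub> A = H #>\<^bsub>?G\<^esub> B \<longleftrightarrow> class_act \<sigma> A y0 = class_act \<sigma> B y0"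
    if AB: "A \<in> carrier ?G" "B \<in> carrier ?G" for A B
  proof -
    have iB: "inv\<^bsub>?G\<^esub> B \<in> carrier ?G" using AB by simp
    have sub: "H \<subseteq> carrier ?G" by (rule subgroup.subset[OF H])
    have "H #>\<^bsub>?G\<^esub> A = H #>\<^bsub>?G\<^esub> B \<longleftrightarrow> H #>\<^bsub>?G\<^esub> (A \<otimes>\<^bsub>?G\<^esub> inv\<^bsub>?G\<^esub> B) = H"
    proof
      assume "H #>\<^bsub>?G\<^esub> A = H #>\<^bsub>?G\<^esub> B"
      then have "(H #>\<^bsub>?G\<^esub> A) #>\<^bsub>?G\<^esub> inv\<^bsub>?G\<^esub> B = (H #>\<^bsub>?G\<^esub> B) #>\<^bsub>?G\<^esub> inv\<^bsub>?G\<^esub> B" by simp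
      then show "H #>\<^bsub>?G\<^esub> (A \<otimes>\<^bsub>?G\<^esub> inv\<^bsub>?G\<^esub> B) = H"
        using AB iB sub by (simp add: G.coset_mult_assoc G.coset_mult_one)
    next
      assume "H #>\<^bsub>?G\<^esub> (A \<otimes>\<^bsub>?G\<^esub> inv\<^bsub>?G\<^esub> B) = H"
      then have "(H #>\<^bsub>?G\<^esub> (A \<otimes>\<^bsub>?G\<^esub> inv\<^bsub>?G\<^esub> B)) #>\<^bsub>?G\<^esub> B = H #>\<^bsub>?G\<^esub> B" by simp
      then show "H #>\<^bsub>?G\<^esub> A = H #>\<^bsub>?G\<^esub> B"
        using AB iB sub by (simp add: G.coset_mult_assoc G.m_assoc)
    qed
    also have "\<dots> \<longleftrightarrow> A \<otimes>\<^bsub>?G\<^esub> inv\<^bsub>?G\<^esub> B \<in> H"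
      using coset_eq_iff[OF H] AB by simp
    also have "\<dots> \<longleftrightarrow> class_act \<sigma> (inv\<^bsub>?G\<^esub> B) (class_act \<sigma> A y0) = y0"
      unfolding H_eq stabilizer_group_def using AB class_act_mult[OF assms(1) AB(1) iB] by simp
    also have "\<dots> \<longleftrightarrow> class_act \<sigma> A y0 = class_act \<sigma> B y0"
    proof
      assume *: "class_act \<sigma> (inv\<^bsub>?G\<^esub> B) (class_act \<sigma> A y0) = y0"
      show "class_act \<sigma> A y0 = class_act \<sigma> B y0"
        using class_act_inv[OF assms(1) iB, of "class_act \<sigma> A y0"] AB * by simp
    next
      assume "class_act \<sigma> A y0 = class_act \<sigma> B y0"
      then show "class_act \<sigma> (inv\<^bsub>?G\<^esub> B) (class_act \<sigma> A y0) = y0"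
        using class_act_inv[OF assms(1) AB(2), of y0] by simp
    qed
    finally show ?thesis .
  qed
  define h where "h v = class_act \<sigma> (SOME A. A \<in> carrier ?G \<and> v = H #>\<^bsub>?G\<^esub> A) y0" for v
  have h: "h (H #>\<^bsub>?G\<^esub> A) = class_act \<sigma> A y0" if "A \<in> carrier ?G" for A
  proof -
    define B where "B = (SOME B. B \<in> carrier ?G \<and> H #>\<^bsub>?G\<^esub> A = H #>\<^bsub>?G\<^esub> B)"
    have B: "B \<in> carrier ?G \<and> H #>\<^bsub>?G\<^esub> A = H #>\<^bsub>?G\<^esub> B"
      unfolding B_def by (rule someI[of _ A]) (use that in simp)
    then have "class_act \<sigma> A y0 = class_act \<sigma> B y0" using same[OF that] by blast
    then show ?thesis unfolding h_def B_def by simp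
  qed
  have X: "\<exists>A \<in> carrier ?G. v = H #>\<^bsub>?G\<^esub> A" if "v \<in> ?X" for v
    using that by (auto simp: RCOSETS_def)
  have in_Y: "word_act \<sigma> w y \<in> Y" if "y \<in> Y" for w y
    using equivariant_word_act[of \<sigma> Y \<sigma> Y id y w] assms(2) that by (simp add: equivariant_on_def)
  show "extends_action ?X H (coset_act R H) Y y0 \<sigma>"
    unfolding extends_action_def
  proof (intro exI[of _ h] conjI)
    show "inj_on h ?X"
    proof (rule inj_onI)
      fix v w assume v: "v \<in> ?X" and w: "w \<in> ?X" and eq: "h v = h w"
      obtain A where A: "A \<in> carrier ?G" "v = H #>\<^bsub>?G\<^esub> A" using X[OF v] by blast
      obtain B where B: "B \<in> carrier ?G" "w = H #>\<^bsub>?G\<^esub> B" using X[OF w] by blast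
      show "v = w" using eq same[OF A(1) B(1)] unfolding A(2) B(2) h[OF A(1)] h[OF B(1)] by blast
    qed
    show "h ` ?X \<subseteq> Y"
    proof
      fix z assume "z \<in> h ` ?X"
      then obtain v where v: "v \<in> ?X" "z = h v" by blast
      obtain A' where "A' \<in> carrier ?G" "v = H #>\<^bsub>?G\<^esub> A'" using X[OF v(1)] by blast
      then obtain A where A: "A \<in> carrier ?G" "z = class_act \<sigma> A y0" using v(2) h by simp
      then obtain w where "A = word_class UNIV R w" unfolding carrier_presented_group by blast
      then show "z \<in> Y" using A in_Y[OF assms(3)] by (simp only: class_act_word_class[OF assms(1)])
    qed
    show "h H = y0"
      using h[of "\<one>\<^bsub>?G\<^esub>"] class_act_one[OF assms(1)] subgroup.subset[OF H] by (simp add: G.coset_mult_one)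
    show "equivariant_on ?X (coset_act R H) \<sigma> h"
      unfolding equivariant_on_def
    proof (intro allI ballI)
      fix s v assume v: "v \<in> ?X"
      let ?g = "word_class UNIV R [(s, True)]"
      obtain A where A: "A \<in> carrier ?G" "v = H #>\<^bsub>?G\<^esub> A" using X[OF v] by blast
      have g: "?g \<in> carrier ?G" by (rule word_class_carrier[OF H])
      have "coset_act R H s v = H #>\<^bsub>?G\<^esub> (A \<otimes>\<^bsub>?G\<^esub> ?g)"
        using v G.coset_mult_assoc[OF subgroup.subset[OF H] A(1) g] by (simp add: coset_act_def A(2))
      then show "h (coset_act R H s v) = \<sigma> s (h v)"
        using A g h class_act_mult[OF assms(1) A(1) g] class_act_word_class[OF assms(1), of "[(s, True)]"]
        by (simp add: letter_act_def)
    qed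
  qed
qed

section \<open>Subgroups acting freely are free\<close>

type_synonym gamma_elt = "gamma_gen group_word set"

definition gamma_rel :: "nat \<Rightarrow> (gamma_gen group_word \<times> gamma_gen group_word) set" where
  "gamma_rel m = {(replicate (2 * m) (gen_x, True), []), (replicate (3 * m) (gen_y, True), []),
     (replicate 2 (gen_x, True), replicate 3 (gen_y, True))}"

lemma Gamma3_eq: "Gamma3 m = presented_group UNIV (gamma_rel m)"
  by (simp add: Gamma3_def gamma_rel_def)

definition gen_order :: "nat \<Rightarrow> gamma_gen \<Rightarrow> nat" where
  "gen_order m s = (case s of gen_x \<Rightarrow> 2 * m | gen_y \<Rightarrow> 3 * m)"

text \<open>The exponents for which both generators give the same element x^2 = y^3.\<close>

definition gen_exp :: "gamma_gen \<Rightarrow> nat" where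
  "gen_exp s = (case s of gen_x \<Rightarrow> 2 | gen_y \<Rightarrow> 3)"

lemma gamma_rel_word_act:
  fixes \<sigma> :: "gamma_gen \<Rightarrow> 'z \<Rightarrow> 'z"
  shows "(\<forall>(u, v) \<in> gamma_rel m. word_act \<sigma> u = word_act \<sigma> v) \<longleftrightarrow>
    (\<forall>s. \<sigma> s ^^ gen_order m s = id) \<and> \<sigma> gen_x ^^ 2 = \<sigma> gen_y ^^ 3"
proof -
  have r: "word_act \<sigma> (replicate n (s, True)) = \<sigma> s ^^ n" for n s
    by (rule HOL.ext) (rule word_act_replicate)
  have n: "word_act \<sigma> [] = id" by (rule HOL.ext) simp
  have all: "(\<forall>s. P s) \<longleftrightarrow> P gen_x \<and> P gen_y" for P by (metis gamma_gen.exhaust)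
  show ?thesis unfolding all gamma_rel_def by (simp add: r n gen_order_def del: replicate_Suc)
qed

lemma gamma_action_relations_hold:
  assumes "gamma_action m Y \<sigma>"
  shows "relations_hold (gamma_rel m) \<sigma>" and "\<sigma> s permutes Y" and "semiregular (gen_order m s) (\<sigma> s) Y"
proof -
  show s: "semiregular (gen_order m s) (\<sigma> s) Y" for s
    using assms by (cases s) (auto simp: gamma_action_def gen_order_def)
  show p: "\<sigma> s permutes Y" for s using semiregularD(1)[OF s] .
  have "\<sigma> s ^^ gen_order m s = id" for s
  proof
    fix y
    show "(\<sigma> s ^^ gen_order m s) y = id y"
      using semiregularD(2)[OF s] permutes_not_in[OF permutes_funpow[OF p]] by (cases "y \<in> Y") auto
  qed
  then show "relations_hold (gamma_rel m) \<sigma>"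
    unfolding relations_hold_def gamma_rel_word_act
    using assms permutes_bij[OF p] by (auto simp: gamma_action_def)
qed

locale gamma_subgroup =
  fixes m :: nat and H :: "gamma_gen group_word set set"
  assumes m_pos: "m > 0" and H: "subgroup H (presented_group UNIV (gamma_rel m))"
begin

abbreviation "Gm \<equiv> presented_group UNIV (gamma_rel m)"
abbreviation "X \<equiv> rcosets\<^bsub>Gm\<^esub> H"
abbreviation "gen s \<equiv> word_class UNIV (gamma_rel m) [(s, True)]"
abbreviation "\<rho> \<equiv> coset_act (gamma_rel m) H"

abbreviation "cls \<equiv> word_class UNIV (gamma_rel m)"
abbreviation gmult (infixl "\<cdot>" 70) where "a \<cdot> b \<equiv> a \<otimes>\<^bsub>Gm\<^esub> b"
abbreviation ginv where "ginv a \<equiv> inv\<^bsub>Gm\<^esub> a"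
abbreviation gone ("\<epsilon>") where "\<epsilon> \<equiv> \<one>\<^bsub>Gm\<^esub>"
abbreviation gpow (infixr "\<up>" 75) where "a \<up> n \<equiv> a [^]\<^bsub>Gm\<^esub> (n :: nat)"
abbreviation gcoset (infixl "\<triangleleft>" 60) where "v \<triangleleft> a \<equiv> v #>\<^bsub>Gm\<^esub> a"

sublocale G: group Gm by (rule group_presented_group)

lemma gen_carrier [simp]: "gen s \<in> carrier Gm"
  by (rule word_class_carrier[OF H])

lemma gen_pow: "gen s \<up> n = cls (replicate n (s, True))"
  by (rule word_class_replicate[symmetric]) simp

lemma coset_act_funpow:
  assumes "v \<in> X"
  shows "(\<rho> s ^^ n) v = v \<triangleleft> (gen s \<up> n)"
  using word_act_coset_act[OF H assms] unfolding gen_pow word_act_replicate[symmetric] .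

lemma gen_pow_order: "gen s \<up> gen_order m s = \<epsilon>"
  and gen_pow_exp: "gen s \<up> gen_exp s = gen gen_x \<up> (2 :: nat)"
proof -
  have eq: "cls u = cls v" if "(u, v) \<in> gamma_rel m" for u v
    using that by (simp add: word_class_eq_iff words_UNIV word_rel.relation)
  show "gen s \<up> gen_order m s = \<epsilon>"
    unfolding gen_pow one_presented_group
    by (rule eq) (cases s; simp add: gamma_rel_def gen_order_def)
  show "gen s \<up> gen_exp s = gen gen_x \<up> (2 :: nat)"
  proof (cases s)
    case gen_y
    then show ?thesis
      unfolding gen_pow by (intro eq[symmetric]) (simp add: gamma_rel_def gen_exp_def)
  qed (simp add: gen_exp_def)
qed

text \<open>The relations already return every coset after the full order; only earlier returns have
  to be excluded.\<close>

lemma gamma_action_coset_act: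
  assumes "\<And>v s i. v \<in> X \<Longrightarrow> 0 < i \<Longrightarrow> i < gen_order m s \<Longrightarrow> v \<triangleleft> (gen s \<up> i) \<noteq> v"
  shows "gamma_action m X \<rho>"
proof -
  have rel: "\<rho> s ^^ gen_order m s = id" "\<rho> gen_x ^^ 2 = \<rho> gen_y ^^ 3" for s
    using relations_hold_coset_act[OF H] unfolding relations_hold_def gamma_rel_word_act by auto
  have "semiregular (gen_order m s) (\<rho> s) X" for s
    unfolding semiregular_def
    using assms coset_act_permutes[OF H] rel(1) by (auto simp: coset_act_funpow)
  from this[of gen_x] this[of gen_y] rel(2) show ?thesis
    by (simp add: gamma_action_def gen_order_def)
qed

text \<open>A trivial power would act trivially everywhere, whereas on 6 m points there is an action
  with full cycles.\<close>

lemma gen_pow_eq_one: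
  assumes "gen s \<up> i = \<epsilon>" "0 < i" "i < gen_order m s"
  shows False
proof -
  obtain \<sigma> where \<sigma>: "gamma_action m {..<6 * m} \<sigma>" using ex_gamma_action[OF m_pos] by blast
  note r = gamma_action_relations_hold[OF \<sigma>]
  have 0: "0 \<in> {..<6 * m}" using m_pos by simp
  have "class_act \<sigma> (gen s \<up> i) 0 = 0"
    unfolding assms(1) by (rule class_act_one[OF r(1)])
  then have "(\<sigma> s ^^ i) 0 = 0"
    unfolding gen_pow class_act_word_class[OF r(1)] word_act_replicate .
  then show False using semiregularD(3)[OF r(3) 0 assms(2,3)] by simp
qed

text \<open>If a proper power c of a generator fixes the coset H g, then the conjugate of c by g
  lies in H and has finite order. Freeness makes it trivial, although c is not.\<close>

lemma free_imp_gamma_action: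
  assumes free: "free_group (Gm\<lparr>carrier := H\<rparr>)"
  shows "gamma_action m X \<rho>"
proof (rule gamma_action_coset_act, rule notI)
  fix v s and i :: nat
  assume v: "v \<in> X" and i: "0 < i" "i < gen_order m s" and eq: "v \<triangleleft> (gen s \<up> i) = v"
  define c where "c = gen s \<up> i"
  have c: "c \<in> carrier Gm" by (simp add: c_def)
  obtain g where g: "g \<in> carrier Gm" "v = H \<triangleleft> g" using v by (auto simp: RCOSETS_def)
  have sub: "H \<subseteq> carrier Gm" by (rule subgroup.subset[OF H])
  have "(H \<triangleleft> g) \<triangleleft> c \<triangleleft> ginv g = (H \<triangleleft> g) \<triangleleft> ginv g"
    using eq by (simp add: g c_def)
  then have "H \<triangleleft> (g \<cdot> c \<cdot> ginv g) = H"
    using g(1) c sub by (simp add: G.coset_mult_assoc G.coset_mult_one)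
  then have in_H: "g \<cdot> c \<cdot> ginv g \<in> H"
    using coset_eq_iff[OF H, of "g \<cdot> c \<cdot> ginv g"] g(1) c by simp
  have "c \<up> gen_order m s = (gen s \<up> gen_order m s) \<up> i"
    unfolding c_def G.nat_pow_pow[OF gen_carrier] by (simp only: mult.commute)
  then have "c \<up> gen_order m s = \<epsilon>"
    unfolding gen_pow_order by (simp only: G.nat_pow_one)
  then have "(g \<cdot> c \<cdot> ginv g) \<up> gen_order m s = \<epsilon>"
    using g(1) c by (simp add: G.conjugate_nat_pow)
  then have "g \<cdot> c \<cdot> ginv g = \<epsilon>"
    using free_group_torsion[OF free, of _ "gen_order m s"] in_H i
    by (simp add: G.nat_pow_consistent[symmetric])
  then have "c = \<epsilon>" by (rule G.conjugate_eq_one[OF g(1) c])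
  then show False using gen_pow_eq_one i unfolding c_def by blast
qed

end

section \<open>A maximal tree in the quotient graph and coset representatives along it\<close>

locale free_gamma_subgroup = gamma_subgroup +
  assumes fin: "finite X" and act: "gamma_action m X \<rho>"
begin

text \<open>All cycles are full, so the coset reached by a power of s determines that power.\<close>

lemma coset_gen_pow_inj:
  assumes "v \<in> X" "v \<triangleleft> (gen s \<up> i) = v \<triangleleft> (gen s \<up> j)"
  shows "gen s \<up> (i :: nat) = gen s \<up> (j :: nat)"
proof -
  let ?N = "gen_order m s"
  have N: "?N > 0" using m_pos by (cases s) (simp_all add: gen_order_def)
  note sr = gamma_action_relations_hold(3)[OF act]
  have "(\<rho> s ^^ (i mod ?N)) v = (\<rho> s ^^ (j mod ?N)) v"
    unfolding funpow_mod_semiregular[OF sr assms(1)]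
    unfolding coset_act_funpow[OF assms(1)] by (rule assms(2))
  then have ij: "i mod ?N = j mod ?N"
    using semiregular_funpow_inj[OF sr assms(1), of "i mod ?N" s "j mod ?N"] N by simp
  have "gen s \<up> k = gen s \<up> (k mod ?N)" for k
  proof -
    have "gen s \<up> (?N * (k div ?N) + k mod ?N) = gen s \<up> (k mod ?N)"
      by (simp only: G.nat_pow_mult[symmetric] G.nat_pow_pow[symmetric] gen_carrier gen_pow_order
          G.nat_pow_one G.l_one G.nat_pow_closed)
    then show ?thesis by simp
  qed
  then show ?thesis using ij by metis
qed

text \<open>A vertex of the quotient graph is a pair \<open>(v, s)\<close>, standing for the orbit of the coset \<open>v\<close> under
  the generator \<open>s\<close>; the edges are the orbits of the central element \<open>x\<^sup>2 = y\<^sup>3\<close>. \<open>T\<close> is the union of the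
  edges of a tree, and \<open>tree_path T s v g\<close> says that \<open>g\<close> leads from the base coset to \<open>v\<close>, changing the
  generator only at elements of \<open>T\<close>.\<close>

inductive tree_path :: "gamma_elt set set \<Rightarrow> gamma_gen \<Rightarrow> gamma_elt set \<Rightarrow>
    gamma_elt \<Rightarrow> bool" for T where
  base: "tree_path T gen_x H \<epsilon>"
| step: "tree_path T s v g \<Longrightarrow> tree_path T s (v \<triangleleft> gen s) (g \<cdot> gen s)"
| switch: "tree_path T s v g \<Longrightarrow> v \<in> T \<Longrightarrow> tree_path T s' v g"

lemma tree_path_mono: "tree_path T s v g \<Longrightarrow> T \<subseteq> T' \<Longrightarrow> tree_path T' s v g"
  by (induction rule: tree_path.induct) (auto intro: tree_path.intros)

lemma tree_path_coset:
  assumes "tree_path T s v g"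
  shows "g \<in> carrier Gm \<and> v = H \<triangleleft> g \<and> v \<in> X"
  using assms
proof (induction rule: tree_path.induct)
  case base
  then show ?case
    using H_in_rcosets[OF H] subgroup.subset[OF H] by (simp add: G.coset_mult_one)
next
  case (step s v g)
  then show ?case
    using rcos_mult[OF H, of v "gen s"] subgroup.subset[OF H] by (auto simp: G.coset_mult_assoc)
qed simp

lemma coset_gen_pow_Suc:
  "v \<in> X \<Longrightarrow> v \<triangleleft> (gen s \<up> (j :: nat)) \<triangleleft> gen s = v \<triangleleft> (gen s \<up> Suc j)"
  using rcos_mult_assoc[OF H, of v "gen s \<up> j" "gen s"] by (simp only: G.nat_pow_Suc gen_carrier G.nat_pow_closed)

lemma tree_path_pow:
  fixes n :: nat
  assumes "tree_path T s v g"
  shows "tree_path T s (v \<triangleleft> (gen s \<up> n)) (g \<cdot> (gen s \<up> n))"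
proof (induction n)
  case 0
  have "v \<triangleleft> (gen s \<up> (0 :: nat)) = v" "g \<cdot> (gen s \<up> (0 :: nat)) = g"
    using tree_path_coset[OF assms] rcos_mult_one[OF H, of v] by (auto simp only: G.nat_pow_0 G.r_one)
  then show ?case using assms by (simp only:)
next
  case (Suc n)
  have "v \<triangleleft> (gen s \<up> n) \<triangleleft> gen s = v \<triangleleft> (gen s \<up> Suc n)"
    using tree_path_coset[OF assms] by (intro coset_gen_pow_Suc) blast
  moreover have "g \<cdot> (gen s \<up> n) \<cdot> gen s = g \<cdot> (gen s \<up> Suc n)"
    using tree_path_coset[OF assms] by (simp add: G.m_assoc)
  ultimately show ?case using tree_path.step[OF Suc] by simp
qed

text \<open>A coherent choice of coset representatives on a subtree: \<open>U\<close> holds the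
  vertices reached, with every coset in their orbits, and \<open>t v s\<close> leads to v at the
  vertex of s. Across an edge in \<open>T\<close> the two representatives agree.\<close>

definition tree_section :: "(gamma_elt set \<times> gamma_gen) set \<Rightarrow>
    (gamma_elt set \<Rightarrow> gamma_gen \<Rightarrow> gamma_elt) \<Rightarrow> gamma_elt set set \<Rightarrow> bool" where
  "tree_section U t T \<longleftrightarrow> U \<subseteq> X \<times> UNIV \<and> (H, gen_x) \<in> U \<and> t H gen_x = \<epsilon> \<and>
     (\<forall>(v, s) \<in> U. (v \<triangleleft> gen s, s) \<in> U \<and> t (v \<triangleleft> gen s) s = t v s \<cdot> gen s) \<and>
     (\<forall>v \<in> T. \<exists>g. \<forall>s. (v, s) \<in> U \<and> t v s = g) \<and>
     (\<forall>(v, s) \<in> U. tree_path T s v (t v s))"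

text \<open>Continues the representative g of v along its orbit; by \<open>coset_gen_pow_inj\<close>
  the chosen exponent does not affect the power.\<close>

definition orbit_section :: "gamma_elt set \<Rightarrow> gamma_elt \<Rightarrow> gamma_gen \<Rightarrow>
    gamma_elt set \<Rightarrow> gamma_elt" where
  "orbit_section v g s z = g \<cdot> (gen s \<up> (SOME j :: nat. z = v \<triangleleft> (gen s \<up> j)))"

lemma orbit_section_eq:
  assumes "v \<in> X"
  shows "orbit_section v g s (v \<triangleleft> (gen s \<up> (j :: nat))) = g \<cdot> (gen s \<up> j)"
proof -
  let ?P = "\<lambda>i :: nat. v \<triangleleft> (gen s \<up> j) = v \<triangleleft> (gen s \<up> i)"
  have "?P (SOME i. ?P i)" by (rule someI[of ?P j]) simp
  from coset_gen_pow_inj[OF assms this] show ?thesis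
    unfolding orbit_section_def by simp
qed

text \<open>The smallest tree is the single vertex formed by the orbit of H under x, without
  edges.\<close>

lemma ex_tree_section: "\<exists>U t T. tree_section U t T"
proof -
  let ?U = "(\<lambda>j :: nat. (H \<triangleleft> (gen gen_x \<up> j), gen_x)) ` UNIV"
  let ?t = "\<lambda>v s. orbit_section H \<epsilon> gen_x v"
  note HX = H_in_rcosets[OF H]
  note eq = orbit_section_eq[OF HX, of "\<epsilon>" gen_x]
  have H0: "H \<triangleleft> (gen gen_x \<up> (0 :: nat)) = H" using rcos_mult_one[OF H HX] by simp
  have "tree_section ?U ?t {}"
    unfolding tree_section_def
  proof (intro conjI ballI)
    show "?U \<subseteq> X \<times> UNIV" using rcos_mult[OF H HX] by auto
    show "(H, gen_x) \<in> ?U" using H0 by (metis rangeI)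
    show "?t H gen_x = \<epsilon>" using eq[of 0] H0 by simp
  next
    fix a assume "a \<in> ?U"
    then obtain j :: nat where a: "a = (H \<triangleleft> (gen gen_x \<up> j), gen_x)" by blast
    show "case a of (v, s) \<Rightarrow> (v \<triangleleft> gen s, s) \<in> ?U \<and> ?t (v \<triangleleft> gen s) s = ?t v s \<cdot> gen s"
      unfolding a prod.case coset_gen_pow_Suc[OF HX] eq
    proof
      show "(H \<triangleleft> (gen gen_x \<up> Suc j), gen_x) \<in> ?U" by blast
    qed (simp add: G.m_assoc)
    show "case a of (v, s) \<Rightarrow> tree_path {} s v (?t v s)"
      unfolding a prod.case eq by (rule tree_path_pow[OF tree_path.base])
  qed simp
  then show ?thesis by blast
qed

lemma tree_section_pow:
  assumes "tree_section U t T" "(v, s) \<in> U"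
  shows "(v \<triangleleft> (gen s \<up> (n :: nat)), s) \<in> U \<and>
    t (v \<triangleleft> (gen s \<up> n)) s = t v s \<cdot> (gen s \<up> n)"
proof -
  have v: "v \<in> X" and tv: "t v s \<in> carrier Gm"
    using assms tree_path_coset[of T s v "t v s"] by (auto simp: tree_section_def)
  show ?thesis
  proof (induction n)
    case 0
    then show ?case using assms(2) rcos_mult_one[OF H v] tv by simp
  next
    case (Suc n)
    then have "(v \<triangleleft> (gen s \<up> n) \<triangleleft> gen s, s) \<in> U \<and>
        t (v \<triangleleft> (gen s \<up> n) \<triangleleft> gen s) s = t (v \<triangleleft> (gen s \<up> n)) s \<cdot> gen s"
      using assms(1) unfolding tree_section_def by blast
    then show ?case
      unfolding coset_gen_pow_Suc[OF v] using Suc tv by (simp add: G.m_assoc)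
  qed
qed

text \<open>One vertex and one edge are added: the orbit of v under s', and the orbit of v under x^2
  = y^3. On that edge old and new representatives agree because x^2 is a power of either
  generator.\<close>

lemma tree_section_extend:
  assumes ts: "tree_section U t T" and v: "(v, s) \<in> U" "(v, s') \<notin> U"
  shows "\<exists>U' t' T'. tree_section U' t' T' \<and> U \<subset> U'"
proof -
  define a where "a = t v s"
  have vX: "v \<in> X" and a: "a \<in> carrier Gm"
    using ts v(1) tree_path_coset[of T s v "t v s"] by (auto simp: tree_section_def a_def)
  define O' where "O' = (\<lambda>j :: nat. (v \<triangleleft> (gen s' \<up> j), s')) ` UNIV"
  define U' where "U' = U \<union> O'"
  define T' where "T' = T \<union> (\<lambda>i :: nat. v \<triangleleft> (gen gen_x \<up> (2 * i))) ` UNIV"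
  define t' where "t' z r = (if (z, r) \<in> U then t z r else orbit_section v a s' z)" for z r
  \<comment> \<open>Continuing around the cycle of s' returns to v, so a single point of this orbit
    in \<open>U\<close> would put v there too.\<close>
  have new: "(v \<triangleleft> (gen s' \<up> j), s') \<notin> U" for j :: nat
  proof
    let ?z = "v \<triangleleft> (gen s' \<up> j)" and ?N = "gen_order m s'"
    assume "(?z, s') \<in> U"
    then have "(?z \<triangleleft> (gen s' \<up> (?N * j - j)), s') \<in> U"
      using tree_section_pow[OF ts] by blast
    moreover have "?N > 0" using m_pos by (cases s') (simp_all add: gen_order_def)
    then have "j + (?N * j - j) = ?N * j" by (cases ?N) simp_all
    then have "?z \<triangleleft> (gen s' \<up> (?N * j - j)) = v \<triangleleft> (gen s' \<up> (?N * j))"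
      using rcos_mult_assoc[OF H vX, of "gen s' \<up> j" "gen s' \<up> (?N * j - j)"]
      by (simp add: G.nat_pow_mult)
    moreover have "gen s' \<up> (?N * j) = \<epsilon>"
      using G.nat_pow_pow[OF gen_carrier, of s' ?N j] gen_pow_order[of s'] by simp
    ultimately show False using v(2) rcos_mult_one[OF H vX] by simp
  qed
  have t'_new: "t' (v \<triangleleft> (gen s' \<up> j)) s' = a \<cdot> (gen s' \<up> j)" for j :: nat
    using new orbit_section_eq[OF vX] by (simp add: t'_def)
  have t'_old: "t' z r = t z r" if "(z, r) \<in> U" for z r using that by (simp add: t'_def)
  have v0: "v \<triangleleft> (gen r \<up> (0 :: nat)) = v" for r using rcos_mult_one[OF H vX] by simp
  have vT': "v \<in> T'" using v0[of gen_x] unfolding T'_def by (metis UnI2 mult_0_right rangeI)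
  have central: "gen gen_x \<up> (2 * i) = gen r \<up> (gen_exp r * i)" for i :: nat and r
    using gen_pow_exp[of r] by (simp flip: G.nat_pow_pow)
  have path: "tree_path T' s v a"
    using ts v(1) tree_path_mono[of T s v a T'] by (auto simp: tree_section_def a_def T'_def)
  have "tree_section U' t' T'"
    unfolding tree_section_def
  proof (intro conjI ballI)
    show "U' \<subseteq> X \<times> UNIV"
      using ts rcos_mult[OF H vX] by (auto simp: U'_def O'_def tree_section_def)
    show "(H, gen_x) \<in> U'" "t' H gen_x = \<epsilon>"
      using ts t'_old[of H gen_x] by (simp_all add: U'_def tree_section_def)
  next
    fix p assume "p \<in> U'"
    then consider z r where "p = (z, r)" "(z, r) \<in> U" | j :: nat where "p = (v \<triangleleft> (gen s' \<up> j), s')"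
      unfolding U'_def O'_def by (cases p) blast
    then have "(case p of (v, s) \<Rightarrow> (v \<triangleleft> gen s, s) \<in> U' \<and> t' (v \<triangleleft> gen s) s = t' v s \<cdot> gen s) \<and>
        (case p of (v, s) \<Rightarrow> tree_path T' s v (t' v s))"
    proof cases
      case 1
      have "(z \<triangleleft> gen r, r) \<in> U" "t (z \<triangleleft> gen r) r = t z r \<cdot> gen r" "tree_path T r z (t z r)"
        using ts 1(2) by (auto simp: tree_section_def)
      then show ?thesis
        using 1 t'_old tree_path_mono[of T r z "t z r" T'] by (auto simp: U'_def T'_def)
    next
      case 2
      have "(v \<triangleleft> (gen s' \<up> Suc j), s') \<in> U'" unfolding U'_def O'_def by blast
      moreover have "tree_path T' s' (v \<triangleleft> (gen s' \<up> j)) (a \<cdot> (gen s' \<up> j))"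
        by (rule tree_path_pow[OF tree_path.switch[OF path vT']])
      ultimately show ?thesis
        unfolding 2 prod.case coset_gen_pow_Suc[OF vX] t'_new using a by (simp add: G.m_assoc)
    qed
    then show "case p of (v, s) \<Rightarrow> (v \<triangleleft> gen s, s) \<in> U' \<and> t' (v \<triangleleft> gen s) s = t' v s \<cdot> gen s"
      "case p of (v, s) \<Rightarrow> tree_path T' s v (t' v s)" by blast+
  next
    fix z assume "z \<in> T'"
    then consider "z \<in> T" | i :: nat where "z = v \<triangleleft> (gen gen_x \<up> (2 * i))"
      unfolding T'_def by blast
    then show "\<exists>g. \<forall>s. (z, s) \<in> U' \<and> t' z s = g"
    proof cases
      case 1
      then obtain g where "\<forall>s. (z, s) \<in> U \<and> t z s = g" using ts unfolding tree_section_def by blast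
      then show ?thesis using t'_old by (auto simp: U'_def)
    next
      case 2
      have z: "z = v \<triangleleft> (gen r \<up> (gen_exp r * i))" for r unfolding 2 central[of i r] ..
      define b where "b = a \<cdot> (gen gen_x \<up> (2 * i))"
      have 1: "(z, s') \<in> U'" unfolding z[of s'] U'_def O'_def by blast
      have 2: "t' z s' = b"
        unfolding z[of s'] t'_new central[of i s'] b_def ..
      have 3: "(z, s) \<in> U \<and> t z s = b"
        using tree_section_pow[OF ts v(1), of "gen_exp s * i"] unfolding z[of s, symmetric] a_def b_def central[of i s] .
      have "(z, r) \<in> U' \<and> t' z r = b" for r
      proof -
        have "r = s \<or> r = s'" using v by (cases r; cases s; cases s') auto
        then show ?thesis using 1 2 3 t'_old[of z s] by (auto simp only: U'_def Un_iff)
      qed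
      then show ?thesis by blast
    qed
  qed
  moreover have "U \<subset> U'"
  proof -
    have "(v, s') \<in> O'" unfolding O'_def using v0[of s'] by (intro image_eqI[of _ _ 0]) auto
    then show ?thesis using v(2) unfolding U'_def by blast
  qed
  ultimately show ?thesis by blast
qed

text \<open>A \<open>U\<close> of maximal size is closed under changing the generator, since it
  cannot be extended, and under the generators themselves; by transitivity it is everything.\<close>

lemma ex_full_tree_section: "\<exists>t T. tree_section (X \<times> UNIV) t T"
proof -
  have finU: "finite (X \<times> (UNIV :: gamma_gen set))" using fin by (simp add: UNIV_gamma_gen)
  have bound: "card U < Suc (card (X \<times> (UNIV :: gamma_gen set)))" if "\<exists>t T. tree_section U t T" for U
  proof -
    have "U \<subseteq> X \<times> UNIV" using that unfolding tree_section_def by blast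
    then show ?thesis using card_mono[OF finU] by (simp add: less_Suc_eq_le)
  qed
  obtain U where U: "\<exists>t T. tree_section U t T" and max: "\<And>U'. \<exists>t T. tree_section U' t T \<Longrightarrow> card U' \<le> card U"
  proof -
    obtain U0 where "\<exists>t T. tree_section U0 t T" using ex_tree_section by blast
    from ex_has_greatest_nat[of "\<lambda>U. \<exists>t T. tree_section U t T", OF this, of card] bound
    show thesis using that by (metis less_imp_le)
  qed
  obtain t T where ts: "tree_section U t T" using U by blast
  have all: "(v, s') \<in> U" if "(v, s) \<in> U" for v s s'
  proof (rule ccontr)
    assume "(v, s') \<notin> U"
    then obtain U' t' T' where "tree_section U' t' T'" "U \<subset> U'"
      using tree_section_extend[OF ts \<open>(v, s) \<in> U\<close>] by blast
    moreover from this have "finite U'" using finU finite_subset unfolding tree_section_def by blast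
    ultimately show False using max[of U'] psubset_card_mono[of U' U] by auto
  qed
  have "X \<subseteq> {v. \<forall>s. (v, s) \<in> U}"
  proof -
    have "H \<in> {v. \<forall>s. (v, s) \<in> U}" using ts all[of H gen_x] by (auto simp: tree_section_def)
    moreover have "\<rho> s v \<in> {v. \<forall>s. (v, s) \<in> U}" if "v \<in> X \<inter> {v. \<forall>s. (v, s) \<in> U}" for s v
    proof -
      have "(v \<triangleleft> gen s, s) \<in> U" using that ts unfolding tree_section_def by blast
      then show ?thesis using all that by (auto simp: coset_act_def)
    qed
    ultimately show ?thesis
      by (rule transitive_coset_act[OF H fin, unfolded transitive_action_def, THEN conjunct2, THEN conjunct2,
          rule_format])
  qed
  moreover have "U \<subseteq> X \<times> UNIV" using ts by (simp only: tree_section_def)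
  ultimately have "U = X \<times> UNIV" by auto
  then show ?thesis using ts by blast
qed

end

section \<open>The basis and a covering with fibre the free group\<close>

context free_gamma_subgroup
begin

context
  fixes t T
  assumes ts: "tree_section (X \<times> UNIV) t T"
begin

lemma section_props:
  assumes "v \<in> X"
  shows "t v s \<in> carrier Gm" "v = H \<triangleleft> t v s" "t (v \<triangleleft> gen s) s = t v s \<cdot> gen s"
    "tree_path T s v (t v s)"
proof -
  show p: "tree_path T s v (t v s)" and "t (v \<triangleleft> gen s) s = t v s \<cdot> gen s"
    using ts assms unfolding tree_section_def by auto
  show "t v s \<in> carrier Gm" "v = H \<triangleleft> t v s" using tree_path_coset[OF p] by auto
qed

lemma section_base: "t H gen_x = \<epsilon>"
  using ts by (simp add: tree_section_def)

text \<open>The loop that follows the tree to v, crosses the edge there and returns along the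
  tree.\<close>

definition edge_elt :: "gamma_elt set \<Rightarrow> gamma_elt" where
  "edge_elt v = t v gen_x \<cdot> ginv (t v gen_y)"

lemma edge_elt_carrier: "v \<in> X \<Longrightarrow> edge_elt v \<in> carrier Gm"
  using section_props by (simp add: edge_elt_def)

lemma edge_elt_in_H:
  assumes "v \<in> X"
  shows "edge_elt v \<in> H"
proof -
  note p = section_props[OF assms]
  have sub: "H \<subseteq> carrier Gm" by (rule subgroup.subset[OF H])
  have "H \<triangleleft> t v gen_x \<triangleleft> ginv (t v gen_y) = H \<triangleleft> t v gen_y \<triangleleft> ginv (t v gen_y)"
    using p(2)[of gen_x] p(2)[of gen_y] by simp
  then have "H \<triangleleft> edge_elt v = H"
    unfolding edge_elt_def using p(1) sub by (simp add: G.coset_mult_assoc G.coset_mult_one)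
  then show ?thesis using coset_eq_iff[OF H edge_elt_carrier[OF assms]] by blast
qed

lemma section_pow:
  assumes "v \<in> X"
  shows "t (v \<triangleleft> (gen s \<up> (n :: nat))) s = t v s \<cdot> (gen s \<up> n)"
  using tree_section_pow[OF ts, of v s n] assms by blast

abbreviation "central \<equiv> gen gen_x \<up> 2"

text \<open>Both representatives acquire the same right factor, which cancels; the loop depends only
  on the edge.\<close>

lemma edge_elt_central:
  assumes "v \<in> X"
  shows "edge_elt (v \<triangleleft> central) = edge_elt v"
proof -
  have "t (v \<triangleleft> central) s = t v s \<cdot> central" for s
    using section_pow[OF assms, of s "gen_exp s"] unfolding gen_pow_exp .
  then show ?thesis
    using section_props(1)[OF assms]
    by (simp add: edge_elt_def G.inv_mult_group G.m_assoc) (simp flip: G.m_assoc)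
qed

lemma edge_elt_tree:
  assumes "v \<in> T" "v \<in> X"
  shows "edge_elt v = \<epsilon>"
proof -
  have "t v gen_x = t v gen_y" using ts assms(1) unfolding tree_section_def by metis
  then show ?thesis using section_props(1)[OF assms(2)] by (simp add: edge_elt_def)
qed

definition basis :: "gamma_elt set" where
  "basis = edge_elt ` X - {\<epsilon>}"

abbreviation "F \<equiv> presented_group basis {}"

abbreviation fmult (infixl "\<odot>" 70) where "a \<odot> b \<equiv> a \<otimes>\<^bsub>F\<^esub> b"
abbreviation finv where "finv a \<equiv> inv\<^bsub>F\<^esub> a"
abbreviation fone ("\<eta>") where "\<eta> \<equiv> \<one>\<^bsub>F\<^esub>"

interpretation F: group F by (rule group_presented_group)

text \<open>The vertices of x serve as reference and carry trivial labels. A trivial edge element is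
  not a letter and gives the identity.\<close>

definition label :: "gamma_gen \<Rightarrow> gamma_elt set \<Rightarrow> gamma_elt group_word set" where
  "label s v = (if s = gen_x \<or> edge_elt v = \<epsilon> then \<eta> else word_class basis {} [(edge_elt v, True)])"

lemma label_x: "label gen_x v = \<eta>"
  by (simp add: label_def)

lemma label_carrier:
  assumes "v \<in> X"
  shows "label s v \<in> carrier F"
proof (cases "s = gen_x \<or> edge_elt v = \<epsilon>")
  case False
  then have "[(edge_elt v, True)] \<in> words basis" using assms by (auto simp: basis_def words_def)
  then show ?thesis using False by (simp add: label_def word_class_in_carrier)
qed (simp add: label_def)

lemma label_central: "v \<in> X \<Longrightarrow> label s (v \<triangleleft> central) = label s v"
  by (simp add: label_def edge_elt_central)

abbreviation "Z \<equiv> X \<times> carrier F"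

text \<open>The action on the covering of the quotient graph with group \<open>F\<close>: changing from the orbit of \<open>x\<close> to that of \<open>y\<close> at
  the coset \<open>v\<close> multiplies the second component by the label of the edge through \<open>v\<close>. Since labels are constant
  on edges, the relation \<open>x\<^sup>2 = y\<^sup>3\<close> is respected.\<close>

definition cover_act :: "gamma_gen \<Rightarrow> gamma_elt set \<times> gamma_elt group_word set \<Rightarrow>
    gamma_elt set \<times> gamma_elt group_word set" where
  "cover_act s z = (if z \<in> Z then
     (fst z \<triangleleft> gen s, snd z \<odot> label s (fst z) \<odot> finv (label s (fst z \<triangleleft> gen s))) else z)"

lemma cover_act_eq:
  "v \<in> X \<Longrightarrow> w \<in> carrier F \<Longrightarrow> cover_act s (v, w) =
     (v \<triangleleft> gen s, w \<odot> label s v \<odot> finv (label s (v \<triangleleft> gen s)))"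
  by (simp add: cover_act_def)

lemma F_cancel:
  "a \<in> carrier F \<Longrightarrow> b \<in> carrier F \<Longrightarrow> a \<odot> finv b \<odot> b = a"
  "a \<in> carrier F \<Longrightarrow> b \<in> carrier F \<Longrightarrow> a \<odot> b \<odot> finv b = a"
  by (simp_all add: F.m_assoc)

lemma cover_act_permutes: "cover_act s permutes Z"
proof (rule bij_imp_permutes)
  let ?h = "\<lambda>v. v \<triangleleft> ginv (gen s)"
  have h: "?h v \<in> X" "?h v \<triangleleft> gen s = v" "?h (v \<triangleleft> gen s) = v" "v \<triangleleft> gen s \<in> X" if "v \<in> X" for v
    using that by (auto simp: rcos_mult[OF H] rcos_mult_assoc[OF H] rcos_mult_one[OF H])
  show "bij_betw (cover_act s) Z Z"
  proof (rule bij_betwI[where g = "\<lambda>(v, w). (?h v, w \<odot> label s v \<odot> finv (label s (?h v)))"])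
    show "cover_act s \<in> Z \<rightarrow> Z"
      using h label_carrier by (auto simp: cover_act_eq)
    show "(\<lambda>(v, w). (?h v, w \<odot> label s v \<odot> finv (label s (?h v)))) \<in> Z \<rightarrow> Z"
      using h label_carrier by auto
  next
    fix z assume "z \<in> Z"
    then obtain v w where z: "z = (v, w)" "v \<in> X" "w \<in> carrier F" by blast
    show "(\<lambda>(v, w). (?h v, w \<odot> label s v \<odot> finv (label s (?h v)))) (cover_act s z) = z"
      unfolding z(1) cover_act_eq[OF z(2,3)] prod.case h(3)[OF z(2)]
      using label_carrier[OF z(2), of s] label_carrier[OF h(4)[OF z(2)], of s] z(3) by (simp add: F_cancel)
    show "cover_act s ((\<lambda>(v, w). (?h v, w \<odot> label s v \<odot> finv (label s (?h v)))) z) = z"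
      unfolding z(1) prod.case
      using label_carrier[OF z(2), of s] label_carrier[OF h(1)[OF z(2)], of s] z(3) h(1)[OF z(2)]
      by (subst cover_act_eq) (simp_all add: F_cancel h(2)[OF z(2)])
  qed
qed (simp add: cover_act_def)

text \<open>The labels telescope; only those at the two ends survive.\<close>

lemma cover_act_funpow:
  assumes "v \<in> X" "w \<in> carrier F"
  shows "(cover_act s ^^ n) (v, w) = (v \<triangleleft> (gen s \<up> n),
     w \<odot> label s v \<odot> finv (label s (v \<triangleleft> (gen s \<up> n))))"
proof (induction n)
  case 0
  have "v \<triangleleft> (gen s \<up> (0 :: nat)) = v" using rcos_mult_one[OF H assms(1)] by (simp only: G.nat_pow_0)
  then show ?case using assms label_carrier[OF assms(1), of s] by (simp only: funpow_0 F_cancel)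
next
  case (Suc n)
  let ?v = "v \<triangleleft> (gen s \<up> n)"
  have v: "?v \<in> X" "v \<triangleleft> (gen s \<up> Suc n) \<in> X" by (rule rcos_mult[OF H assms(1)]; simp del: G.nat_pow_Suc)+
  show ?case
    unfolding funpow.simps(2) comp_apply Suc
    using assms label_carrier[OF assms(1), of s] label_carrier[OF v(1), of s]
    by (subst cover_act_eq) (simp_all add: v coset_gen_pow_Suc F_cancel del: G.nat_pow_Suc)
qed

lemma relations_hold_cover_act: "relations_hold (gamma_rel m) cover_act"
proof -
  have out: "(cover_act s ^^ n) z = z" if "z \<notin> Z" for s n z
    using permutes_not_in[OF permutes_funpow[OF cover_act_permutes] that] .
  have 1: "(cover_act s ^^ gen_order m s) z = z" for s z
  proof (cases "z \<in> Z")
    case True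
    then obtain v w where z: "z = (v, w)" "v \<in> X" "w \<in> carrier F" by blast
    have "v \<triangleleft> (gen s \<up> gen_order m s) = v"
      unfolding gen_pow_order by (rule rcos_mult_one[OF H z(2)])
    then show ?thesis
      unfolding z(1) cover_act_funpow[OF z(2,3)] using label_carrier[OF z(2), of s] z(3) by (simp only: F_cancel)
  qed (rule out)
  have 2: "(cover_act s ^^ gen_exp s) z = (if z \<in> Z then (fst z \<triangleleft> central, snd z) else z)" for s z
  proof (cases "z \<in> Z")
    case True
    then obtain v w where z: "z = (v, w)" "v \<in> X" "w \<in> carrier F" by blast
    show ?thesis
      unfolding z(1) cover_act_funpow[OF z(2,3)] gen_pow_exp label_central[OF z(2)]
      using label_carrier[OF z(2), of s] z by (simp add: F_cancel)
  qed (simp add: out)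
  have "cover_act gen_x ^^ 2 = cover_act gen_y ^^ 3"
    using 2[of gen_x] 2[of gen_y] by (intro HOL.ext) (simp add: gen_exp_def)
  then show ?thesis
    unfolding relations_hold_def gamma_rel_word_act
    using 1 permutes_bij[OF cover_act_permutes] by auto
qed

abbreviation "cact \<equiv> class_act cover_act"

text \<open>Left multiplication by elements of F and the projection to cosets are equivariant maps
  on the covering, hence compatible with all words.\<close>

lemma cact_Z: "g \<in> carrier Gm \<Longrightarrow> z \<in> Z \<Longrightarrow> cact g z \<in> Z"
  and cact_left: "g \<in> carrier Gm \<Longrightarrow> z \<in> Z \<Longrightarrow> b \<in> carrier F \<Longrightarrow>
      cact g (fst z, b \<odot> snd z) = (fst (cact g z), b \<odot> snd (cact g z))"
  and cact_fst: "g \<in> carrier Gm \<Longrightarrow> z \<in> Z \<Longrightarrow> fst (cact g z) = fst z \<triangleleft> g"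
proof -
  assume g: "g \<in> carrier Gm" and z: "z \<in> Z"
  then obtain u where u: "g = cls u" unfolding carrier_presented_group by blast
  have cact: "cact g = word_act cover_act u"
    unfolding u by (rule class_act_word_class[OF relations_hold_cover_act])
  have eqv1: "equivariant_on Z cover_act \<rho> fst"
    unfolding equivariant_on_def by (auto simp: cover_act_def coset_act_def)
  have wa: "word_act cover_act u z \<in> Z \<and> fst (word_act cover_act u z) = word_act \<rho> u (fst z)"
    by (rule equivariant_word_act[OF cover_act_permutes coset_act_permutes[OF H] _ eqv1 z]) auto
  show "cact g z \<in> Z" using wa unfolding cact by blast
  have "fst z \<in> X" using z by auto
  then show "fst (cact g z) = fst z \<triangleleft> g"
    using wa word_act_coset_act[OF H, of "fst z" u] unfolding cact by (simp only: u)
  assume b: "b \<in> carrier F"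
  have eqv2: "equivariant_on Z cover_act cover_act (\<lambda>z. (fst z, b \<odot> snd z))"
    unfolding equivariant_on_def
  proof (intro allI ballI)
    fix s z assume "z \<in> Z"
    then obtain v w where z: "z = (v, w)" "v \<in> X" "w \<in> carrier F" by blast
    then show "(fst (cover_act s z), b \<odot> snd (cover_act s z)) = cover_act s (fst z, b \<odot> snd z)"
      using b label_carrier[of v s] label_carrier[of "v \<triangleleft> gen s" s] rcos_mult[OF H, of v "gen s"]
      by (simp add: cover_act_eq F.m_assoc)
  qed
  have "word_act cover_act u z \<in> Z \<and>
     (fst (word_act cover_act u z), b \<odot> snd (word_act cover_act u z)) = word_act cover_act u (fst z, b \<odot> snd z)"
    by (rule equivariant_word_act[OF cover_act_permutes cover_act_permutes _ eqv2 z]) (use b in auto)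
  then show "cact g (fst z, b \<odot> snd z) = (fst (cact g z), b \<odot> snd (cact g z))"
    unfolding cact by simp
qed

lemma base_Z: "(H, \<eta>) \<in> Z"
  using H_in_rcosets[OF H] by simp

lemma cact_gen: "cact (gen s) z = cover_act s z"
  unfolding class_act_word_class[OF relations_hold_cover_act] by (simp add: letter_act_def)

text \<open>The generator changes only at edges with trivial label, so just the label at the end
  point remains.\<close>

lemma cact_tree_path:
  assumes "tree_path T s v g"
  shows "cact g (H, \<eta>) = (v, finv (label s v))"
  using assms
proof (induction rule: tree_path.induct)
  case base
  then show ?case by (simp add: class_act_one[OF relations_hold_cover_act] label_x)
next
  case (step s v g)
  have g: "g \<in> carrier Gm" "v \<in> X" using tree_path_coset[OF step(1)] by auto
  have v': "v \<triangleleft> gen s \<in> X" using rcos_mult[OF H g(2)] by simp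
  have "cact (g \<cdot> gen s) (H, \<eta>) = cover_act s (v, finv (label s v))"
    unfolding class_act_mult[OF relations_hold_cover_act g(1) gen_carrier] step.IH cact_gen ..
  also have "\<dots> = (v \<triangleleft> gen s, finv (label s (v \<triangleleft> gen s)))"
    using label_carrier[OF g(2), of s] label_carrier[OF v', of s] g by (simp add: cover_act_eq)
  finally show ?case .
next
  case (switch s v g s')
  have "v \<in> X" using tree_path_coset[OF switch(1)] by auto
  then have "label r v = \<eta>" for r using edge_elt_tree[OF switch(2)] by (simp add: label_def)
  then show ?case using switch.IH by simp
qed

text \<open>The monodromy of the covering: elements of H move the base point within its
  fibre.\<close>

definition free_map :: "gamma_elt \<Rightarrow> gamma_elt group_word set" where
  "free_map g = snd (cact g (H, \<eta>))"

lemma cact_H: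
  assumes "g \<in> H"
  shows "cact g (H, \<eta>) = (H, free_map g)" "free_map g \<in> carrier F"
proof -
  have g: "g \<in> carrier Gm" using assms subgroup.subset[OF H] by blast
  have "fst (cact g (H, \<eta>)) = H"
    using cact_fst[OF g base_Z] coset_eq_iff[OF H g] assms by simp
  then show "cact g (H, \<eta>) = (H, free_map g)" by (simp add: free_map_def prod_eq_iff)
  show "free_map g \<in> carrier F" using cact_Z[OF g base_Z] by (auto simp: free_map_def)
qed

lemma free_map_hom: "free_map \<in> hom (Gm\<lparr>carrier := H\<rparr>) F"
proof (rule homI)
  fix g g' assume gg': "g \<in> carrier (Gm\<lparr>carrier := H\<rparr>)" "g' \<in> carrier (Gm\<lparr>carrier := H\<rparr>)"
  then have g: "g \<in> carrier Gm" "g' \<in> carrier Gm" "g \<in> H" "g' \<in> H" using subgroup.subset[OF H] by auto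
  have "cact (g \<cdot> g') (H, \<eta>) = cact g' (H, free_map g)"
    unfolding class_act_mult[OF relations_hold_cover_act g(1,2)] cact_H(1)[OF g(3)] ..
  also have "\<dots> = (H, free_map g \<odot> free_map g')"
    using cact_left[OF g(2) base_Z cact_H(2)[OF g(3)]] cact_H[OF g(3)] cact_H(1)[OF g(4)] by simp
  finally show "free_map (g \<otimes>\<^bsub>Gm\<lparr>carrier := H\<rparr>\<^esub> g') = free_map g \<odot> free_map g'"
    by (simp add: free_map_def)
qed (use cact_H in auto)

text \<open>The tree parts of the loop contribute nothing, and crossing the edge contributes its
  label.\<close>

lemma free_map_edge_elt:
  assumes v: "v \<in> X"
  shows "free_map (edge_elt v) = label gen_y v"
proof -
  note p = section_props[OF v]
  have 1: "cact (t v gen_x) (H, \<eta>) = (v, \<eta>)"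
    using cact_tree_path[OF p(4)[of gen_x]] by (simp add: label_x)
  have 2: "cact (t v gen_y) (H, label gen_y v) = (v, \<eta>)"
    using cact_left[OF p(1)[of gen_y] base_Z label_carrier[OF v, of gen_y]] cact_tree_path[OF p(4)[of gen_y]]
      label_carrier[OF v, of gen_y] by simp
  have "cact (edge_elt v) (H, \<eta>) = cact (ginv (t v gen_y)) (v, \<eta>)"
    unfolding edge_elt_def
    using class_act_mult[OF relations_hold_cover_act p(1)[of gen_x] G.inv_closed[OF p(1)[of gen_y]]] 1 by simp
  also have "\<dots> = (H, label gen_y v)"
    using class_act_inv[OF relations_hold_cover_act p(1)[of gen_y], of "(H, label gen_y v)"] 2 by simp
  finally show ?thesis by (simp add: free_map_def)
qed

section \<open>The inverse of the map into the free group\<close>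

definition realize :: "gamma_elt group_word set \<Rightarrow> gamma_elt" where
  "realize = G.class_eval (\<lambda>b. b)"

lemma basis_carrier: "(\<lambda>b. b) \<in> basis \<rightarrow> carrier Gm"
  using edge_elt_carrier by (auto simp: basis_def)

lemma realize_hom: "realize \<in> hom F Gm"
  unfolding realize_def by (rule G.class_eval_hom[OF basis_carrier])

interpretation realize: group_hom F Gm realize
  using realize_hom by (simp add: group_hom_def group_hom_axioms_def F.is_group G.is_group)

lemma realize_label:
  assumes "v \<in> X"
  shows "realize (label gen_y v) = edge_elt v"
proof (cases "edge_elt v = \<epsilon>")
  case True
  then show ?thesis by (simp add: label_def)
next
  case False
  then have "[(edge_elt v, True)] \<in> words basis" using assms by (auto simp: basis_def words_def)
  then show ?thesis
    using False edge_elt_carrier[OF assms]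
    by (simp add: label_def realize_def G.class_eval_word_class[OF basis_carrier])
qed

text \<open>A developing map from the covering to the group, under which generators act by right
  multiplication; the position of the moved base point thus reveals the group element.\<close>

definition position :: "gamma_elt set \<times> gamma_elt group_word set \<Rightarrow> gamma_elt" where
  "position z = realize (snd z) \<cdot> t (fst z) gen_x"

lemma position_carrier: "z \<in> Z \<Longrightarrow> position z \<in> carrier Gm"
  using section_props(1) by (auto simp: position_def)

text \<open>For y, the realized labels are edge elements, which exchange the representative of a
  coset at the vertex of x for the one at the vertex of y; the latter is multiplied by y along the
  step.\<close>

lemma position_cover_act:
  assumes "z \<in> Z"
  shows "position (cover_act s z) = position z \<cdot> gen s"
proof -
  obtain v w where z: "z = (v, w)" "v \<in> X" "w \<in> carrier F" using assms by blast
  have v': "v \<triangleleft> gen s \<in> X" by (rule rcos_mult[OF H z(2) gen_carrier])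
  have rw: "realize w \<in> carrier Gm" using z(3) by simp
  note p = section_props[OF z(2)] section_props[OF v']
  show ?thesis
  proof (cases s)
    case gen_x
    then show ?thesis
      using z rw p v' by (simp add: position_def cover_act_eq label_x G.m_assoc)
  next
    case gen_y
    have "position (cover_act s z) =
        realize w \<cdot> edge_elt v \<cdot> ginv (edge_elt (v \<triangleleft> gen gen_y)) \<cdot> t (v \<triangleleft> gen gen_y) gen_x"
      using z v' label_carrier[OF z(2), of gen_y] label_carrier[OF v', of gen_y] realize_label[OF z(2)] realize_label[OF v']
      by (simp add: position_def cover_act_eq gen_y)
    also have "ginv (edge_elt (v \<triangleleft> gen gen_y)) =
        t (v \<triangleleft> gen gen_y) gen_y \<cdot> ginv (t (v \<triangleleft> gen gen_y) gen_x)"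
      unfolding edge_elt_def using p(5) gen_y by (simp add: G.inv_mult_group)
    also have "realize w \<cdot> edge_elt v \<cdot> (t (v \<triangleleft> gen gen_y) gen_y \<cdot> ginv (t (v \<triangleleft> gen gen_y) gen_x))
        \<cdot> t (v \<triangleleft> gen gen_y) gen_x = realize w \<cdot> edge_elt v \<cdot> t (v \<triangleleft> gen gen_y) gen_y"
      using rw edge_elt_carrier[OF z(2)] p(5) gen_y by (simp add: G.m_assoc)
    also have "t (v \<triangleleft> gen gen_y) gen_y = t v gen_y \<cdot> gen gen_y"
      by (rule p(3))
    also have "realize w \<cdot> edge_elt v \<cdot> (t v gen_y \<cdot> gen gen_y) = position z \<cdot> gen s"
      using z rw p(1) by (simp add: position_def edge_elt_def gen_y G.m_assoc G.inv_mult_cancel)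
    finally show ?thesis .
  qed
qed

lemma position_word_act:
  assumes "z \<in> Z"
  shows "word_act cover_act u z \<in> Z \<and>
    position (word_act cover_act u z) = position z \<cdot> cls u"
  using assms
proof (induction u arbitrary: z)
  case Nil
  then show ?case using position_carrier by (simp flip: one_presented_group)
next
  case (Cons l u)
  obtain s b where l: "l = (s, b)" by force
  define z' where "z' = letter_act cover_act l z"
  have z': "z' \<in> Z \<and> position z' = position z \<cdot> cls [l]"
  proof (cases b)
    case True
    then show ?thesis
      using Cons.prems permutes_in_image[OF cover_act_permutes] position_cover_act
      by (simp add: z'_def letter_act_def l)
  next
    case False
    have 1: "z' \<in> Z" "cover_act s z' = z"
      using False Cons.prems permutes_in_image[OF permutes_inv[OF cover_act_permutes]]
        permutes_inverses(1)[OF cover_act_permutes] by (auto simp: z'_def letter_act_def l)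
    have "position z = position z' \<cdot> gen s" using position_cover_act[OF 1(1), of s] 1(2) by simp
    then have "position z \<cdot> ginv (gen s) = position z'"
      using position_carrier[OF 1(1)] by (simp add: G.m_assoc)
    then show ?thesis
      using 1(1) word_class_inverse_letter[of s UNIV "gamma_rel m" True] False by (simp add: l)
  qed
  have "cls [l] \<cdot> cls u = cls (l # u)"
    using mult_word_class[OF words_UNIV[of "[l]"] words_UNIV[of u], of "gamma_rel m"] by simp
  moreover have "cls u \<in> carrier Gm" "cls [l] \<in> carrier Gm"
    by (rule word_class_carrier[OF H])+
  ultimately show ?case
    using Cons.IH[of z'] z' position_carrier[OF Cons.prems] by (simp add: z'_def G.m_assoc)
qed

lemma realize_free_map:
  assumes "g \<in> H"
  shows "realize (free_map g) = g"
proof -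
  have g: "g \<in> carrier Gm" using assms subgroup.subset[OF H] by blast
  then obtain u where u: "g = cls u" unfolding carrier_presented_group by blast
  have "position (cact g (H, \<eta>)) = position (H, \<eta>) \<cdot> g"
    using position_word_act[OF base_Z, of u] unfolding u class_act_word_class[OF relations_hold_cover_act] by blast
  then show ?thesis
    using g cact_H[OF assms] by (simp add: position_def section_base)
qed

text \<open>Injectivity comes from the left inverse \<open>realize\<close>. For surjectivity, the
  image is a subgroup that contains every letter, as the image of the corresponding edge
  element.\<close>

lemma free_map_iso: "free_map \<in> iso (Gm\<lparr>carrier := H\<rparr>) F"
proof -
  interpret GH: group "Gm\<lparr>carrier := H\<rparr>" by (rule subgroup.subgroup_is_group[OF H G.is_group])
  interpret fm: group_hom "Gm\<lparr>carrier := H\<rparr>" F free_map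
    using free_map_hom by (simp add: group_hom_def group_hom_axioms_def GH.is_group F.is_group)
  have img: "subgroup (free_map ` H) F" using fm.img_is_subgroup by simp
  have letters: "word_class basis {} [(b, c)] \<in> free_map ` H" if "b \<in> basis" for b c
  proof -
    obtain v where v: "v \<in> X" "b = edge_elt v" "b \<noteq> \<epsilon>" using \<open>b \<in> basis\<close> by (auto simp: basis_def)
    have "word_class basis {} [(b, True)] = free_map b"
      using free_map_edge_elt[OF v(1)] v(2,3) by (simp add: label_def)
    then have 1: "word_class basis {} [(b, True)] \<in> free_map ` H" using edge_elt_in_H[OF v(1)] v(2) by blast
    then have "finv (word_class basis {} [(b, True)]) \<in> free_map ` H"
      by (rule subgroup.m_inv_closed[OF img])
    then show ?thesis
      using 1 word_class_inverse_letter[OF that, of "{}" True] by (cases c) simp_all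
  qed
  have words: "word_class basis {} w \<in> free_map ` H" if "w \<in> words basis" for w
    using that
  proof (induction w)
    case Nil
    then show ?case using subgroup.one_closed[OF img] by (simp add: one_presented_group)
  next
    case (Cons l w)
    obtain b c where l: "l = (b, c)" by force
    have w: "b \<in> basis" "w \<in> words basis" "[(b, c)] \<in> words basis" using Cons.prems by (auto simp: l words_def)
    have "word_class basis {} [(b, c)] \<odot> word_class basis {} w \<in> free_map ` H"
      by (rule subgroup.m_closed[OF img letters[OF w(1)] Cons.IH[OF w(2)]])
    then show ?case unfolding mult_word_class[OF w(3,2)] by (simp add: l)
  qed
  have "free_map ` H = carrier F"
    using words subgroup.subset[OF img] unfolding carrier_presented_group by blast
  moreover have "inj_on free_map H"
    by (rule inj_on_inverseI[of _ realize]) (rule realize_free_map)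
  ultimately show ?thesis
    using free_map_hom by (simp add: iso_def bij_betw_def)
qed

end

lemma gamma_action_imp_free: "free_group (Gm\<lparr>carrier := H\<rparr>)"
proof -
  obtain t T where ts: "tree_section (X \<times> UNIV) t T" using ex_full_tree_section by blast
  have "Gm\<lparr>carrier := H\<rparr> \<cong> presented_group (basis t) {}"
    using free_map_iso[OF ts] unfolding is_iso_def by blast
  then show ?thesis
    unfolding free_group_def using subgroup.subgroup_is_group[OF H G.is_group] by blast
qed

end

section \<open>Counting free subgroups\<close>

definition free_subgroups :: "nat \<Rightarrow> nat \<Rightarrow> gamma_elt set set" where
  "free_subgroups m k = {H. subgroup H (Gamma3 m) \<and> card (rcosets\<^bsub>Gamma3 m\<^esub> H) = k \<and>
     free_group (Gamma3 m\<lparr>carrier := H\<rparr>)}"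

lemma gamma_action_funpow_equivariant:
  assumes "\<And>s. \<rho> s permutes X" "equivariant_on X \<rho> \<sigma> h" "x \<in> X"
  shows "(\<rho> s ^^ n) x \<in> X \<and> h ((\<rho> s ^^ n) x) = (\<sigma> s ^^ n) (h x)"
proof (rule funpow_equivariant[OF _ _ assms(3)])
  show "\<rho> s x \<in> X" if "x \<in> X" for x using permutes_in_image[OF assms(1)] that by blast
  show "h (\<rho> s x) = \<sigma> s (h x)" if "x \<in> X" for x using assms(2) that by (simp add: equivariant_on_def)
qed

lemma hom_coeff_pos: "m > 0 \<Longrightarrow> hom_coeff m k > 0"
  by (simp add: hom_coeff_def)

text \<open>Each action on \<open>Y\<close> restricts to the orbit of \<open>y0\<close>, which is a copy of the coset space of the
  stabilizer of \<open>y0\<close>, and to the complement of that orbit.\<close>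

lemma card_gamma_action_fibre:
  assumes m: "m > 0" and Y: "finite Y" "y0 \<in> Y" "card Y = 6 * m * l"
    and H_free: "H \<in> free_subgroups m (6 * m * k)" and k: "0 < k" "k \<le> l"
  shows "of_nat (card {\<sigma>. gamma_action m Y \<sigma> \<and>
      extends_action (coset_space (gamma_rel m) H) H (coset_act (gamma_rel m) H) Y y0 \<sigma>}) =
    fact (6 * m * l - 1) * hom_coeff m (l - k)"
proof -
  interpret gamma_subgroup m H
    by (rule gamma_subgroup.intro[OF m]) (use H_free in \<open>simp add: free_subgroups_def Gamma3_eq\<close>)
  have cX: "card X = 6 * m * k" and "free_group (Gm\<lparr>carrier := H\<rparr>)"
    using H_free by (simp_all add: free_subgroups_def Gamma3_eq)
  then have act: "gamma_action m X \<rho>" using free_imp_gamma_action by blast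
  have fX: "finite X" using cX m k(1) by (intro card_ge_0_finite) simp
  define C where "C B = {\<sigma>. gamma_action m B \<sigma>}" for B :: "'a set"
  have nk: "6 * m * l - 6 * m * k = 6 * m * (l - k)" by (simp add: diff_mult_distrib2)
  have le: "6 * m * k \<le> 6 * m * l" using k by simp
  \<comment> \<open>A sample set with the size of the complement; the number of actions depends on
    the size alone.\<close>
  obtain D0 where D0: "D0 \<subseteq> Y" "card D0 = 6 * m * (l - k)"
    using obtain_subset_with_card_n[of "6 * m * (l - k)" Y] Y nk by auto
  define a where "a = card (C D0)"
  have a: "of_nat a = fact (6 * m * (l - k)) * hom_coeff m (l - k)"
    unfolding a_def C_def using D0 Y m by (intro card_gamma_action) (auto intro: finite_subset)
  have "card {\<sigma> \<in> C Y. extends_action X H \<rho> Y y0 \<sigma>} * fact (card Y - card X) = fact (card Y - 1) * a"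
  proof (rule card_extends_action[OF fX Y(1,2) _ transitive_coset_act[OF H fX]])
    show "card X \<le> card Y" using cX Y(3) le by simp
    show "\<sigma> i permutes B" if "\<sigma> \<in> C B" for B \<sigma> i
      using that gamma_action_relations_hold(2) by (auto simp: C_def)
  next
    fix \<sigma> h assume *: "\<sigma> \<in> C Y" "inj_on h X" "h ` X \<subseteq> Y" "equivariant_on X \<rho> \<sigma> h"
    have "\<sigma> s ` (h ` X) = h ` X" for s
      by (rule image_permutes_equivariant[OF fX coset_act_permutes[OF H, of s]])
         (use *(4) in \<open>auto simp: equivariant_on_def\<close>)
    then show "restrict_action \<sigma> (Y - h ` X) \<in> C (Y - h ` X)"
      using gamma_action_restrict[of m Y \<sigma> "h ` X"] * by (auto simp: C_def)
  next
    fix \<tau> h assume "\<tau> \<in> C (Y - h ` X)" "inj_on h X" "h ` X \<subseteq> Y"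
    then show "glue_action X h \<rho> \<tau> \<in> C Y"
      using gamma_action_glue[OF act] by (auto simp: C_def)
  next
    fix D assume D: "D \<subseteq> Y" "card D = card Y - card X"
    have fD: "finite D" using D Y by (auto intro: finite_subset)
    have "of_nat (card (C D)) = (of_nat a :: rat)"
      unfolding a C_def using D(2) cX Y(3) nk by (intro card_gamma_action[OF fD m]) simp
    then show "finite (C D) \<and> card (C D) = a"
      using card_gamma_action_mult(1)[OF fD m] by (simp add: C_def)
  qed
  then have "card {\<sigma> \<in> C Y. extends_action X H \<rho> Y y0 \<sigma>} * fact (6 * m * (l - k)) = fact (6 * m * l - 1) * a"
    unfolding cX Y(3) nk .
  then have "of_nat (card {\<sigma> \<in> C Y. extends_action X H \<rho> Y y0 \<sigma>} * fact (6 * m * (l - k))) =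
      (of_nat (fact (6 * m * l - 1) * a) :: rat)" by (simp only:)
  then have "of_nat (card {\<sigma> \<in> C Y. extends_action X H \<rho> Y y0 \<sigma>}) = fact (6 * m * l - 1) * hom_coeff m (l - k)"
    by (simp add: a)
  then show ?thesis by (simp add: C_def)
qed

text \<open>The coset space of the stabilizer embeds equivariantly into Y as the orbit of y0. Its
  cycles are therefore full, which makes the stabilizer free and its index a multiple of 6
  m.\<close>

lemma stabilizer_in_free_subgroups:
  assumes m: "m > 0" and Y: "finite Y" "y0 \<in> Y" "card Y = 6 * m * l" and act: "gamma_action m Y \<sigma>"
  defines "H \<equiv> stabilizer_group (gamma_rel m) \<sigma> y0"
  shows "\<exists>k. 0 < k \<and> k \<le> l \<and> H \<in> free_subgroups m (6 * m * k)"
    and "extends_action (coset_space (gamma_rel m) H) H (coset_act (gamma_rel m) H) Y y0 \<sigma>"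
proof -
  note r = gamma_action_relations_hold[OF act]
  interpret gamma_subgroup m H
    by (rule gamma_subgroup.intro[OF m]) (unfold H_def, rule subgroup_stabilizer_group[OF r(1)])
  show ext: "extends_action X H \<rho> Y y0 \<sigma>"
    by (subst extends_action_stabilizer[OF r(1,2) Y(2) H]) (rule H_def[THEN meta_eq_to_obj_eq])
  then obtain h where h: "inj_on h X" "h ` X \<subseteq> Y" "equivariant_on X \<rho> \<sigma> h"
    unfolding extends_action_def by blast
  have fX: "finite X" using h Y(1) by (metis finite_imageD finite_subset)
  have actX: "gamma_action m X \<rho>"
  proof (rule gamma_action_coset_act, rule notI)
    fix v s and i :: nat
    assume v: "v \<in> X" and i: "0 < i" "i < gen_order m s" and eq: "v \<triangleleft> (gen s \<up> i) = v"
    then have "(\<rho> s ^^ i) v = v" by (simp only: coset_act_funpow)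
    then have "(\<sigma> s ^^ i) (h v) = h v"
      using gamma_action_funpow_equivariant[OF coset_act_permutes[OF H] h(3) v, where s = s and n = i] by simp
    then show False using semiregularD(3)[OF r(3) _ i, of "h v"] h(2) v by blast
  qed
  interpret free_gamma_subgroup m H by unfold_locales (rule fX, rule actX)
  obtain k where k: "card X = 6 * m * k" using gamma_action_card[OF fX m actX] by blast
  have "card X \<noteq> 0" using H_in_rcosets[OF H] fX by auto
  then have "k > 0" using k by (cases k) auto
  moreover have "card X \<le> card Y" by (rule card_inj_on_le[OF h(1,2) Y(1)])
  then have "k \<le> l" using k Y(3) m by simp
  moreover have "H \<in> free_subgroups m (6 * m * k)"
    using gamma_action_imp_free k H by (simp add: free_subgroups_def Gamma3_eq)
  ultimately show "\<exists>k. 0 < k \<and> k \<le> l \<and> H \<in> free_subgroups m (6 * m * k)" by blast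
qed

text \<open>Actions on 6 m l points are sorted by the stabilizer of the point 0. By
  \<open>card_gamma_action_fibre\<close> the size of a class depends only on the index of the
  stabilizer; dividing by (6 m l - 1)! leaves the factor 6 m l on the left.\<close>

lemma free_subgroup_recursion:
  assumes m: "m > 0" and l: "l > 0"
  shows "of_nat (6 * m * l) * hom_coeff m l =
    (\<Sum>k\<in>{1..l}. of_nat (card (free_subgroups m (6 * m * k))) * hom_coeff m (l - k))"
proof -
  define n where "n = 6 * m * l"
  have n: "n > 0" using m l by (simp add: n_def)
  define Y where "Y = {..<n}"
  have Y: "finite Y" "0 \<in> Y" "card Y = 6 * m * l" using n by (simp_all add: Y_def n_def)
  let ?E = "\<lambda>H. {\<sigma>. gamma_action m Y \<sigma> \<and>
      extends_action (coset_space (gamma_rel m) H) H (coset_act (gamma_rel m) H) Y 0 \<sigma>}"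
  let ?A = "{\<sigma>. gamma_action m Y \<sigma>}"
  have finA: "finite ?A" by (rule card_gamma_action_mult(1)[OF Y(1) m])
  have stab: "H = stabilizer_group (gamma_rel m) \<sigma> 0" if "H \<in> free_subgroups m k" "\<sigma> \<in> ?E H" for H \<sigma> k
  proof -
    have "gamma_action m Y \<sigma>" using that(2) by blast
    note r = gamma_action_relations_hold[OF this]
    have "subgroup H (presented_group UNIV (gamma_rel m))"
      using that(1) by (simp add: free_subgroups_def Gamma3_eq)
    from extends_action_stabilizer[OF r(1,2) Y(2) this] show ?thesis using that(2) by blast
  qed
  have E: "of_nat (card (?E H)) = fact (n - 1) * hom_coeff m (l - k)"
    if "k \<in> {1..l}" "H \<in> free_subgroups m (6 * m * k)" for H k
    unfolding n_def using that by (intro card_gamma_action_fibre[OF m Y]) auto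
  have ne: "?E H \<noteq> {}" if "k \<in> {1..l}" "H \<in> free_subgroups m (6 * m * k)" for H k
  proof
    assume "?E H = {}"
    then have "of_nat (card (?E H)) = (0 :: rat)" by (simp only: card.empty of_nat_0)
    then show False using E[OF that] hom_coeff_pos[OF m, of "l - k"] by simp
  qed
  \<comment> \<open>Each such subgroup is the stabilizer of 0 in at least one of finitely many
    actions, since its class has positive size.\<close>
  have fin: "finite (free_subgroups m (6 * m * k))" if "k \<in> {1..l}" for k
  proof (rule finite_subset[OF _ finite_imageI[OF finA]])
    show "free_subgroups m (6 * m * k) \<subseteq> (\<lambda>\<sigma>. stabilizer_group (gamma_rel m) \<sigma> 0) ` ?A"
    proof
      fix H assume H: "H \<in> free_subgroups m (6 * m * k)"
      then obtain \<sigma> where "\<sigma> \<in> ?E H" using ne[OF \<open>k \<in> {1..l}\<close> H] by blast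
      then show "H \<in> (\<lambda>\<sigma>. stabilizer_group (gamma_rel m) \<sigma> 0) ` ?A" using stab[OF H] by blast
    qed
  qed
  define P where "P = (SIGMA k : {1..l}. free_subgroups m (6 * m * k))"
  have P: "finite P" unfolding P_def by (intro finite_SigmaI fin) auto
  have "?A = (\<Union>p\<in>P. ?E (snd p))"
  proof (intro equalityI subsetI)
    fix \<sigma> assume "\<sigma> \<in> ?A"
    then have act: "gamma_action m Y \<sigma>" by simp
    define H where "H = stabilizer_group (gamma_rel m) \<sigma> 0"
    obtain k where "0 < k" "k \<le> l" "H \<in> free_subgroups m (6 * m * k)"
      using stabilizer_in_free_subgroups(1)[OF m Y act] unfolding H_def by blast
    then have "(k, H) \<in> P" by (auto simp: P_def)
    moreover have "\<sigma> \<in> ?E H"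
      using stabilizer_in_free_subgroups(2)[OF m Y act] act unfolding H_def by blast
    ultimately show "\<sigma> \<in> (\<Union>p\<in>P. ?E (snd p))" by force
  qed blast
  then have "card ?A = card (\<Union>p\<in>P. ?E (snd p))" by (simp only:)
  also have "\<dots> = (\<Sum>p\<in>P. card (?E (snd p)))"
  proof (rule card_UN_disjoint[OF P])
    show "\<forall>p\<in>P. finite (?E (snd p))" using finA by (auto intro: finite_subset[OF _ finA])
    show "\<forall>p\<in>P. \<forall>q\<in>P. p \<noteq> q \<longrightarrow> ?E (snd p) \<inter> ?E (snd q) = {}"
    proof (intro ballI impI, rule ccontr)
      fix p q assume p: "p \<in> P" and q: "q \<in> P" and pq: "p \<noteq> q" and "?E (snd p) \<inter> ?E (snd q) \<noteq> {}"
      then obtain \<sigma> where \<sigma>: "\<sigma> \<in> ?E (snd p)" "\<sigma> \<in> ?E (snd q)" by blast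
      have H: "snd p \<in> free_subgroups m (6 * m * fst p)" "snd q \<in> free_subgroups m (6 * m * fst q)"
        using p q by (auto simp: P_def)
      \<comment> \<open>An action determines the stabilizer, and the stabilizer determines its
        index.\<close>
      have "snd p = snd q" using stab[OF H(1) \<sigma>(1)] stab[OF H(2) \<sigma>(2)] by simp
      moreover from this have "6 * m * fst p = 6 * m * fst q"
        using H by (simp only: free_subgroups_def mem_Collect_eq)
      then have "fst p = fst q" using m by simp
      ultimately show False using pq by (simp add: prod_eq_iff)
    qed
  qed
  finally have "of_nat (card ?A) = (\<Sum>p\<in>P. of_nat (card (?E (snd p))) :: rat)"
    by (simp only: of_nat_sum)
  also have "\<dots> = (\<Sum>p\<in>P. fact (n - 1) * hom_coeff m (l - fst p))"
    by (rule sum.cong[OF HOL.refl], rule E) (auto simp: P_def)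
  also have "\<dots> = (\<Sum>k\<in>{1..l}. \<Sum>H\<in>free_subgroups m (6 * m * k). fact (n - 1) * hom_coeff m (l - k))"
    unfolding P_def using fin by (subst sum.Sigma) (auto simp: case_prod_beta)
  also have "\<dots> = fact (n - 1) * (\<Sum>k\<in>{1..l}. of_nat (card (free_subgroups m (6 * m * k))) * hom_coeff m (l - k))"
    by (simp add: sum_distrib_left mult_ac)
  finally have "fact n * hom_coeff m l = fact (n - 1) *
      (\<Sum>k\<in>{1..l}. of_nat (card (free_subgroups m (6 * m * k))) * hom_coeff m (l - k))"
    using card_gamma_action[OF Y(1) m Y(3)] by (simp add: n_def)
  moreover have "fact n = of_nat n * (fact (n - 1) :: rat)" by (rule fact_reduce[OF n])
  ultimately show ?thesis by (simp add: n_def mult.assoc mult.left_commute)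
qed

text \<open>For l > 0 the coefficient of z^l is the recursion; the term k = 0 of the product
  accounts for the summand h on the right.\<close>

lemma F_series_hom_coeff:
  assumes m: "m > 0"
  shows "F_series m * Abs_fps (hom_coeff m) =
    Abs_fps (hom_coeff m) + fps_const (of_nat (6 * m)) * fps_X * fps_deriv (Abs_fps (hom_coeff m))"
proof (rule fps_ext)
  fix l
  have F: "fps_nth (F_series m) k = (if k = 0 then 1 else of_nat (card (free_subgroups m (6 * m * k))))" for k
    by (simp add: F_series_def free_subgroup_number_def free_subgroups_def)
  have "fps_nth (F_series m * Abs_fps (hom_coeff m)) l =
      (\<Sum>k\<in>{0..l}. fps_nth (F_series m) k * hom_coeff m (l - k))"
    by (simp add: fps_mult_nth)
  also have "\<dots> = hom_coeff m l + (\<Sum>k\<in>{1..l}. fps_nth (F_series m) k * hom_coeff m (l - k))"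
    by (simp add: sum.atLeast_Suc_atMost F)
  also have "(\<Sum>k\<in>{1..l}. fps_nth (F_series m) k * hom_coeff m (l - k)) = of_nat (6 * m * l) * hom_coeff m l"
  proof (cases "l = 0")
    case False
    then have "of_nat (6 * m * l) * hom_coeff m l =
      (\<Sum>k\<in>{1..l}. of_nat (card (free_subgroups m (6 * m * k))) * hom_coeff m (l - k))"
      by (intro free_subgroup_recursion[OF m]) simp
    also have "\<dots> = (\<Sum>k\<in>{1..l}. fps_nth (F_series m) k * hom_coeff m (l - k))"
      by (rule sum.cong) (auto simp: F)
    finally show ?thesis ..
  qed simp
  also have "of_nat (6 * m * l) * hom_coeff m l =
      fps_nth (fps_const (of_nat (6 * m)) * fps_X * fps_deriv (Abs_fps (hom_coeff m))) l"
    by (cases l) (simp_all add: mult.assoc algebra_simps)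
  finally show "fps_nth (F_series m * Abs_fps (hom_coeff m)) l = fps_nth (Abs_fps (hom_coeff m) +
      fps_const (of_nat (6 * m)) * fps_X * fps_deriv (Abs_fps (hom_coeff m))) l"
    by simp
qed

theorem theorem11:
  fixes m \<alpha> p :: nat
  assumes "m > 0" and "\<alpha> > 0" and "prime p"
  shows "([p = 1] (mod 6) \<longrightarrow>
      (\<exists>P :: int poly.
         fps_cong (F_series m)
           (fps_of_poly (map_poly of_int P) / fps_of_poly (Q m ((p - 1) div 6)) ^ \<alpha>)
           (int p ^ \<alpha>)) \<and>
      degree (Q m ((p - 1) div 6)) = (p - 1) div 6) \<and>
    ([p = 5] (mod 6) \<longrightarrow>
      (\<exists>P :: int poly.
         fps_cong (F_series m)
           (fps_of_poly (map_poly of_int P) / fps_of_poly (Q m ((p - 5) div 6)) ^ \<alpha>)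
           (int p ^ \<alpha>)) \<and>
      degree (Q m ((p - 5) div 6)) = (p - 5) div 6)"
proof -
  have main: "\<exists>P :: int poly. fps_cong (F_series m)
      (fps_of_poly (map_poly of_int P) / fps_of_poly (Q m n) ^ \<alpha>) (int p ^ \<alpha>)"
    if "p = 6 * n + 1 \<or> p = 6 * n + 5" for n
  proof (rule F_series_mod_prime_power[OF assms(3) _ _ that F_series_hom_coeff[OF assms(1)]])
    show "p \<noteq> 2" "p \<noteq> 3" using that by presburger+
  qed
  show ?thesis
  proof (intro conjI impI)
    assume "[p = 1] (mod 6)"
    then have "p = 6 * (p div 6) + 1" using mult_div_mod_eq[of 6 p] by (simp add: cong_def)
    then have "p = 6 * ((p - 1) div 6) + 1" by (metis diff_add_inverse2 nonzero_mult_div_cancel_left zero_neq_numeral)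
    then show "\<exists>P :: int poly. fps_cong (F_series m)
        (fps_of_poly (map_poly of_int P) / fps_of_poly (Q m ((p - 1) div 6)) ^ \<alpha>) (int p ^ \<alpha>)"
      by (intro main) simp
  next
    assume "[p = 5] (mod 6)"
    then have "p = 6 * (p div 6) + 5" using mult_div_mod_eq[of 6 p] by (simp add: cong_def)
    then have "p = 6 * ((p - 5) div 6) + 5" by (metis diff_add_inverse2 nonzero_mult_div_cancel_left zero_neq_numeral)
    then show "\<exists>P :: int poly. fps_cong (F_series m)
        (fps_of_poly (map_poly of_int P) / fps_of_poly (Q m ((p - 5) div 6)) ^ \<alpha>) (int p ^ \<alpha>)"
      by (intro main) simp
  qed (simp_all add: degree_Q[OF assms(1)])
qed

end
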